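(* Let $x,x_1,x_2$ be roots of unity with $x\ne1$, let $a\in\mathbb{C}\setminus\mathbb{Z}$, and let $p_1,p_2,q\in\mathbb{N}$ with $(p_1,x_1)\ne(1,1)$, $(p_2,x_2)\ne(1,1)$ and $(q,xx_1x_2)\neq(1,1)$. Writing $C_m:=(-1)^m\mathrm{Li}_{m+1}(x;1-a)-x\,\mathrm{Li}_{m+1}(x^{-1};a)$ for $m\ge0$, we have \begin{align*} &x\, S_{p_1,p_2;q}^{(a-1)}\big(x_1,x_2;(xx_1x_2)^{-1}\big)+(-1)^{p_1+p_2+q} S_{p_1,p_2;q}^{(-a)}\big(x_1^{-1},x_2^{-1};xx_1x_2\big)\\ &=x\, S_{p_1;p_2+q}^{(a-1)}\big(x_1;(xx_1)^{-1}\big)+x\, S_{p_2;p_1+q}^{(a-1)}\big(x_2;(xx_2)^{-1}\big)\\ &\quad+x\,\mathrm{Li}_{p_1}(x_1;a)S_{p_2;q}^{(a-1)}\big(x_2;(xx_1x_2)^{-1}\big)+x\,\mathrm{Li}_{p_2}(x_2;a)S_{p_1;q}^{(a-1)}\big(x_1;(xx_1x_2)^{-1}\big)\\ &\quad-(-1)^{p_2+q}x_1^{-1}\mathrm{Li}_{p_1}(x_1;a)S_{p_2;q}^{(-a)}\big(x_2^{-1};xx_1x_2\big)-(-1)^{p_1+q}x_2^{-1}\mathrm{Li}_{p_2}(x_2;a)S_{p_1;q}^{(-a)}\big(x_1^{-1};xx_1x_2\big)\\ &\quad+(-1)^{p_1+p_2+q}\mathrm{Li}_{p_1+p_2+q}(x;1-a)-x\,\mathrm{Li}_{p_1}(x_1;a)\mathrm{Li}_{p_2+q}\big((xx_1)^{-1};a\big)\\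 &\quad-x\,\mathrm{Li}_{p_2}(x_2;a)\mathrm{Li}_{p_1+q}\big((xx_2)^{-1};a\big)-x\,\mathrm{Li}_{p_1}(x_1;a)\mathrm{Li}_{p_2}(x_2;a)\mathrm{Li}_q\big((xx_1x_2)^{-1};a\big)\\ &\quad-(-1)^q(x_1x_2)^{-1}\mathrm{Li}_{p_1}(x_1;a)\mathrm{Li}_{p_2}(x_2;a)\mathrm{Li}_q(xx_1x_2;1-a)\\ &\quad-\sum_{\substack{m+k=p_1+q-1\\ m,k\geq 0}}(-1)^k\binom{k+p_2-1}{p_2-1}\mathrm{Li}_{k+p_2}(x_2)\,C_m -\sum_{\substack{m+k=p_2+q-1\\ m,k\geq 0}}(-1)^k\binom{k+p_1-1}{p_1-1}\mathrm{Li}_{k+p_1}(x_1)\,C_m\\ &\quad-(-1)^q\sum_{m=0}^{p_1+p_2-1}\binom{p_1+p_2+q-m-2}{q-1}C_m\,\mathrm{Li}_{p_1+p_2+q-m-1}(xx_1x_2)\\ &\quad-\sum_{\substack{m+k_1+k_2=q-1\\ m,k_1,k_2\geq 0}}(-1)^{k_1+k_2}\binom{k_1+p_1-1}{p_1-1}\binom{k_2+p_2-1}{p_2-1}\mathrm{Li}_{k_1+p_1}(x_1)\mathrm{Li}_{k_2+p_2}(x_2)\,C_m\\ &\quad-(-1)^q\sum_{\substack{m+k\leq p_2-1\\ m,k\geq 0}}\binom{k+p_1-1}{p_1-1}\binom{p_2+q-m-k-2}{q-1}C_m\\ &\qquad\qquad\times\left((-1)^k\mathrm{Li}_{k+p_1}(x_1)\mathrm{Li}_{p_2+q-m-k-1}(xx_1x_2)+(-1)^{p_1}S_{k+p_1;p_2+q-m-k-1}\big(x_1^{-1};xx_1x_2\big)\right)\\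 &\quad-(-1)^q\sum_{\substack{m+k\leq p_1-1\\ m,k\geq 0}}\binom{k+p_2-1}{p_2-1}\binom{p_1+q-m-k-2}{q-1}C_m\\ &\qquad\qquad\times\left((-1)^k\mathrm{Li}_{k+p_2}(x_2)\mathrm{Li}_{p_1+q-m-k-1}(xx_1x_2)+(-1)^{p_2}S_{k+p_2;p_1+q-m-k-1}\big(x_2^{-1};xx_1x_2\big)\right). \end{align*}
   Context: For $|w|\le1$, $m\in\mathbb{N}$ with $(m,w)\ne(1,1)$, $b\in\mathbb{C}\setminus\{0,-1,-2,\dots\}$: $\mathrm{Li}_m(w;b)=\sum_{n\ge1}\frac{w^n}{(n+b-1)^m}$, $\mathrm{Li}_m(w)=\sum_{n\ge1}\frac{w^n}{n^m}$. For $n\ge0$: $\zeta_n(p;w;b)=\sum_{k=1}^n\frac{w^k}{(k+b)^p}$ and $\zeta_n(p;w)=\sum_{k=1}^n\frac{w^k}{k^p}$. For roots of unity $u_1,\dots,u_r,v$, positive integers $p_1,\dots,p_r,q$ with $(q,v)\ne(1,1)$ and $b\in\mathbb{C}\setminus\mathbb{Z}$: $S^{(b)}_{p_1,\dots,p_r;q}(u_1,\dots,u_r;v)=\sum_{n\ge1}\frac{\zeta_n(p_1;u_1;b)\cdots\zeta_n(p_r;u_r;b)}{(n+b)^q}v^n$ (Hurwitz-type cyclotomic Euler $S$-sum), and the cyclotomic Euler sum is $S_{p;q}(u;v)=\sum_{n\ge1}\frac{\zeta_n(p;u)}{n^q}v^n$. *)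

theory Defs
  imports Complex_Main
begin

definition root_of_unity :: "complex \<Rightarrow> bool" where
  "root_of_unity w \<longleftrightarrow> (\<exists>n::nat. n > 0 \<and> w ^ n = 1)"

text \<open>
  All infinite series run over \<open>n \<ge> 1\<close>, hence the index \<open>Suc n\<close>. They may be only
  conditionally convergent (exponent 1 and a root of unity other than 1), so they are
  ordered sums \<^const>\<open>suminf\<close>, that is, limits of partial sums, and not unordered sums.
\<close>

text \<open>
  \<open>Li_hurwitz m w b\<close> is meant for \<open>\<bar>w\<bar> \<le> 1\<close>, \<open>m \<ge> 1\<close>, \<open>(m, w) \<noteq> (1, 1)\<close> and \<open>b\<close> not a
  nonpositive integer, \<open>Li m w\<close> for the same \<open>m\<close> and \<open>w\<close>.
\<close>

definition Li_hurwitz :: "nat \<Rightarrow> complex \<Rightarrow> complex \<Rightarrow> complex" where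
  "Li_hurwitz m w b = (\<Sum>n. w ^ Suc n / (of_nat (Suc n) + b - 1) ^ m)"

definition Li :: "nat \<Rightarrow> complex \<Rightarrow> complex" where
  "Li m w = (\<Sum>n. w ^ Suc n / of_nat (Suc n) ^ m)"

definition zeta_hurwitz :: "nat \<Rightarrow> nat \<Rightarrow> complex \<Rightarrow> complex \<Rightarrow> complex" where
  "zeta_hurwitz n p w b = (\<Sum>k=1..n. w ^ k / (of_nat k + b) ^ p)"

definition zeta_cyc :: "nat \<Rightarrow> nat \<Rightarrow> complex \<Rightarrow> complex" where
  "zeta_cyc n p w = (\<Sum>k=1..n. w ^ k / of_nat k ^ p)"

text \<open>
  \<open>S_hurwitz b [(p\<^sub>1, u\<^sub>1), \<dots>, (p\<^sub>r, u\<^sub>r)] q v\<close> is the Hurwitz-type cyclotomic Euler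
  \<open>S\<close>-sum \<open>S\<^sup>(\<^sup>b\<^sup>)\<close> with upper data \<open>p\<^sub>1, \<dots>, p\<^sub>r; q\<close> and arguments
  \<open>u\<^sub>1, \<dots>, u\<^sub>r; v\<close>. Pairing each exponent with its root of unity
  makes the two lists have the same length \<open>r\<close>.
\<close>

definition S_hurwitz ::
  "complex \<Rightarrow> (nat \<times> complex) list \<Rightarrow> nat \<Rightarrow> complex \<Rightarrow> complex" where
  "S_hurwitz b pus q v =
     (\<Sum>n. (\<Prod>(p, u)\<leftarrow>pus. zeta_hurwitz (Suc n) p u b) / (of_nat (Suc n) + b) ^ q * v ^ Suc n)"

definition S_cyc :: "nat \<Rightarrow> nat \<Rightarrow> complex \<Rightarrow> complex \<Rightarrow> complex" where
  "S_cyc p q u v = (\<Sum>n. zeta_cyc (Suc n) p u / of_nat (Suc n) ^ q * v ^ Suc n)"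

definition C_coeff :: "complex \<Rightarrow> complex \<Rightarrow> nat \<Rightarrow> complex" where
  "C_coeff x a m =
     (-1) ^ m * Li_hurwitz (m + 1) x (1 - a) - x * Li_hurwitz (m + 1) (inverse x) a"

end

theory Submission
  imports Defs "HOL-Analysis.Infinite_Sum" "HOL-Analysis.Uniform_Limit"
    "HOL-Computational_Algebra.Formal_Power_Series"
begin

text \<open>
  Put \<open>\<phi>\<^sub>i(s) = \<Sum>k\<ge>0. y\<^sub>i ^ k / (s + k) ^ p\<^sub>i\<close> and consider the bilateral sum of
  \<open>x powi (- n) * \<phi>\<^sub>1(a + n) * \<phi>\<^sub>2(a + n) / (a + n) ^ q\<close> over all integers \<open>n\<close>. At \<open>y\<^sub>i = x\<^sub>i\<close>,
  writing \<open>\<phi>\<^sub>i(a \<plusminus> n)\<close> through \<open>\<phi>\<^sub>i(a)\<close> and partial zeta sums turns its two halves into the two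
  quadratic Euler sums plus lower terms. On the other hand, for \<open>norm y\<^sub>i < 1\<close> everything converges
  absolutely: expanding the product over pairs \<open>(i, j)\<close>, decomposing
  \<open>1 / ((s + i) ^ p\<^sub>1 * (s + j) ^ p\<^sub>2 * s ^ q)\<close> into partial fractions and summing over \<open>n\<close> first gives
  the coefficients \<open>- C\<^sub>m\<close>, because the bilateral sum of \<open>x powi (- n) / (a + n + k) ^ (m + 1)\<close>
  is \<open>- x ^ k * C\<^sub>m\<close>. The theorem is Abel's limit \<open>y\<^sub>i = r * x\<^sub>i\<close>, \<open>r \<rightarrow> 1\<close>, of the resulting identity.
  (Equivalently: the residues of the paper's kernel function are summed without any contour.)
\<close>

section \<open>Uniform tail bounds by partial summation\<close>

text \<open>With an exponent equal to 1 some of the series converge only conditionally, so on the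
  unit circle neither the expansion over pairs nor the interchange with the sum over
  \<open>n\<close> is available; hence the detour through \<open>norm y < 1\<close>. The price is a
  limit \<open>r -> 1\<close> inside conditionally convergent series on both sides. All of them have
  the shape of a sum of \<open>G n r * hw b q n\<close>, and the limit is harmless once their tails
  are bounded by \<open>C / real (Suc m)\<close> with \<open>C\<close> independent of
  \<open>r\<close>. For \<open>q = 1\<close> such a bound needs cancellation, governed by a ratio
  that stays away from 1: this is the use of the conditions excluding \<open>(1, 1)\<close>, while
  \<open>x \<noteq> 1\<close> makes the bilateral sums of simple poles converge. The second obstacle
  is that powers of \<open>1 / y\<close> are unbounded inside the disc; partial zeta sums are
  therefore carried in a renormalised form and become Euler sums again only at modulus one. The
  index shift in \<open>hw\<close> lets one weight serve the shifts \<open>a - 1\<close>,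
  \<open>- a\<close> and \<open>0\<close>.\<close>

definition hw :: "complex \<Rightarrow> nat \<Rightarrow> nat \<Rightarrow> complex" where
  "hw b q n = 1 / (of_nat (Suc n) + b) ^ q"

text \<open>Beyond \<open>N\<close> the triangle inequality gives the ratio \<open>1/2\<close>; the
  finitely many earlier ratios are positive by assumption, so a minimum completes the choice of
  \<open>d\<close>.\<close>

lemma shift_lower_bound:
  fixes b :: complex
  assumes "\<And>n. of_nat (Suc n) + b \<noteq> 0"
  obtains d where "d > 0" "\<And>n. d * real (Suc n) \<le> norm (of_nat (Suc n) + b)"
proof -
  define N where "N = nat \<lceil>2 * norm b\<rceil>"
  define R where "R = (\<lambda>n. norm (of_nat (Suc n) + b) / real (Suc n))"
  define d where "d = Min (insert (1/2) (R ` {..N}))"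
  have pos: "R n > 0" for n
    unfolding R_def using assms[of n] by (intro divide_pos_pos) auto
  have d: "d > 0" unfolding d_def using pos by (subst Min_gr_iff) auto
  have le: "d \<le> R n" for n
  proof (cases "n \<le> N")
    case True
    then show ?thesis unfolding d_def by (intro Min_le) auto
  next
    case False
    then have "real n \<ge> 2 * norm b" unfolding N_def by linarith
    then have "real (Suc n) / 2 \<le> real (Suc n) - norm b" by simp
    also have "\<dots> = norm (of_nat (Suc n) :: complex) - norm b" by (simp only: norm_of_nat)
    also have "\<dots> \<le> norm (of_nat (Suc n) + b)" by (rule norm_diff_ineq)
    finally have "1/2 \<le> R n" unfolding R_def
      by (simp add: field_simps)
    moreover have "d \<le> 1/2" unfolding d_def by (intro Min_le) auto
    ultimately show ?thesis by linarith
  qed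
  show ?thesis
  proof (rule that[OF d])
    fix n show "d * real (Suc n) \<le> norm (of_nat (Suc n) + b)"
      using le[of n] unfolding R_def by (simp add: pos_le_divide_eq del: of_nat_Suc)
  qed
qed

text \<open>Size and increment of the weight are what summation by parts consumes; quadratic decay
  replaces it when \<open>q \<noteq> 1\<close>. For \<open>q = 1\<close> the increment is exactly
  the product of two consecutive weights.\<close>

lemma hw_bounds:
  assumes b: "\<And>n. of_nat (Suc n) + b \<noteq> 0" and q: "q \<ge> 1"
  obtains K where "K > 0" "\<And>n. norm (hw b q n) \<le> K / real (Suc n)"
    "\<And>n. norm (hw b q n - hw b q (Suc n)) \<le> K / real (Suc n) ^ 2"
    "\<And>n. q \<noteq> 1 \<Longrightarrow> norm (hw b q n) \<le> K / real (Suc n) ^ 2"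
proof -
  obtain d where d: "d > 0" "\<And>n. d * real (Suc n) \<le> norm (of_nat (Suc n) + b)"
    using shift_lower_bound[OF b] by blast
  have pw: "norm (hw b q n) \<le> (1 / d ^ q) / real (Suc n) ^ q" for n q
  proof -
    have "norm (hw b q n) = 1 / norm (of_nat (Suc n) + b) ^ q"
      unfolding hw_def by (simp add: norm_divide norm_power)
    also have "\<dots> \<le> 1 / (d * real (Suc n)) ^ q"
      using d by (intro divide_left_mono power_mono mult_pos_pos zero_less_power) (auto simp: b simp del: of_nat_Suc)
    finally show ?thesis by (simp add: power_mult_distrib)
  qed
  have mono: "1 / real (Suc n) ^ q \<le> 1 / real (Suc n) ^ r" if "r \<le> q" for r q n
    using that by (intro divide_left_mono power_increasing) auto
  have pw': "norm (hw b q n) \<le> (1 / d ^ q) / real (Suc n) ^ r" if "r \<le> q" for r q n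
  proof -
    have "(1 / d ^ q) * (1 / real (Suc n) ^ q) \<le> (1 / d ^ q) * (1 / real (Suc n) ^ r)"
      using d mono[OF that] by (intro mult_left_mono) auto
    then show ?thesis using pw[of q n] by simp
  qed
  \<comment> \<open>\<open>2 / d ^ q\<close> pays for the two terms of the triangle inequality when
    \<open>q \<ge> 2\<close>, and \<open>1 / d ^ 2\<close> for the product of two weights when
    \<open>q = 1\<close>.\<close>
  define K where "K = 2 / d ^ q + 1 / d ^ 2"
  have K: "K > 0" "1 / d ^ q \<le> K" "2 / d ^ q \<le> K" "1 / d ^ 2 \<le> K"
    using d unfolding K_def by (auto intro!: add_pos_pos add_increasing2 divide_right_mono)
  have step: "c / x \<le> K / x" if "c \<le> K" "x > 0" for c x :: real
    using that by (intro divide_right_mono) auto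
  show ?thesis
  proof (rule that[OF K(1)])
    fix n
    show "norm (hw b q n) \<le> K / real (Suc n)"
      using order.trans[OF pw'[OF q, of n] step[OF K(2)]] by simp
    show "norm (hw b q n) \<le> K / real (Suc n) ^ 2" if "q \<noteq> 1"
      by (rule order.trans[OF pw' step[OF K(2)]]) (use that q in auto)
    show "norm (hw b q n - hw b q (Suc n)) \<le> K / real (Suc n) ^ 2"
    proof (cases "q = 1")
      case True
      have "hw b q n - hw b q (Suc n) = hw b 1 n * hw b 1 (Suc n)"
        unfolding hw_def True using b[of n] b[of "Suc n"] by (simp add: field_simps)
      then have "norm (hw b q n - hw b q (Suc n)) = norm (hw b 1 n) * norm (hw b 1 (Suc n))"
        by (simp add: norm_mult)
      also have "\<dots> \<le> (1 / d / real (Suc n)) * (1 / d / real (Suc n))"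
      proof (intro mult_mono)
        show "norm (hw b 1 n) \<le> 1 / d / real (Suc n)" using pw[of 1 n] by simp
        have "norm (hw b 1 (Suc n)) \<le> 1 / d / real (Suc (Suc n))" using pw[of 1 "Suc n"] by simp
        also have "\<dots> \<le> 1 / d / real (Suc n)" using d by (intro divide_left_mono) auto
        finally show "norm (hw b 1 (Suc n)) \<le> 1 / d / real (Suc n)" .
      qed (use d in auto)
      also have "\<dots> = (1 / d ^ 2) / real (Suc n) ^ 2" by (simp add: power2_eq_square)
      also have "\<dots> \<le> K / real (Suc n) ^ 2" by (rule step[OF K(4)]) auto
      finally show ?thesis .
    next
      case False
      then have q2: "2 \<le> q" using q by simp
      have "norm (hw b q n - hw b q (Suc n)) \<le> norm (hw b q n) + norm (hw b q (Suc n))"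
        by (rule norm_triangle_ineq4)
      also have "\<dots> \<le> (1 / d ^ q) / real (Suc n) ^ 2 + (1 / d ^ q) / real (Suc n) ^ 2"
      proof (intro add_mono pw'[OF q2])
        have "norm (hw b q (Suc n)) \<le> (1 / d ^ q) / real (Suc (Suc n)) ^ 2" by (rule pw'[OF q2])
        also have "\<dots> \<le> (1 / d ^ q) / real (Suc n) ^ 2"
          using d by (intro divide_left_mono power_mono) auto
        finally show "norm (hw b q (Suc n)) \<le> (1 / d ^ q) / real (Suc n) ^ 2" .
      qed
      also have "\<dots> = (2 / d ^ q) / real (Suc n) ^ 2" by simp
      also have "\<dots> \<le> K / real (Suc n) ^ 2" by (rule step[OF K(3)]) auto
      finally show ?thesis .
    qed
  qed
qed

text \<open>Comparison with the telescoping \<open>1 / (t * (t + 1))\<close>. The induction keeps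
  the remainder \<open>- 1 / real (Suc (m + n))\<close>, which the claim drops.\<close>

lemma sum_inverse_squares_tail:
  "(\<Sum>k\<in>{m..<n}. 1 / real (Suc k) ^ 2) \<le> 2 / real (Suc m)"
proof -
  have tel: "(\<Sum>k\<in>{m..<Suc (m+n)}. 1 / real (Suc k) ^ 2) \<le> 2 / real (Suc m) - 1 / real (Suc (m + n))" for n
  proof (induction n)
    case 0
    have "1 / real (Suc m) ^ 2 \<le> 1 / real (Suc m) ^ 1"
      by (intro divide_left_mono power_increasing) auto
    then show ?case by simp
  next
    case (Suc n)
    define t where "t = real (Suc (m + n))"
    have t: "t > 0" unfolding t_def by simp
    have "1 / (t + 1) ^ 2 \<le> 1 / (t * (t + 1))"
      unfolding power2_eq_square using t by (intro divide_left_mono mult_right_mono) auto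
    also have "\<dots> = 1 / t - 1 / (t + 1)" using t by (simp add: field_simps)
    finally have "1 / real (Suc (Suc (m + n))) ^ 2 \<le> 1 / real (Suc (m + n)) - 1 / real (Suc (m + Suc n))"
      unfolding t_def by (simp add: add_ac)
    with Suc show ?case by simp
  qed
  show ?thesis
  proof (cases "m < n")
    case True
    then obtain k where "n = Suc (m + k)" using less_imp_Suc_add by blast
    then show ?thesis using tel[of k] by (smt (verit) divide_nonneg_nonneg of_nat_0_le_iff)
  qed simp
qed

text \<open>Multiplied by \<open>1 - z\<close>, each term splits into a telescoping difference, a
  term with the increment of \<open>w\<close> and a term with the error of the recurrence; the last
  two are of order \<open>1 / n ^ 2\<close>. The 6 is 1 + 1 from the boundary terms plus 2 + 2 from
  the sums of inverse squares. The bounds on \<open>G\<close> start at \<open>m\<close> so that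
  \<open>G\<close> may be \<open>y ^ (k - m)\<close>, whose truncated exponent breaks the recurrence
  below \<open>m\<close>.\<close>

lemma tail_bound_parts:
  fixes G w :: "nat \<Rightarrow> complex" and z :: complex
  assumes d: "0 < d" "d \<le> norm (1 - z)" and B: "0 \<le> B" and K: "0 \<le> K"
    and G: "\<And>n. m \<le> n \<Longrightarrow> norm (G n) \<le> B"
    and GS: "\<And>n. m \<le> n \<Longrightarrow> norm (G (Suc n) - z * G n) \<le> B / real (Suc n)"
    and w: "\<And>n. norm (w n) \<le> K / real (Suc n)"
    and wd: "\<And>n. norm (w n - w (Suc n)) \<le> K / real (Suc n) ^ 2"
  shows "norm (\<Sum>n\<in>{m..<N}. G n * w n) \<le> (6 * B * K / d) / real (Suc m)"
proof (cases "m \<le> N")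
  case False
  then show ?thesis using B K d by simp
next
  case True
  have sq: "(\<Sum>n\<in>{m..<N}. B * K * (1 / real (Suc n) ^ 2)) \<le> B * K * (2 / real (Suc m))"
    unfolding sum_distrib_left[symmetric]
    using B K by (intro mult_left_mono sum_inverse_squares_tail) auto
  have "(1 - z) * (\<Sum>n\<in>{m..<N}. G n * w n)
      = (\<Sum>n\<in>{m..<N}. - (G (Suc n) * w (Suc n) - G n * w n)
          - G (Suc n) * (w n - w (Suc n)) + (G (Suc n) - z * G n) * w n)"
    unfolding sum_distrib_left by (intro sum.cong refl) (simp add: algebra_simps)
  also have "\<dots> = - (\<Sum>n\<in>{m..<N}. G (Suc n) * w (Suc n) - G n * w n)
      - (\<Sum>n\<in>{m..<N}. G (Suc n) * (w n - w (Suc n)))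
      + (\<Sum>n\<in>{m..<N}. (G (Suc n) - z * G n) * w n)"
    by (simp only: sum.distrib sum_subtractf sum_negf)
  also have "(\<Sum>n\<in>{m..<N}. G (Suc n) * w (Suc n) - G n * w n) = G N * w N - G m * w m"
    by (rule sum_Suc_diff'[OF True])
  finally have eq: "(1 - z) * (\<Sum>n\<in>{m..<N}. G n * w n) = - (G N * w N - G m * w m)
      - (\<Sum>n\<in>{m..<N}. G (Suc n) * (w n - w (Suc n)))
      + (\<Sum>n\<in>{m..<N}. (G (Suc n) - z * G n) * w n)" .
  have Gw: "norm (G n * w n) \<le> B * K * (1 / real (Suc m))" if "m \<le> n" for n
  proof -
    have "norm (G n * w n) \<le> B * (K / real (Suc n))"
      unfolding norm_mult using G[OF that] w B by (intro mult_mono) auto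
    also have "\<dots> \<le> B * (K / real (Suc m))"
      using that B K by (intro mult_left_mono divide_left_mono) auto
    finally show ?thesis by simp
  qed
  have s1: "norm (\<Sum>n\<in>{m..<N}. G (Suc n) * (w n - w (Suc n))) \<le> B * K * (2 / real (Suc m))"
  proof (rule order.trans[OF sum_norm_le sq])
    fix n assume "n \<in> {m..<N}"
    then have "norm (G (Suc n) * (w n - w (Suc n))) \<le> B * (K / real (Suc n) ^ 2)"
      unfolding norm_mult using G wd B by (intro mult_mono) auto
    then show "norm (G (Suc n) * (w n - w (Suc n))) \<le> B * K * (1 / real (Suc n) ^ 2)" by simp
  qed
  have s2: "norm (\<Sum>n\<in>{m..<N}. (G (Suc n) - z * G n) * w n) \<le> B * K * (2 / real (Suc m))"
  proof (rule order.trans[OF sum_norm_le sq])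
    fix n assume "n \<in> {m..<N}"
    then have "norm ((G (Suc n) - z * G n) * w n) \<le> (B / real (Suc n)) * (K / real (Suc n))"
      unfolding norm_mult using GS[of n] w[of n] B K by (intro mult_mono) auto
    then show "norm ((G (Suc n) - z * G n) * w n) \<le> B * K * (1 / real (Suc n) ^ 2)"
      by (simp add: power2_eq_square)
  qed
  have "d * norm (\<Sum>n\<in>{m..<N}. G n * w n) \<le> norm ((1 - z) * (\<Sum>n\<in>{m..<N}. G n * w n))"
    unfolding norm_mult using d by (intro mult_right_mono) auto
  also have "\<dots> \<le> norm (G N * w N) + norm (G m * w m)
      + norm (\<Sum>n\<in>{m..<N}. G (Suc n) * (w n - w (Suc n)))
      + norm (\<Sum>n\<in>{m..<N}. (G (Suc n) - z * G n) * w n)"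
    unfolding eq
    by (intro order.trans[OF norm_triangle_ineq] add_mono order.refl
        order.trans[OF norm_triangle_ineq4]) (simp_all add: norm_triangle_ineq4 norm_minus_commute)
  also have "\<dots> \<le> B * K * (1 / real (Suc m)) + B * K * (1 / real (Suc m))
      + B * K * (2 / real (Suc m)) + B * K * (2 / real (Suc m))"
    using s1 s2 Gw[of N] Gw[of m] True by (intro add_mono) auto
  also have "\<dots> = 6 * B * K / real (Suc m)" by (simp add: add_divide_distrib[symmetric] del: of_nat_Suc)
  finally have "norm (\<Sum>n\<in>{m..<N}. G n * w n) \<le> (6 * B * K / real (Suc m)) / d"
    by (subst pos_le_divide_eq[OF d(1)]) (simp only: mult.commute)
  then show ?thesis by (simp add: divide_divide_eq_left' mult.commute)
qed

lemma uniform_tail_summable: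
  fixes g :: "nat \<Rightarrow> 'a \<Rightarrow> complex"
  assumes "\<And>m N. norm (\<Sum>n\<in>{m..<N}. g n r) \<le> C / real (Suc m)"
  shows "summable (\<lambda>n. g n r)"
  unfolding summable_Cauchy
proof (intro allI impI)
  fix e :: real assume e: "e > 0"
  obtain N where N: "norm C / e < real N" using reals_Archimedean2 by blast
  show "\<exists>N. \<forall>m\<ge>N. \<forall>n. norm (sum (\<lambda>n. g n r) {m..<n}) < e"
  proof (intro exI allI impI)
    fix m n assume "N \<le> m"
    then have "norm C / e < real (Suc m)" using N by linarith
    then have "C < e * real (Suc m)" using e by (simp add: divide_less_eq mult.commute del: of_nat_Suc)
    then have "C / real (Suc m) < e" by (simp add: divide_less_eq del: of_nat_Suc)
    with assms show "norm (sum (\<lambda>n. g n r) {m..<n}) < e" by (rule order.strict_trans1)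
  qed
qed

text \<open>Letting the upper end of a block tend to infinity bounds the full tail by
  \<open>C / real (Suc m)\<close> on all of \<open>A\<close>, so the partial sums converge
  uniformly.\<close>

lemma uniform_tail_continuous:
  fixes g :: "nat \<Rightarrow> 'a::topological_space \<Rightarrow> complex"
  assumes cont: "\<And>n. continuous_on A (g n)"
    and bd: "\<And>m N r. r \<in> A \<Longrightarrow> norm (\<Sum>n\<in>{m..<N}. g n r) \<le> C / real (Suc m)"
  shows "continuous_on A (\<lambda>r. \<Sum>n. g n r)"
proof (rule uniform_limit_theorem[where F = sequentially and f = "\<lambda>m r. \<Sum>n<m. g n r"])
  have tail: "norm ((\<Sum>n. g n r) - (\<Sum>n<m. g n r)) \<le> C / real (Suc m)" if r: "r \<in> A" for r m
  proof -
    have "(\<lambda>N. (\<Sum>n<N. g n r) - (\<Sum>n<m. g n r)) \<longlonglongrightarrow> (\<Sum>n. g n r) - (\<Sum>n<m. g n r)"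
      using uniform_tail_summable[of g r C] bd[OF r] by (intro tendsto_diff summable_LIMSEQ tendsto_const) auto
    then have "(\<lambda>N. norm ((\<Sum>n<N. g n r) - (\<Sum>n<m. g n r))) \<longlonglongrightarrow> norm ((\<Sum>n. g n r) - (\<Sum>n<m. g n r))"
      by (rule tendsto_norm)
    moreover have "norm ((\<Sum>n<N. g n r) - (\<Sum>n<m. g n r)) \<le> C / real (Suc m)" if "m \<le> N" for N
    proof -
      have "(\<Sum>n<N. g n r) - (\<Sum>n<m. g n r) = (\<Sum>n\<in>{m..<N}. g n r)"
        using sum_diff_nat_ivl[of 0 m N "\<lambda>n. g n r"] that by (simp add: lessThan_atLeast0)
      then show ?thesis using bd[OF r] by simp
    qed
    ultimately show ?thesis
      by (intro LIMSEQ_le_const2) auto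
  qed
  show "uniform_limit A (\<lambda>m r. \<Sum>n<m. g n r) (\<lambda>r. \<Sum>n. g n r) sequentially"
    unfolding uniform_limit_iff
  proof (intro allI impI)
    fix e :: real assume e: "e > 0"
    have "(\<lambda>m. C / real (Suc m)) \<longlonglongrightarrow> 0"
      using LIMSEQ_Suc[OF lim_const_over_n[of C]] by simp
    then have "\<forall>\<^sub>F m in sequentially. C / real (Suc m) < e" using e by (rule order_tendstoD)
    then show "\<forall>\<^sub>F m in sequentially. \<forall>r\<in>A. dist (\<Sum>n<m. g n r) (\<Sum>n. g n r) < e"
    proof eventually_elim
      case (elim m)
      then show ?case using order.strict_trans1[OF tail elim] by (simp add: dist_norm norm_minus_commute)
    qed
  qed
  show "\<forall>\<^sub>F m in sequentially. continuous_on A (\<lambda>r. \<Sum>n<m. g n r)"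
    by (intro always_eventually allI continuous_on_sum cont)
qed auto

text \<open>Only \<open>q = 1\<close> needs cancellation; it comes from the near-recurrence
  \<open>G (n + 1) \<approx> z * G n\<close> with \<open>z\<close> bounded away from \<open>1\<close>.\<close>

lemma hw_series_tail:
  fixes z :: "'a \<Rightarrow> complex" and G :: "nat \<Rightarrow> 'a \<Rightarrow> complex"
  assumes b: "\<And>n. of_nat (Suc n) + b \<noteq> 0" and q: "q \<ge> 1" and B: "0 \<le> B"
    and d: "0 < d" "q = 1 \<Longrightarrow> (\<And>r. r \<in> A \<Longrightarrow> d \<le> norm (1 - z r))"
    and G: "\<And>n r. r \<in> A \<Longrightarrow> norm (G n r) \<le> B"
    and GS: "q = 1 \<Longrightarrow> (\<And>n r. r \<in> A \<Longrightarrow> norm (G (Suc n) r - z r * G n r) \<le> B / real (Suc n))"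
  obtains C where "\<And>m N r. r \<in> A \<Longrightarrow> norm (\<Sum>n\<in>{m..<N}. G n r * hw b q n) \<le> C / real (Suc m)"
proof -
  obtain K where K: "K > 0" "\<And>n. norm (hw b q n) \<le> K / real (Suc n)"
    "\<And>n. norm (hw b q n - hw b q (Suc n)) \<le> K / real (Suc n) ^ 2"
    "\<And>n. q \<noteq> 1 \<Longrightarrow> norm (hw b q n) \<le> K / real (Suc n) ^ 2"
    using hw_bounds[OF b q] by blast
  show ?thesis
  proof (cases "q = 1")
    case True
    show ?thesis
    proof (rule that)
      fix m N r assume "r \<in> A"
      then show "norm (\<Sum>n\<in>{m..<N}. G n r * hw b q n) \<le> (6 * B * K / d) / real (Suc m)"
        using K d B G GS True by (intro tail_bound_parts[where z = "z r"]) auto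
    qed
  next
    case False
    show ?thesis
    proof (rule that)
      fix m N r assume r: "r \<in> A"
      have "norm (\<Sum>n\<in>{m..<N}. G n r * hw b q n) \<le> (\<Sum>n\<in>{m..<N}. B * K * (1 / real (Suc n) ^ 2))"
      proof (rule sum_norm_le)
        fix n
        have "norm (G n r * hw b q n) \<le> B * (K / real (Suc n) ^ 2)"
          unfolding norm_mult using G[OF r] K(4)[of n] False B by (intro mult_mono) auto
        then show "norm (G n r * hw b q n) \<le> B * K * (1 / real (Suc n) ^ 2)" by simp
      qed
      also have "\<dots> \<le> B * K * (2 / real (Suc m))"
        unfolding sum_distrib_left[symmetric]
        using B K by (intro mult_left_mono sum_inverse_squares_tail) auto
      finally show "norm (\<Sum>n\<in>{m..<N}. G n r * hw b q n) \<le> (B * K * 2) / real (Suc m)" by simp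
    qed
  qed
qed


section \<open>Finite and infinite Hurwitz sums\<close>

text \<open>\<open>hsum b p y n\<close> is the sum of \<open>y ^ (n - 1 - l) * hw b p l\<close> over \<open>l < n\<close>: the partial zeta sum
  with argument \<open>1 / y\<close>, renormalised so that it stays bounded for \<open>norm y \<le> 1\<close> and makes sense
  at \<open>y = 0\<close>.\<close>

primrec hsum :: "complex \<Rightarrow> nat \<Rightarrow> complex \<Rightarrow> nat \<Rightarrow> complex" where
  "hsum b p y 0 = 0"
| "hsum b p y (Suc n) = y * hsum b p y n + hw b p n"

lemma zeta_hurwitz_eq_hsum:
  assumes "u \<noteq> 0"
  shows "zeta_hurwitz n p u b = u ^ n * hsum b p (inverse u) n"
proof (induction n)
  case (Suc n)
  have "zeta_hurwitz (Suc n) p u b = zeta_hurwitz n p u b + u ^ Suc n * hw b p n"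
    unfolding zeta_hurwitz_def hw_def by simp
  with Suc show ?case using assms by (simp add: algebra_simps)
qed (simp add: zeta_hurwitz_def)

text \<open>For \<open>p = 1\<close> the weights are not summable and the cancellation has to come
  from \<open>1 - y\<close>: the quantity \<open>(1 - y) * hsum b p y (Suc n) - hw b p n\<close>
  obeys a recursion with factor \<open>y\<close> that is driven only by the summable increments of
  \<open>hw\<close>.\<close>

lemma hsum_bound:
  assumes b: "\<And>n. of_nat (Suc n) + b \<noteq> 0" and p: "p \<ge> 1" and d: "0 < d"
  obtains B where "0 \<le> B"
    "\<And>y n. norm y \<le> 1 \<Longrightarrow> (p = 1 \<Longrightarrow> d \<le> norm (1 - y)) \<Longrightarrow> norm (hsum b p y n) \<le> B"
proof -
  obtain K where K: "K > 0" "\<And>n. norm (hw b p n) \<le> K / real (Suc n)"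
    "\<And>n. norm (hw b p n - hw b p (Suc n)) \<le> K / real (Suc n) ^ 2"
    "\<And>n. p \<noteq> 1 \<Longrightarrow> norm (hw b p n) \<le> K / real (Suc n) ^ 2"
    using hw_bounds[OF b p] by blast
  have sq: "(\<Sum>k<n. K / real (Suc k) ^ 2) \<le> 2 * K" for n
  proof -
    have "(\<Sum>k<n. K / real (Suc k) ^ 2) = K * (\<Sum>k\<in>{0..<n}. 1 / real (Suc k) ^ 2)"
      by (simp add: sum_distrib_left lessThan_atLeast0)
    also have "\<dots> \<le> K * 2" using K(1) sum_inverse_squares_tail[of 0 n] by (intro mult_left_mono) auto
    finally show ?thesis by simp
  qed
  have Kn: "norm (hw b p n) \<le> K" for n
  proof -
    have "K / real (Suc n) \<le> K / 1" using K(1) by (intro divide_left_mono) auto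
    then show ?thesis using K(2)[of n] by simp
  qed
  show ?thesis
  proof (cases "p = 1")
    case False
    show ?thesis
    proof (rule that[of "2 * K"])
      fix y :: complex and n assume y: "norm y \<le> 1"
      have "norm (hsum b p y n) \<le> (\<Sum>k<n. K / real (Suc k) ^ 2)"
      proof (induction n)
        case (Suc n)
        have "norm (hsum b p y (Suc n)) \<le> norm (y * hsum b p y n) + norm (hw b p n)"
          unfolding hsum.simps by (rule norm_triangle_ineq)
        also have "norm (y * hsum b p y n) \<le> 1 * norm (hsum b p y n)"
          unfolding norm_mult using y by (intro mult_right_mono) auto
        finally show ?case using Suc K(4)[of n] False by simp
      qed simp
      then show "norm (hsum b p y n) \<le> 2 * K" using sq[of n] by linarith
    qed (use K(1) in auto)
  next
    case True
    show ?thesis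
    proof (rule that[of "4 * K / d"])
      fix y :: complex and n assume y: "norm y \<le> 1" and dy: "p = 1 \<Longrightarrow> d \<le> norm (1 - y)"
      have ind: "norm ((1 - y) * hsum b p y (Suc n) - hw b p n) \<le> K + (\<Sum>k<n. K / real (Suc k) ^ 2)" for n
      proof (induction n)
        case 0
        have "norm ((1 - y) * hsum b p y (Suc 0) - hw b p 0) = norm y * norm (hw b p 0)"
          by (simp add: algebra_simps flip: norm_mult)
        also have "\<dots> \<le> 1 * K" using y Kn K(1) by (intro mult_mono) auto
        finally show ?case by simp
      next
        case (Suc n)
        have "(1 - y) * hsum b p y (Suc (Suc n)) - hw b p (Suc n)
            = y * (((1 - y) * hsum b p y (Suc n) - hw b p n) + (hw b p n - hw b p (Suc n)))"
          by (simp add: algebra_simps)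
        then have "norm ((1 - y) * hsum b p y (Suc (Suc n)) - hw b p (Suc n))
            \<le> 1 * (norm ((1 - y) * hsum b p y (Suc n) - hw b p n) + norm (hw b p n - hw b p (Suc n)))"
          unfolding norm_mult using y by (simp only: norm_mult) (intro mult_mono norm_triangle_ineq, auto)
        then show ?case using Suc K(3)[of n] by simp
      qed
      show "norm (hsum b p y n) \<le> 4 * K / d"
      proof (cases n)
        case (Suc m)
        have "norm ((1 - y) * hsum b p y (Suc m)) \<le> norm ((1 - y) * hsum b p y (Suc m) - hw b p m) + norm (hw b p m)"
          by (metis diff_add_cancel norm_triangle_ineq)
        also have "\<dots> \<le> 4 * K" using ind[of m] sq[of m] Kn[of m] by linarith
        finally have "d * norm (hsum b p y (Suc m)) \<le> 4 * K"
          unfolding norm_mult by (meson True dy mult_right_mono norm_ge_zero order_trans)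
        then show ?thesis using d unfolding Suc by (simp add: pos_le_divide_eq mult.commute)
      qed (use K d in auto)
    qed (use K d in auto)
  qed
qed

text \<open>Because of the index shift in \<open>hw\<close>, \<open>lerch (s - 1) p y\<close> is the sum of
  \<open>y ^ k / (s + k) ^ p\<close> over \<open>k \<ge> 0\<close>.\<close>

definition lerch :: "complex \<Rightarrow> nat \<Rightarrow> complex \<Rightarrow> complex" where
  "lerch b p y = (\<Sum>k. y ^ k * hw b p k)"

lemma hw_shift: "hw (b + of_nat n) p k = hw b p (n + k)"
  unfolding hw_def by (simp add: add_ac)

lemma Li_hurwitz_eq: "Li_hurwitz p y a = (\<Sum>k. y ^ Suc k * hw (a - 1) p k)"
  unfolding Li_hurwitz_def hw_def by (simp add: algebra_simps)

text \<open>The tail is divided by \<open>y ^ m\<close>, with a bound still uniform in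
  \<open>y\<close>: such a block is a partial sum of the shifted function
  \<open>lerch (b + of_nat m) p y\<close>.\<close>

lemma power_series_tail:
  assumes b: "\<And>n. of_nat (Suc n) + b \<noteq> 0" and p: "p \<ge> 1" and d: "0 < d"
  obtains C where "0 \<le> C" "\<And>y m N. norm y \<le> 1 \<Longrightarrow> (p = 1 \<Longrightarrow> d \<le> norm (1 - y)) \<Longrightarrow>
    norm (\<Sum>k\<in>{m..<N}. y ^ (k - m) * hw b p k) \<le> C / real (Suc m)"
proof -
  obtain K where K: "K > 0" "\<And>n. norm (hw b p n) \<le> K / real (Suc n)"
    "\<And>n. norm (hw b p n - hw b p (Suc n)) \<le> K / real (Suc n) ^ 2"
    "\<And>n. p \<noteq> 1 \<Longrightarrow> norm (hw b p n) \<le> K / real (Suc n) ^ 2"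
    using hw_bounds[OF b p] by blast
  show ?thesis
  proof (cases "p = 1")
    case True
    show ?thesis
    proof (rule that[of "6 * 1 * K / d"])
      fix y :: complex and m N
      assume y: "norm y \<le> 1" and dy: "p = 1 \<Longrightarrow> d \<le> norm (1 - y)"
      show "norm (\<Sum>k\<in>{m..<N}. y ^ (k - m) * hw b p k) \<le> (6 * 1 * K / d) / real (Suc m)"
      proof (rule tail_bound_parts[where z = y])
        fix k assume "m \<le> k"
        then have "y ^ (Suc k - m) = y * y ^ (k - m)" by (simp add: Suc_diff_le)
        then show "norm (y ^ (Suc k - m) - y * y ^ (k - m)) \<le> 1 / real (Suc k)" by simp
        show "norm (y ^ (k - m)) \<le> 1" using y by (simp add: norm_power power_le_one)
      qed (use d dy True K in auto)
    qed (use K d in auto)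
  next
    case False
    show ?thesis
    proof (rule that[of "2 * K"])
      fix y :: complex and m N
      assume y: "norm y \<le> 1"
      have "norm (\<Sum>k\<in>{m..<N}. y ^ (k - m) * hw b p k) \<le> (\<Sum>k\<in>{m..<N}. K * (1 / real (Suc k) ^ 2))"
      proof (rule sum_norm_le)
        fix k
        have "norm (y ^ (k - m) * hw b p k) \<le> 1 * (K / real (Suc k) ^ 2)"
          unfolding norm_mult norm_power using y K(4)[of k] False
          by (intro mult_mono power_le_one) auto
        then show "norm (y ^ (k - m) * hw b p k) \<le> K * (1 / real (Suc k) ^ 2)" by simp
      qed
      also have "\<dots> \<le> K * (2 / real (Suc m))"
        unfolding sum_distrib_left[symmetric] using K by (intro mult_left_mono sum_inverse_squares_tail) auto
      finally show "norm (\<Sum>k\<in>{m..<N}. y ^ (k - m) * hw b p k) \<le> 2 * K / real (Suc m)" by (simp add: mult.commute)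
    qed (use K in auto)
  qed
qed

lemma gap_witness:
  assumes "y = 1 \<longrightarrow> p \<noteq> 1"
  obtains d where "0 < d" "p = 1 \<Longrightarrow> d \<le> norm (1 - y :: complex)"
proof (cases "y = 1")
  case True
  with assms show ?thesis by (intro that[of 1]) auto
next
  case False
  then show ?thesis by (intro that[of "norm (1 - y)"]) auto
qed

lemma summable_lerch:
  assumes b: "\<And>n. of_nat (Suc n) + b \<noteq> 0" and p: "p \<ge> 1" and y: "norm y \<le> 1" "y = 1 \<longrightarrow> p \<noteq> 1"
  shows "summable (\<lambda>k. y ^ k * hw b p k)"
proof -
  obtain d where d: "0 < d" "p = 1 \<Longrightarrow> d \<le> norm (1 - y)" using gap_witness[OF y(2)] by blast
  obtain C where C: "0 \<le> C" "\<And>y m N. norm y \<le> 1 \<Longrightarrow> (p = 1 \<Longrightarrow> d \<le> norm (1 - y)) \<Longrightarrow>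
    norm (\<Sum>k\<in>{m..<N}. y ^ (k - m) * hw b p k) \<le> C / real (Suc m)" using power_series_tail[OF b p d(1)] by blast
  have "norm (\<Sum>k\<in>{m..<N}. y ^ k * hw b p k) \<le> C / real (Suc m)" for m N
  proof -
    have "(\<Sum>k\<in>{m..<N}. y ^ k * hw b p k) = y ^ m * (\<Sum>k\<in>{m..<N}. y ^ (k - m) * hw b p k)"
      unfolding sum_distrib_left
    proof (intro sum.cong refl)
      fix k assume "k \<in> {m..<N}"
      then have "y ^ k = y ^ m * y ^ (k - m)" by (simp flip: power_add)
      then show "y ^ k * hw b p k = y ^ m * (y ^ (k - m) * hw b p k)" by simp
    qed
    also have "norm \<dots> \<le> 1 * norm (\<Sum>k\<in>{m..<N}. y ^ (k - m) * hw b p k)"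
      unfolding norm_mult norm_power using y by (intro mult_right_mono power_le_one) auto
    also have "\<dots> \<le> C / real (Suc m)" using C(2)[OF y(1) d(2)] by simp
    finally show ?thesis .
  qed
  then show ?thesis by (rule uniform_tail_summable[where g = "\<lambda>k _. y ^ k * hw b p k" and r = "()"])
qed

text \<open>The partial sums at the shifted argument are the normalised blocks of
  \<open>power_series_tail\<close>. This decay along positive shifts makes the upper half of the
  bilateral sum unproblematic even on the unit circle.\<close>

lemma lerch_bound:
  assumes b: "\<And>n. of_nat (Suc n) + b \<noteq> 0" and p: "p \<ge> 1" and d: "0 < d"
  obtains C where "0 \<le> C" "\<And>y n. norm y \<le> 1 \<Longrightarrow> (p = 1 \<Longrightarrow> d \<le> norm (1 - y)) \<Longrightarrow>
    norm (lerch (b + of_nat n) p y) \<le> C / real (Suc n)"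
proof -
  obtain C where C: "0 \<le> C" "\<And>y m N. norm y \<le> 1 \<Longrightarrow> (p = 1 \<Longrightarrow> d \<le> norm (1 - y)) \<Longrightarrow>
    norm (\<Sum>k\<in>{m..<N}. y ^ (k - m) * hw b p k) \<le> C / real (Suc m)" using power_series_tail[OF b p d] by blast
  show ?thesis
  proof (rule that[OF C(1)])
    fix y :: complex and n assume y: "norm y \<le> 1" and dy: "p = 1 \<Longrightarrow> d \<le> norm (1 - y)"
    have bn: "of_nat (Suc k) + (b + of_nat n) \<noteq> 0" for k
      using b[of "k + n"] by (simp add: add_ac)
    have "(\<lambda>N. \<Sum>k<N. y ^ k * hw (b + of_nat n) p k) \<longlonglongrightarrow> lerch (b + of_nat n) p y"
      unfolding lerch_def using summable_lerch[OF bn p y] dy d by (intro summable_LIMSEQ) fastforce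
    then have "(\<lambda>N. norm (\<Sum>k<N. y ^ k * hw (b + of_nat n) p k)) \<longlonglongrightarrow> norm (lerch (b + of_nat n) p y)"
      by (rule tendsto_norm)
    moreover have "norm (\<Sum>k<N. y ^ k * hw (b + of_nat n) p k) \<le> C / real (Suc n)" for N
    proof -
      have "(\<Sum>k<N. y ^ k * hw (b + of_nat n) p k) = (\<Sum>k\<in>{n..<N+n}. y ^ (k - n) * hw b p k)"
        using sum.shift_bounds_nat_ivl[of "\<lambda>k. y ^ (k - n) * hw b p k" 0 n N]
        by (simp add: hw_shift lessThan_atLeast0 add.commute)
      then show ?thesis using C(2)[OF y dy] by simp
    qed
    ultimately show "norm (lerch (b + of_nat n) p y) \<le> C / real (Suc n)"
      by (intro LIMSEQ_le_const2) auto
  qed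
qed

section \<open>Moving the Lerch function along the integers\<close>

lemma lerch_rec:
  assumes b: "\<And>n. of_nat (Suc n) + b \<noteq> 0" and p: "p \<ge> 1" and y: "norm y \<le> 1" "y = 1 \<longrightarrow> p \<noteq> 1"
  shows "lerch b p y = hw b p 0 + y * lerch (b + 1) p y"
proof -
  have s: "summable (\<lambda>k. y ^ k * hw b p k)" by (rule summable_lerch[OF assms])
  have b': "of_nat (Suc n) + (b + 1) \<noteq> 0" for n using b[of "Suc n"] by (simp add: add_ac)
  have "lerch b p y = hw b p 0 + (\<Sum>k. y * (y ^ k * hw (b + 1) p k))"
    unfolding lerch_def using suminf_split_head[OF s] hw_shift[of b 1 p] by (simp add: mult.assoc)
  also have "(\<Sum>k. y * (y ^ k * hw (b + 1) p k)) = y * lerch (b + 1) p y"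
    unfolding lerch_def by (rule suminf_mult[OF summable_lerch[OF b' p y]])
  finally show ?thesis .
qed

text \<open>Each step down adds a head term with denominator \<open>a - m\<close>; negating the
  denominators turns the accumulated terms into \<open>hw (- a)\<close>, at the price of
  \<open>(-1) ^ p\<close>.\<close>

lemma lerch_backward:
  assumes a: "a \<notin> \<int>" and p: "p \<ge> 1" and y: "norm y \<le> 1" "y = 1 \<longrightarrow> p \<noteq> 1"
  shows "lerch (a - 1 - of_nat m) p y = (-1) ^ p * hsum (- a) p y m + y ^ m * lerch (a - 1) p y"
proof (induction m)
  case (Suc m)
  have nz: "of_nat (Suc n) + (a - 1 - of_nat (Suc m)) \<noteq> 0" for n
  proof
    assume "of_nat (Suc n) + (a - 1 - of_nat (Suc m)) = 0"
    then have "a = of_int (int m + 1 - int n)" by (simp add: algebra_simps)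
    then show False using a by simp
  qed
  have "hw (a - 1 - of_nat (Suc m)) p 0 = (-1) ^ p * hw (- a) p m"
  proof -
    have "of_nat (Suc 0) + (a - 1 - of_nat (Suc m)) = - (of_nat (Suc m) + - a)" by simp
    then show ?thesis unfolding hw_def by (simp only: power_minus[of "of_nat (Suc m) + - a"]) (cases "even p"; simp)
  qed
  then show ?case using lerch_rec[OF nz p y] Suc by (simp add: algebra_simps)
qed simp

lemma lerch_forward:
  assumes b: "\<And>n. of_nat (Suc n) + b \<noteq> 0" and p: "p \<ge> 1" and y: "norm y \<le> 1" "y = 1 \<longrightarrow> p \<noteq> 1"
  shows "y ^ Suc n * lerch (b + of_nat n) p y = y * lerch b p y - zeta_hurwitz n p y b"
proof (induction n)
  case (Suc n)
  have bn: "of_nat (Suc k) + (b + of_nat n) \<noteq> 0" for k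
    using b[of "k + n"] by (simp add: add_ac)
  have "zeta_hurwitz (Suc n) p y b = zeta_hurwitz n p y b + y ^ Suc n * hw (b + of_nat n) p 0"
    unfolding zeta_hurwitz_def hw_def by (simp add: add_ac)
  moreover have "y ^ Suc n * lerch (b + of_nat n) p y
      = y ^ Suc n * hw (b + of_nat n) p 0 + y ^ Suc (Suc n) * lerch (b + of_nat (Suc n)) p y"
    by (subst lerch_rec[OF bn p y]) (simp add: algebra_simps)
  ultimately show ?case using Suc by (simp add: algebra_simps)
qed (simp add: zeta_hurwitz_def)

lemma Li_hurwitz_lerch:
  assumes b: "\<And>n. of_nat (Suc n) + (a - 1) \<noteq> 0" and p: "p \<ge> 1" and y: "norm y \<le> 1" "y = 1 \<longrightarrow> p \<noteq> 1"
  shows "Li_hurwitz p y a = y * lerch (a - 1) p y"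
  unfolding Li_hurwitz_eq lerch_def
  using suminf_mult[OF summable_lerch[OF assms], of y] by (simp add: mult.assoc)

text \<open>If \<open>r * u = 1\<close>, comparing moduli forces \<open>r = 1\<close> and then
  \<open>u = 1\<close>. A continuous function without zeros on a compact interval has a positive
  minimal modulus, which gives a gap uniform up to \<open>r = 1\<close>.\<close>

lemma unit_gap:
  fixes u :: complex
  assumes "norm u \<le> 1" "u \<noteq> 1"
  obtains d where "0 < d" "\<And>r. r \<in> {0..1::real} \<Longrightarrow> d \<le> norm (1 - of_real r * u)"
proof -
  have nz: "1 - of_real r * u \<noteq> 0" if "r \<in> {0..1}" for r :: real
  proof
    assume "1 - of_real r * u = 0"
    then have e: "of_real r * u = 1" by simp
    then have "r * norm u = 1" using that by (metis norm_mult norm_of_real norm_one abs_of_nonneg atLeastAtMost_iff)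
    moreover have "r * norm u \<le> r * 1" using that assms by (intro mult_left_mono) auto
    ultimately have "r = 1" using that by simp
    with e assms show False by simp
  qed
  obtain r0 where r0: "r0 \<in> {0..1::real}" "\<And>r. r \<in> {0..1} \<Longrightarrow> norm (1 - of_real r0 * u) \<le> norm (1 - of_real r * u)"
    using continuous_attains_inf[of "{0..1::real}" "\<lambda>r. norm (1 - of_real r * u)"]
    by (force intro!: continuous_intros)
  show ?thesis using nz[OF r0(1)] r0 by (intro that[of "norm (1 - of_real r0 * u)"]) auto
qed

section \<open>Partial fractions\<close>

text \<open>Near the pole \<open>s = - u\<close>, with \<open>t = s + u\<close>, another factor
  \<open>s + w\<close> reads \<open>t + (w - u)\<close>; this is the Taylor series in
  \<open>t\<close> of its reciprocal power, for \<open>c = w - u\<close>.\<close>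

definition inv_lin_pow :: "nat \<Rightarrow> complex \<Rightarrow> complex fps" where
  "inv_lin_pow p c = inverse (fps_const c + fps_X) ^ p"

lemma inv_lin_pow_0 [simp]: "inv_lin_pow 0 c = 1"
  by (simp add: inv_lin_pow_def)

lemma inv_lin_pow_add: "inv_lin_pow (p + q) c = inv_lin_pow p c * inv_lin_pow q c"
  by (simp add: inv_lin_pow_def power_add)

lemma inv_lin_pow_cancel:
  assumes "c \<noteq> 0"
  shows "(fps_const c + fps_X) * inv_lin_pow (Suc p) c = inv_lin_pow p c"
proof -
  have "(fps_const c + fps_X) * inverse (fps_const c + fps_X) = 1"
    using assms by (intro inverse_mult_eq_1') simp
  then show ?thesis unfolding inv_lin_pow_def by (simp flip: mult.assoc)
qed

text \<open>The negative binomial series. Comparing coefficients in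
  \<open>inv_lin_pow_cancel\<close> yields a recursion in \<open>k\<close> and \<open>p\<close>,
  which Pascal's rule solves.\<close>

lemma inv_lin_pow_nth:
  assumes c: "c \<noteq> 0"
  shows "fps_nth (inv_lin_pow (Suc p) c) k = (-1) ^ k * of_nat ((k + p) choose p) / c ^ (k + Suc p)"
proof (induction p arbitrary: k)
  case 0
  have rec: "c * fps_nth (inv_lin_pow 1 c) (Suc k) + fps_nth (inv_lin_pow 1 c) k = 0"
    "c * fps_nth (inv_lin_pow 1 c) 0 = 1" for k
    using arg_cong[OF inv_lin_pow_cancel[OF c, of 0], of "\<lambda>f. fps_nth f (Suc k)"]
      arg_cong[OF inv_lin_pow_cancel[OF c, of 0], of "\<lambda>f. fps_nth f 0"]
    by (simp_all add: distrib_right)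
  show ?case
  proof (induction k)
    case 0
    then show ?case using rec(2) c by (simp add: field_simps)
  next
    case (Suc k)
    have "c * fps_nth (inv_lin_pow 1 c) (Suc k) = - fps_nth (inv_lin_pow 1 c) k"
      using rec(1)[of k] by (simp add: eq_neg_iff_add_eq_0)
    then show ?case using Suc c by (simp add: field_simps)
  qed
next
  case (Suc p)
  note IHp = Suc
  have rec: "c * fps_nth (inv_lin_pow (Suc (Suc p)) c) (Suc k) + fps_nth (inv_lin_pow (Suc (Suc p)) c) k
      = fps_nth (inv_lin_pow (Suc p) c) (Suc k)"
    "c * fps_nth (inv_lin_pow (Suc (Suc p)) c) 0 = fps_nth (inv_lin_pow (Suc p) c) 0" for k
    using arg_cong[OF inv_lin_pow_cancel[OF c, of "Suc p"], of "\<lambda>f. fps_nth f (Suc k)"]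
      arg_cong[OF inv_lin_pow_cancel[OF c, of "Suc p"], of "\<lambda>f. fps_nth f 0"]
    by (simp_all add: distrib_right)
  show ?case
  proof (induction k)
    case 0
    then show ?case using rec(2) IHp[of 0] c by (simp add: field_simps)
  next
    case (Suc k)
    have "c * fps_nth (inv_lin_pow (Suc (Suc p)) c) (Suc k)
        = fps_nth (inv_lin_pow (Suc p) c) (Suc k) - fps_nth (inv_lin_pow (Suc (Suc p)) c) k"
      using rec(1)[of k] by (simp add: algebra_simps)
    also have "\<dots> = (-1) ^ Suc k * of_nat ((Suc k + p) choose p) / c ^ (Suc k + Suc p)
        - (-1) ^ k * of_nat ((k + Suc p) choose Suc p) / c ^ (k + Suc (Suc p))"
      by (simp only: IHp Suc.IH)
    also have "\<dots> = (-1) ^ Suc k * of_nat ((Suc k + Suc p) choose Suc p) / c ^ (Suc k + Suc p)"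
    proof -
      have "(Suc k + Suc p) choose Suc p = (Suc k + p choose p) + (k + Suc p choose Suc p)"
        using binomial_Suc_Suc[of "Suc k + p" p] by simp
      moreover have "c ^ (k + Suc (Suc p)) = c ^ (Suc k + Suc p)" by simp
      ultimately show ?thesis
        by (simp only: of_nat_add power_Suc[of "-1"] distrib_left add_divide_distrib) simp
    qed
    finally show ?case using c by (simp add: field_simps)
  qed
qed

text \<open>The principal part \<open>t ^ (- p) * H t\<close>, for a power series \<open>H\<close>.\<close>

definition princ :: "nat \<Rightarrow> complex fps \<Rightarrow> complex \<Rightarrow> complex" where
  "princ p H t = (\<Sum>m<p. fps_nth H (p - 1 - m) / t ^ Suc m)"

lemma princ_0 [simp]: "princ 0 H t = 0"
  by (simp add: princ_def)

lemma princ_diff: "princ p (F - H) t = princ p F t - princ p H t"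
  by (simp add: princ_def diff_divide_distrib sum_subtractf)

lemma princ_const: "princ p (fps_const c * H) t = c * princ p H t"
  by (simp add: princ_def sum_distrib_left)

lemma princ_X: "princ (Suc p) (fps_X * H) t = princ p H t"
proof -
  have "princ (Suc p) (fps_X * H) t = (\<Sum>m<p. fps_nth (fps_X * H) (p - m) / t ^ Suc m)"
    unfolding princ_def by simp
  also have "\<dots> = princ p H t"
    unfolding princ_def
  proof (intro sum.cong refl)
    fix m assume "m \<in> {..<p}"
    then have "p - m = Suc (p - 1 - m)" by auto
    then show "fps_nth (fps_X * H) (p - m) / t ^ Suc m = fps_nth H (p - 1 - m) / t ^ Suc m" by simp
  qed
  finally show ?thesis .
qed

lemma princ_one:
  assumes "p \<ge> 1"
  shows "princ p 1 t = 1 / t ^ p"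
proof -
  obtain k where k: "p = Suc k" using assms by (cases p) auto
  have "princ p 1 t = (\<Sum>m<k. fps_nth 1 (k - m) / t ^ Suc m) + 1 / t ^ Suc k"
    unfolding princ_def k by simp
  also have "(\<Sum>m<k. fps_nth 1 (k - m) / t ^ Suc m) = 0"
    by (intro sum.neutral) auto
  finally show ?thesis unfolding k by simp
qed

text \<open>Write \<open>c\<close> as \<open>(c + X) - X\<close>: the first part cancels one power
  of the inverse, the factor \<open>X\<close> lowers the order of the pole by
  \<open>princ_X\<close>. This mirrors on principal parts the identity
  \<open>w - u = (s + w) - (s + u)\<close>.\<close>

lemma princ_step:
  assumes "c \<noteq> 0"
  shows "c * princ (Suc p) (inv_lin_pow (Suc q) c * H) t
    = princ (Suc p) (inv_lin_pow q c * H) t - princ p (inv_lin_pow (Suc q) c * H) t"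
proof -
  have "inv_lin_pow q c * H - fps_X * (inv_lin_pow (Suc q) c * H)
      = fps_const c * (inv_lin_pow (Suc q) c * H)"
    unfolding inv_lin_pow_cancel[OF assms, of q, symmetric] by (simp add: algebra_simps)
  then show ?thesis
    by (metis princ_diff princ_X princ_const)
qed

text \<open>Multiplication by \<open>w - u = (s + w) - (s + u)\<close> lowers one exponent or the
  other on the left, and by \<open>princ_step\<close> the right-hand side obeys the same recursion.
  With one exponent zero only a single pure power is left.\<close>

lemma partial_fractions_2:
  assumes "u \<noteq> w" "s + u \<noteq> 0" "s + w \<noteq> 0" "p + r \<ge> 1"
  shows "1 / ((s + u) ^ p * (s + w) ^ r)
    = princ p (inv_lin_pow r (w - u)) (s + u) + princ r (inv_lin_pow p (u - w)) (s + w)"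
  using assms(4)
proof (induction "p + r" arbitrary: p r rule: less_induct)
  case less
  show ?case
  proof (cases "p = 0 \<or> r = 0")
    case True
    then show ?thesis using less.prems by (auto simp: princ_one)
  next
    case False
    then obtain p' r' where pr: "p = Suc p'" "r = Suc r'" by (metis not0_implies_Suc)
    have "(w - u) * (1 / ((s + u) ^ p * (s + w) ^ r))
        = 1 / ((s + u) ^ p * (s + w) ^ r') - 1 / ((s + u) ^ p' * (s + w) ^ r)"
      using assms unfolding pr by (simp add: divide_simps)
    also have "\<dots> = princ p (inv_lin_pow r' (w - u)) (s + u) + princ r' (inv_lin_pow p (u - w)) (s + w)
        - (princ p' (inv_lin_pow r (w - u)) (s + u) + princ r (inv_lin_pow p' (u - w)) (s + w))"
      unfolding pr using less.hyps[of "Suc p'" r'] less.hyps[of p' "Suc r'"] by (simp add: pr)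
    also have "\<dots> = (w - u) * princ p (inv_lin_pow r (w - u)) (s + u)
        - (u - w) * princ r (inv_lin_pow p (u - w)) (s + w)"
      using princ_step[of "w - u" p' r' 1 "s + u"] princ_step[of "u - w" r' p' 1 "s + w"] assms(1)
      unfolding pr by simp
    also have "\<dots> = (w - u) * (princ p (inv_lin_pow r (w - u)) (s + u)
        + princ r (inv_lin_pow p (u - w)) (s + w))"
      by (simp add: algebra_simps)
    finally show ?thesis using assms(1) by (metis mult_left_cancel right_minus_eq)
  qed
qed

text \<open>The same recursion with \<open>v - u\<close>, lowering only \<open>p\<close> or
  \<open>q\<close>; once one of these is zero, two poles remain and
  \<open>partial_fractions_2\<close> applies. \<open>r \<ge> 1\<close> guarantees its condition on
  the exponents.\<close>

lemma partial_fractions_3: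
  assumes "u \<noteq> v" "u \<noteq> w" "v \<noteq> w" "s + u \<noteq> 0" "s + v \<noteq> 0" "s + w \<noteq> 0" "r \<ge> 1"
  shows "1 / ((s + u) ^ p * (s + v) ^ q * (s + w) ^ r)
    = princ p (inv_lin_pow q (v - u) * inv_lin_pow r (w - u)) (s + u)
      + princ q (inv_lin_pow p (u - v) * inv_lin_pow r (w - v)) (s + v)
      + princ r (inv_lin_pow p (u - w) * inv_lin_pow q (v - w)) (s + w)"
proof (induction "p + q" arbitrary: p q rule: less_induct)
  case less
  show ?case
  proof (cases "p = 0 \<or> q = 0")
    case True
    then show ?thesis
      using partial_fractions_2[of u w s p r] partial_fractions_2[of v w s q r] assms by auto
  next
    case False
    then obtain p' q' where pr: "p = Suc p'" "q = Suc q'" by (metis not0_implies_Suc)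
    define R where "R = inv_lin_pow r (w - u)"
    define R' where "R' = inv_lin_pow r (w - v)"
    \<comment> \<open>At the third pole both lowered factors are cofactors and the order
      \<open>r\<close> does not change, so \<open>princ_step\<close> does not apply; here
      \<open>v - u\<close> is the difference of \<open>(v - w) + X\<close> and
      \<open>(u - w) + X\<close>.\<close>
    have last: "fps_const (v - u) * (inv_lin_pow p (u - w) * inv_lin_pow q (v - w))
        = inv_lin_pow p (u - w) * inv_lin_pow q' (v - w) - inv_lin_pow p' (u - w) * inv_lin_pow q (v - w)"
    proof -
      have c: "fps_const (v - u) = (fps_const (v - w) + fps_X) - (fps_const (u - w) + fps_X)"
        by simp
      have "inv_lin_pow q' (v - w) = (fps_const (v - w) + fps_X) * inv_lin_pow q (v - w)"
        "inv_lin_pow p' (u - w) = (fps_const (u - w) + fps_X) * inv_lin_pow p (u - w)"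
        unfolding pr using inv_lin_pow_cancel assms by simp_all
      then show ?thesis unfolding c by (simp only: left_diff_distrib right_diff_distrib mult_ac)
    qed
    have "(v - u) * (1 / ((s + u) ^ p * (s + v) ^ q * (s + w) ^ r))
        = 1 / ((s + u) ^ p * (s + v) ^ q' * (s + w) ^ r) - 1 / ((s + u) ^ p' * (s + v) ^ q * (s + w) ^ r)"
      using assms unfolding pr by (simp add: divide_simps)
    also have "\<dots> = (princ p (inv_lin_pow q' (v - u) * R) (s + u)
          + princ q' (inv_lin_pow p (u - v) * R') (s + v)
          + princ r (inv_lin_pow p (u - w) * inv_lin_pow q' (v - w)) (s + w))
        - (princ p' (inv_lin_pow q (v - u) * R) (s + u)
          + princ q (inv_lin_pow p' (u - v) * R') (s + v)
          + princ r (inv_lin_pow p' (u - w) * inv_lin_pow q (v - w)) (s + w))"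
      unfolding R_def R'_def using less.hyps[of "Suc p'" q'] less.hyps[of p' "Suc q'"] by (simp add: pr)
    also have "\<dots> = (v - u) * princ p (inv_lin_pow q (v - u) * R) (s + u)
        - (u - v) * princ q (inv_lin_pow p (u - v) * R') (s + v)
        + (v - u) * princ r (inv_lin_pow p (u - w) * inv_lin_pow q (v - w)) (s + w)"
    proof -
      have "(v - u) * princ r (inv_lin_pow p (u - w) * inv_lin_pow q (v - w)) (s + w)
          = princ r (inv_lin_pow p (u - w) * inv_lin_pow q' (v - w)) (s + w)
          - princ r (inv_lin_pow p' (u - w) * inv_lin_pow q (v - w)) (s + w)"
        by (simp only: princ_const[symmetric] last princ_diff)
      moreover have "(v - u) * princ p (inv_lin_pow q (v - u) * R) (s + u)
          = princ p (inv_lin_pow q' (v - u) * R) (s + u) - princ p' (inv_lin_pow q (v - u) * R) (s + u)"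
        unfolding pr by (rule princ_step) (use assms in simp)
      moreover have "(u - v) * princ q (inv_lin_pow p (u - v) * R') (s + v)
          = princ q (inv_lin_pow p' (u - v) * R') (s + v) - princ q' (inv_lin_pow p (u - v) * R') (s + v)"
        unfolding pr by (rule princ_step) (use assms in simp)
      ultimately show ?thesis by (simp only:) simp
    qed
    also have "\<dots> = (v - u) * (princ p (inv_lin_pow q (v - u) * R) (s + u)
        + princ q (inv_lin_pow p (u - v) * R') (s + v)
        + princ r (inv_lin_pow p (u - w) * inv_lin_pow q (v - w)) (s + w))"
      by (simp add: algebra_simps)
    finally show ?thesis using assms(1) unfolding R_def R'_def by (metis mult_left_cancel right_minus_eq)
  qed
qed

section \<open>Bilateral sums of the partial fractions\<close>

text \<open>The sum of \<open>x powi (- n) * h (a + n)\<close> over all integers \<open>n\<close>; both halves have to converge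
  separately, as ordered sums.\<close>

definition has_bisum :: "complex \<Rightarrow> complex \<Rightarrow> (complex \<Rightarrow> complex) \<Rightarrow> complex \<Rightarrow> bool" where
  "has_bisum x a h S \<longleftrightarrow> (\<exists>A B. (\<lambda>n. inverse x ^ n * h (a + of_nat n)) sums A \<and>
     (\<lambda>n. x ^ Suc n * h (a - of_nat (Suc n))) sums B \<and> S = A + B)"

lemma has_bisum_add:
  assumes "has_bisum x a f S" "has_bisum x a g T"
  shows "has_bisum x a (\<lambda>s. f s + g s) (S + T)"
proof -
  obtain A B A' B' where "(\<lambda>n. inverse x ^ n * f (a + of_nat n)) sums A"
    "(\<lambda>n. x ^ Suc n * f (a - of_nat (Suc n))) sums B" "S = A + B"
    "(\<lambda>n. inverse x ^ n * g (a + of_nat n)) sums A'"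
    "(\<lambda>n. x ^ Suc n * g (a - of_nat (Suc n))) sums B'" "T = A' + B'"
    using assms unfolding has_bisum_def by blast
  then show ?thesis
    unfolding has_bisum_def distrib_left
    by (intro exI[of _ "A + A'"] exI[of _ "B + B'"] conjI sums_add) auto
qed

lemma has_bisum_cmult:
  assumes "has_bisum x a f S"
  shows "has_bisum x a (\<lambda>s. c * f s) (c * S)"
proof -
  obtain A B where "(\<lambda>n. inverse x ^ n * f (a + of_nat n)) sums A"
    "(\<lambda>n. x ^ Suc n * f (a - of_nat (Suc n))) sums B" "S = A + B"
    using assms unfolding has_bisum_def by blast
  then show ?thesis
    unfolding has_bisum_def mult.left_commute[of _ c]
    by (intro exI[of _ "c * A"] exI[of _ "c * B"] conjI sums_mult) (auto simp: distrib_left)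
qed

lemma has_bisum_sum:
  assumes "finite I" "\<And>i. i \<in> I \<Longrightarrow> has_bisum x a (f i) (S i)"
  shows "has_bisum x a (\<lambda>s. \<Sum>i\<in>I. f i s) (\<Sum>i\<in>I. S i)"
  using assms
proof (induction I rule: finite_induct)
  case empty
  then show ?case unfolding has_bisum_def by (auto intro: exI[of _ 0])
next
  case (insert i I)
  then show ?case by (simp add: has_bisum_add)
qed

lemma has_bisum_cong:
  assumes "has_bisum x a f S" "\<And>n. f (a + of_nat n) = g (a + of_nat n)"
    "\<And>n. f (a - of_nat (Suc n)) = g (a - of_nat (Suc n))"
  shows "has_bisum x a g S"
  using assms unfolding has_bisum_def by simp

text \<open>One step moves the single term at \<open>s = a\<close> from the upper half to the lower
  one, and reindexing \<open>x powi (- n)\<close> releases one factor \<open>x\<close>. As only one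
  term changes sides, conditional convergence is no obstacle.\<close>

lemma has_bisum_shift:
  assumes x: "x \<noteq> 0" and h: "has_bisum x a h S"
  shows "has_bisum x a (\<lambda>s. h (s + of_nat k)) (x ^ k * S)"
proof (induction k)
  case 0
  then show ?case using h by simp
next
  case (Suc k)
  define f where "f = (\<lambda>s. h (s + of_nat k))"
  obtain A B where A: "(\<lambda>n. inverse x ^ n * f (a + of_nat n)) sums A"
    and B: "(\<lambda>n. x ^ Suc n * f (a - of_nat (Suc n))) sums B" and S: "x ^ k * S = A + B"
    using Suc unfolding has_bisum_def f_def by blast
  have "(\<lambda>n. x * (inverse x ^ Suc n * f (a + of_nat (Suc n)))) sums (x * (A - f a))"
    using A sums_Suc_iff[of "\<lambda>n. inverse x ^ n * f (a + of_nat n)" "A - f a"]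
    by (intro sums_mult) simp
  moreover have "x * (inverse x ^ Suc n * f (a + of_nat (Suc n))) = inverse x ^ n * f (a + of_nat n + 1)" for n
    using x by (simp add: add_ac)
  ultimately have 1: "(\<lambda>n. inverse x ^ n * f (a + of_nat n + 1)) sums (x * (A - f a))" by (simp only:)
  define g where "g = (\<lambda>n. x ^ Suc n * f (a - of_nat (Suc n) + 1))"
  have "(\<lambda>n. g (Suc n)) sums (x * B)"
    using sums_mult[OF B, of x] unfolding g_def by (simp add: algebra_simps)
  then have "g sums (x * B + g 0)" by (rule sums_Suc)
  then have 2: "(\<lambda>n. x ^ Suc n * f (a - of_nat (Suc n) + 1)) sums (x * B + x * f a)"
    unfolding g_def by simp
  have "x ^ Suc k * S = x * (A - f a) + (x * B + x * f a)"
  proof -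
    have "x ^ Suc k * S = x * (x ^ k * S)" by simp
    then show ?thesis unfolding S by (simp add: right_diff_distrib distrib_left)
  qed
  with 1 2 have "has_bisum x a (\<lambda>s. f (s + 1)) (x ^ Suc k * S)" unfolding has_bisum_def by blast
  then show ?case unfolding f_def by (simp add: add_ac)
qed

lemma nonint_shift:
  assumes "a \<notin> \<int>"
  shows "of_nat (Suc n) + (a - 1) \<noteq> (0::complex)" "of_nat (Suc n) + (- a) \<noteq> (0::complex)"
proof -
  show "of_nat (Suc n) + (a - 1) \<noteq> (0::complex)"
  proof
    assume "of_nat (Suc n) + (a - 1) = 0"
    then have "a = - of_nat n" by (simp add: eq_neg_iff_add_eq_0 add.commute)
    then show False using assms by simp
  qed
  show "of_nat (Suc n) + (- a) \<noteq> (0::complex)"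
  proof
    assume "of_nat (Suc n) + (- a) = 0"
    then have "a = of_nat (Suc n)" by simp
    then show False using assms by (metis Ints_of_nat)
  qed
qed

text \<open>The upper half is a Lerch sum at \<open>1 / x\<close>; in the lower half the
  denominators are negated, which produces \<open>(-1) ^ Suc m\<close>. For \<open>m = 0\<close>
  each half converges only because \<open>x \<noteq> 1\<close>.\<close>

lemma has_bisum_power:
  assumes x: "norm x = 1" "x \<noteq> 1" and a: "a \<notin> \<int>"
  shows "has_bisum x a (\<lambda>s. 1 / s ^ Suc m) (- C_coeff x a m)"
proof -
  have x0: "x \<noteq> 0" using x by auto
  have ix: "norm (inverse x) \<le> 1" "inverse x \<noteq> 1"
    using x by (auto simp: norm_inverse inverse_eq_1_iff)
  have "(\<lambda>n. inverse x ^ n * hw (a - 1) (Suc m) n) sums lerch (a - 1) (Suc m) (inverse x)"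
    unfolding lerch_def using ix
    by (intro summable_sums summable_lerch nonint_shift[OF a]) auto
  moreover have "hw (a - 1) (Suc m) n = 1 / (a + of_nat n) ^ Suc m" for n
    unfolding hw_def by (simp add: add.commute)
  ultimately have 1: "(\<lambda>n. inverse x ^ n * (1 / (a + of_nat n) ^ Suc m)) sums lerch (a - 1) (Suc m) (inverse x)"
    by simp
  have e: "x ^ Suc n / (of_nat (Suc n) + (1 - a) - 1) ^ Suc m = x * (x ^ n * hw (- a) (Suc m) n)" for n
  proof -
    have "of_nat (Suc n) + (1 - a) - 1 = of_nat (Suc n) + - a" by simp
    then show ?thesis unfolding hw_def by (simp only: power_Suc mult_1_right times_divide_eq_right mult.assoc)
  qed
  have "(\<lambda>n. x ^ Suc n / (of_nat (Suc n) + (1 - a) - 1) ^ Suc m) sums Li_hurwitz (Suc m) x (1 - a)"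
    unfolding Li_hurwitz_def unfolding e using x
    by (intro summable_sums summable_mult summable_lerch nonint_shift[OF a]) auto
  from sums_mult[OF this, of "(-1) ^ Suc m"]
  have "(\<lambda>n. (-1) ^ Suc m * (x ^ Suc n / (of_nat (Suc n) + (1 - a) - 1) ^ Suc m))
      sums ((-1) ^ Suc m * Li_hurwitz (Suc m) x (1 - a))" .
  moreover have "(-1) ^ Suc m * (x ^ Suc n / (of_nat (Suc n) + (1 - a) - 1) ^ Suc m)
      = x ^ Suc n * (1 / (a - of_nat (Suc n)) ^ Suc m)" for n
  proof -
    have n: "a - of_nat (Suc n) = - (of_nat (Suc n) + (1 - a) - 1)" by simp
    show ?thesis unfolding n power_minus[of "of_nat (Suc n) + (1 - a) - 1"]
      by (cases "even m"; simp)
  qed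
  ultimately have 2: "(\<lambda>n. x ^ Suc n * (1 / (a - of_nat (Suc n)) ^ Suc m))
      sums ((-1) ^ Suc m * Li_hurwitz (Suc m) x (1 - a))" by simp
  have "Li_hurwitz (Suc m) (inverse x) a = inverse x * lerch (a - 1) (Suc m) (inverse x)"
    using ix by (intro Li_hurwitz_lerch nonint_shift[OF a]) auto
  then have "- C_coeff x a m = lerch (a - 1) (Suc m) (inverse x) + (-1) ^ Suc m * Li_hurwitz (Suc m) x (1 - a)"
    unfolding C_coeff_def using x0 by (simp flip: mult.assoc)
  with 1 2 show ?thesis unfolding has_bisum_def by blast
qed

text \<open>Up to the factor \<open>- (x ^ k)\<close>, the image of the principal part
  \<open>princ p H\<close> at the pole \<open>- k\<close> under bilateral summation.\<close>

definition princ_C :: "complex \<Rightarrow> complex \<Rightarrow> nat \<Rightarrow> complex fps \<Rightarrow> complex" where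
  "princ_C x a p H = (\<Sum>m<p. fps_nth H (p - 1 - m) * C_coeff x a m)"

lemma has_bisum_princ:
  assumes x: "norm x = 1" "x \<noteq> 1" and a: "a \<notin> \<int>"
  shows "has_bisum x a (\<lambda>s. princ p H (s + of_nat k)) (- (x ^ k * princ_C x a p H))"
proof -
  have x0: "x \<noteq> 0" using x by auto
  have "has_bisum x a (\<lambda>s. \<Sum>m<p. fps_nth H (p - 1 - m) * (1 / (s + of_nat k) ^ Suc m))
      (\<Sum>m<p. fps_nth H (p - 1 - m) * (x ^ k * - C_coeff x a m))"
    by (intro has_bisum_sum has_bisum_cmult has_bisum_shift[OF x0 has_bisum_power[OF assms]]) auto
  then show ?thesis unfolding princ_def princ_C_def by (simp add: sum_distrib_left sum_negf mult_ac)
qed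

text \<open>The contributions of the poles of \<open>1 / ((s + i) ^ p1 * (s + j) ^ p2 * s ^ q)\<close>: the pole at
  \<open>0\<close>, the pole at \<open>- j\<close> when only the factor \<open>(s + j) ^ p2\<close> vanishes among the first two, and
  the pole at \<open>- i = - j\<close>.\<close>

definition res_origin :: "complex \<Rightarrow> complex \<Rightarrow> nat \<Rightarrow> nat \<Rightarrow> nat \<Rightarrow> nat \<Rightarrow> nat \<Rightarrow> complex" where
  "res_origin x a p1 p2 q i j =
     (if i = 0 \<and> j = 0 then princ_C x a (p1 + p2 + q) 1
      else if i = 0 then princ_C x a (p1 + q) (inv_lin_pow p2 (of_nat j))
      else if j = 0 then princ_C x a (p2 + q) (inv_lin_pow p1 (of_nat i))
      else princ_C x a q (inv_lin_pow p1 (of_nat i) * inv_lin_pow p2 (of_nat j)))"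

definition res_off :: "complex \<Rightarrow> complex \<Rightarrow> nat \<Rightarrow> nat \<Rightarrow> nat \<Rightarrow> nat \<Rightarrow> nat \<Rightarrow> complex" where
  "res_off x a p1 p2 q i j = (if j = 0 \<or> i = j then 0 else
     x ^ j * princ_C x a p2 (inv_lin_pow p1 (of_nat i - of_nat j) * inv_lin_pow q (- of_nat j)))"

definition res_diag :: "complex \<Rightarrow> complex \<Rightarrow> nat \<Rightarrow> nat \<Rightarrow> nat \<Rightarrow> nat \<Rightarrow> nat \<Rightarrow> complex" where
  "res_diag x a p1 p2 q i j = (if j = 0 \<or> i \<noteq> j then 0 else
     x ^ j * princ_C x a (p1 + p2) (inv_lin_pow q (- of_nat j)))"

text \<open>The shape of the partial fractions depends on which of the poles \<open>0\<close>,
  \<open>- i\<close>, \<open>- j\<close> coincide, since the exponents of merged poles add up; the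
  five cases are exactly these coincidences. The pole at \<open>- i\<close> is
  \<open>res_off\<close> with the two factors exchanged.\<close>

lemma has_bisum_triple:
  assumes x: "norm x = 1" "x \<noteq> 1" and a: "a \<notin> \<int>" and p: "p1 \<ge> 1" "p2 \<ge> 1" "q \<ge> 1"
  shows "has_bisum x a (\<lambda>s. 1 / ((s + of_nat i) ^ p1 * (s + of_nat j) ^ p2 * s ^ q))
    (- (res_origin x a p1 p2 q i j + res_off x a p1 p2 q i j + res_off x a p2 p1 q j i
        + res_diag x a p1 p2 q i j))"
proof -
  note bp = has_bisum_princ[OF x a]
  have nz: "a + of_nat n + of_nat k \<noteq> 0" "a - of_nat (Suc n) + of_nat k \<noteq> 0" for n k
  proof -
    have "s \<in> \<int>" if "s + t = 0" "t \<in> \<int>" for s t :: complex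
      using that by (metis Ints_minus eq_neg_iff_add_eq_0)
    from this[of a "of_nat n + of_nat k"] this[of a "of_nat k - of_nat (Suc n)"]
    show "a + of_nat n + of_nat k \<noteq> 0" "a - of_nat (Suc n) + of_nat k \<noteq> 0"
      using a by (auto simp: algebra_simps)
  qed
  \<comment> \<open>As \<open>a\<close> is not an integer, no point of the bilateral sum is a pole,
    so an identity valid away from the poles is enough.\<close>
  have bp': "has_bisum x a f S" if "has_bisum x a g S" "\<And>s. (\<And>k. s + of_nat k \<noteq> 0) \<Longrightarrow> g s = f s" for f g S
    using nz by (intro has_bisum_cong[OF that(1)] that(2)) blast+
  consider "i = 0" "j = 0" | "i = 0" "j \<noteq> 0" | "i \<noteq> 0" "j = 0" | "i \<noteq> 0" "i = j" | "i \<noteq> 0" "j \<noteq> 0" "i \<noteq> j"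
    by blast
  then show ?thesis
  proof cases
    case 1
    have "has_bisum x a (\<lambda>s. princ (p1 + p2 + q) 1 (s + of_nat 0)) (- (x ^ 0 * princ_C x a (p1 + p2 + q) 1))"
      by (rule bp)
    then show ?thesis
      using p 1 by (simp add: princ_one res_origin_def res_off_def res_diag_def power_add)
  next
    case 2
    have "has_bisum x a (\<lambda>s. princ (p1 + q) (inv_lin_pow p2 (of_nat j)) (s + of_nat 0)
          + princ p2 (inv_lin_pow (p1 + q) (- of_nat j)) (s + of_nat j))
        (- (x ^ 0 * princ_C x a (p1 + q) (inv_lin_pow p2 (of_nat j)))
          + - (x ^ j * princ_C x a p2 (inv_lin_pow (p1 + q) (- of_nat j))))"
      by (intro has_bisum_add bp)
    then show ?thesis
    proof (rule bp'[THEN arg_cong[where f = "has_bisum x a _", THEN iffD1, rotated]])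
      fix s :: complex assume s: "\<And>k. s + of_nat k \<noteq> 0"
      show "princ (p1 + q) (inv_lin_pow p2 (of_nat j)) (s + of_nat 0)
          + princ p2 (inv_lin_pow (p1 + q) (- of_nat j)) (s + of_nat j)
        = 1 / ((s + of_nat i) ^ p1 * (s + of_nat j) ^ p2 * s ^ q)"
        using partial_fractions_2[of 0 "of_nat j" s "p1 + q" p2] s[of 0] s[of j] p 2
        by (simp add: power_add mult_ac)
    qed (use 2 in \<open>simp add: res_origin_def res_off_def res_diag_def inv_lin_pow_add\<close>)
  next
    case 3
    have "has_bisum x a (\<lambda>s. princ (p2 + q) (inv_lin_pow p1 (of_nat i)) (s + of_nat 0)
          + princ p1 (inv_lin_pow (p2 + q) (- of_nat i)) (s + of_nat i))
        (- (x ^ 0 * princ_C x a (p2 + q) (inv_lin_pow p1 (of_nat i)))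
          + - (x ^ i * princ_C x a p1 (inv_lin_pow (p2 + q) (- of_nat i))))"
      by (intro has_bisum_add bp)
    then show ?thesis
    proof (rule bp'[THEN arg_cong[where f = "has_bisum x a _", THEN iffD1, rotated]])
      fix s :: complex assume s: "\<And>k. s + of_nat k \<noteq> 0"
      show "princ (p2 + q) (inv_lin_pow p1 (of_nat i)) (s + of_nat 0)
          + princ p1 (inv_lin_pow (p2 + q) (- of_nat i)) (s + of_nat i)
        = 1 / ((s + of_nat i) ^ p1 * (s + of_nat j) ^ p2 * s ^ q)"
        using partial_fractions_2[of 0 "of_nat i" s "p2 + q" p1] s[of 0] s[of i] p 3
        by (simp add: power_add mult_ac)
    qed (use 3 in \<open>simp add: res_origin_def res_off_def res_diag_def inv_lin_pow_add\<close>)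
  next
    case 4
    have "has_bisum x a (\<lambda>s. princ q (inv_lin_pow (p1 + p2) (of_nat i)) (s + of_nat 0)
          + princ (p1 + p2) (inv_lin_pow q (- of_nat i)) (s + of_nat i))
        (- (x ^ 0 * princ_C x a q (inv_lin_pow (p1 + p2) (of_nat i)))
          + - (x ^ i * princ_C x a (p1 + p2) (inv_lin_pow q (- of_nat i))))"
      by (intro has_bisum_add bp)
    then show ?thesis
    proof (rule bp'[THEN arg_cong[where f = "has_bisum x a _", THEN iffD1, rotated]])
      fix s :: complex assume s: "\<And>k. s + of_nat k \<noteq> 0"
      show "princ q (inv_lin_pow (p1 + p2) (of_nat i)) (s + of_nat 0)
          + princ (p1 + p2) (inv_lin_pow q (- of_nat i)) (s + of_nat i)
        = 1 / ((s + of_nat i) ^ p1 * (s + of_nat j) ^ p2 * s ^ q)"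
        using partial_fractions_2[of 0 "of_nat i" s q "p1 + p2"] s[of 0] s[of i] p 4
        by (simp add: power_add mult_ac)
    qed (use 4 in \<open>simp add: res_origin_def res_off_def res_diag_def inv_lin_pow_add\<close>)
  next
    case 5
    have "has_bisum x a (\<lambda>s. princ p1 (inv_lin_pow p2 (of_nat j - of_nat i) * inv_lin_pow q (- of_nat i)) (s + of_nat i)
          + princ p2 (inv_lin_pow p1 (of_nat i - of_nat j) * inv_lin_pow q (- of_nat j)) (s + of_nat j)
          + princ q (inv_lin_pow p1 (of_nat i) * inv_lin_pow p2 (of_nat j)) (s + of_nat 0))
        (- (x ^ i * princ_C x a p1 (inv_lin_pow p2 (of_nat j - of_nat i) * inv_lin_pow q (- of_nat i)))
          + - (x ^ j * princ_C x a p2 (inv_lin_pow p1 (of_nat i - of_nat j) * inv_lin_pow q (- of_nat j)))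
          + - (x ^ 0 * princ_C x a q (inv_lin_pow p1 (of_nat i) * inv_lin_pow p2 (of_nat j))))"
      by (intro has_bisum_add bp)
    then show ?thesis
    proof (rule bp'[THEN arg_cong[where f = "has_bisum x a _", THEN iffD1, rotated]])
      fix s :: complex assume s: "\<And>k. s + of_nat k \<noteq> 0"
      show "princ p1 (inv_lin_pow p2 (of_nat j - of_nat i) * inv_lin_pow q (- of_nat i)) (s + of_nat i)
          + princ p2 (inv_lin_pow p1 (of_nat i - of_nat j) * inv_lin_pow q (- of_nat j)) (s + of_nat j)
          + princ q (inv_lin_pow p1 (of_nat i) * inv_lin_pow p2 (of_nat j)) (s + of_nat 0)
        = 1 / ((s + of_nat i) ^ p1 * (s + of_nat j) ^ p2 * s ^ q)"
        using partial_fractions_3[of "of_nat i" "of_nat j" 0 s q p1 p2] s[of 0] s[of i] s[of j] p 5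
        by simp
    qed (use 5 in \<open>simp add: res_origin_def res_off_def res_diag_def\<close>)
  qed
qed

section \<open>Absolutely convergent rearrangement\<close>

lemma summable_on_pair_bound:
  fixes F :: "'a \<times> 'b \<Rightarrow> complex"
  assumes u: "u summable_on A" and v: "v summable_on B"
    and uv: "\<And>x. 0 \<le> u x" "\<And>y. 0 \<le> v y"
    and F: "\<And>x y. x \<in> A \<Longrightarrow> y \<in> B \<Longrightarrow> norm (F (x, y)) \<le> u x * (v y :: real)"
  shows "F summable_on A \<times> B"
proof (rule abs_summable_summable, rule Infinite_Sum.abs_summable_on_comparison_test)
  have "(\<lambda>(x, y). u x * v y) summable_on A \<times> B"
  proof (rule summable_on_SigmaI)
    fix x show "((\<lambda>y. case (x, y) of (x, y) \<Rightarrow> u x * v y) has_sum (u x * infsum v B)) B"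
      using has_sum_cmult_right[OF has_sum_infsum[OF v]] by simp
  qed (use uv u in \<open>auto intro: summable_on_cmult_left\<close>)
  then show "(\<lambda>z. norm (case z of (x, y) \<Rightarrow> u x * v y)) summable_on A \<times> B"
    using uv by (simp add: case_prod_unfold)
  fix z assume "z \<in> A \<times> B"
  then show "norm (F z) \<le> norm (case z of (x, y) \<Rightarrow> u x * v y)"
    using F uv by (auto simp: abs_mult)
qed

lemma has_sum_product:
  fixes f :: "'a \<Rightarrow> complex" and g :: "'b \<Rightarrow> complex"
  assumes "(f has_sum a) A" "(g has_sum b) B"
  shows "((\<lambda>(x, y). f x * g y) has_sum (a * b)) (A \<times> B)"
proof (rule has_sum_SigmaI)
  show "((\<lambda>y. case (x, y) of (x, y) \<Rightarrow> f x * g y) has_sum (f x * b)) B" for x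
    using has_sum_cmult_right[OF assms(2)] by simp
  show "((\<lambda>x. f x * b) has_sum (a * b)) A"
    by (rule has_sum_cmult_left[OF assms(1)])
  have "(\<lambda>x. norm (f x)) summable_on A" "(\<lambda>x. norm (g x)) summable_on B"
    using assms has_sum_imp_summable summable_on_iff_abs_summable_on_complex by blast+
  then show "(\<lambda>(x, y). f x * g y) summable_on A \<times> B"
    by (rule summable_on_pair_bound) (auto simp: norm_mult)
qed

lemma has_sum_Suc:
  fixes f :: "nat \<Rightarrow> complex"
  assumes "((\<lambda>n. f (Suc n)) has_sum S) UNIV"
  shows "(f has_sum (f 0 + S)) UNIV"
proof -
  have "(f has_sum S) (range Suc)"
    using assms by (subst has_sum_reindex) (auto simp: o_def)
  moreover have "(f has_sum f 0) {0}" by (rule has_sum_finiteI) auto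
  ultimately have "(f has_sum (f 0 + S)) ({0} \<union> range Suc)"
    by (intro has_sum_Un_disjoint) auto
  moreover have "{0} \<union> range Suc = UNIV"
    by (metis UNIV_nat_eq insert_is_Un)
  ultimately show ?thesis by simp
qed

lemma has_sum_nat_bounded:
  fixes y :: complex
  assumes y: "norm y < 1" and w: "\<And>n. norm (w n :: complex) \<le> K"
  shows "((\<lambda>n. y ^ n * w n) has_sum (\<Sum>n. y ^ n * w n)) UNIV"
proof (rule norm_summable_imp_has_sum)
  show s: "summable (\<lambda>n. norm (y ^ n * w n))"
  proof (rule summable_comparison_test)
    show "\<exists>N. \<forall>n\<ge>N. norm (norm (y ^ n * w n)) \<le> norm y ^ n * K"
      using w by (auto simp: norm_mult norm_power intro!: mult_left_mono)
    show "summable (\<lambda>n. norm y ^ n * K)"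
      using y by (intro summable_mult2 summable_geometric) auto
  qed
  show "(\<lambda>n. y ^ n * w n) sums (\<Sum>n. y ^ n * w n)"
    using s by (intro summable_sums) (rule summable_norm_cancel)
qed

lemma hw_0: "hw 0 p n = 1 / of_nat (Suc n) ^ p"
  by (simp add: hw_def)

lemma norm_hw_0: "norm (hw 0 p n) \<le> 1"
proof -
  have "1 \<le> real (Suc n) ^ p" by (rule one_le_power) simp
  then show ?thesis unfolding hw_0 by (simp add: norm_divide norm_power del: of_nat_Suc)
qed

lemma Li_has_sum:
  assumes "norm y < 1"
  shows "((\<lambda>n. y ^ Suc n * hw 0 p n) has_sum Li p y) UNIV"
proof -
  have "((\<lambda>n. y ^ n * hw 0 p n) has_sum (\<Sum>n. y ^ n * hw 0 p n)) UNIV" (is "(_ has_sum ?S) _")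
    by (rule has_sum_nat_bounded[OF assms norm_hw_0])
  from has_sum_cmult_right[OF this, of y]
  have h: "((\<lambda>n. y ^ Suc n * hw 0 p n) has_sum (y * ?S)) UNIV" by (simp add: mult.assoc)
  have "Li p y = y * ?S"
    using has_sum_imp_sums[OF h] by (simp add: Li_def hw_0 sums_iff)
  with h show ?thesis by simp
qed

text \<open>For \<open>q = 1\<close> the factor \<open>s n ^ q\<close> gives only one power of
  \<open>1 / n\<close>. The condition \<open>s2\<close> supplies the second one from
  \<open>(s n + of_nat i) ^ p1\<close>, at the cost of a factor \<open>Suc i\<close> that the
  geometric weight absorbs. The family over \<open>n\<close>, \<open>i\<close>, \<open>j\<close>
  then has a product majorant, and its two orders of summation are the two conclusions.\<close>

lemma triple_fubini:
  fixes s c :: "nat \<Rightarrow> complex"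
  assumes d: "0 < d" and c: "\<And>n. norm (c n) \<le> 1"
    and s0: "\<And>n. d * real (Suc n) \<le> norm (s n)"
    and s1: "\<And>n i. d \<le> norm (s n + of_nat i)"
    and s2: "\<And>n i. d * real (Suc n) \<le> norm (s n + of_nat i) * real (Suc i)"
    and p: "p1 \<ge> 1" "p2 \<ge> 1" "q \<ge> 1" and y: "norm y1 < 1" "norm y2 < 1"
    and V: "\<And>i j. (\<lambda>n. c n * (1 / ((s n + of_nat i) ^ p1 * (s n + of_nat j) ^ p2 * s n ^ q))) sums V i j"
  obtains S where
    "(\<lambda>n. c n * (lerch (s n - 1) p1 y1 * lerch (s n - 1) p2 y2 / s n ^ q)) sums S"
    "((\<lambda>(i, j). y1 ^ i * y2 ^ j * V i j) has_sum S) UNIV"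
proof -
  define T where "T = (\<lambda>n i j. c n * (1 / ((s n + of_nat i) ^ p1 * (s n + of_nat j) ^ p2 * s n ^ q)))"
  define F where "F = (\<lambda>(n, (i, j)). y1 ^ i * y2 ^ j * T n i j)"
  define K where "K = 1 / d ^ (p1 + p2 + q)"
  define u where "u = (\<lambda>n. K * (1 / real (Suc n) ^ 2))"
  \<comment> \<open>The factor \<open>Suc i\<close> paid for the extra decay in \<open>n\<close>
    sits with \<open>norm y1 ^ i\<close>; the result is summable as the derivative of a geometric
    series.\<close>
  define v where "v = (\<lambda>(i, j). (real (Suc i) * norm y1 ^ i) * norm y2 ^ j)"
  have K: "K > 0" unfolding K_def using d by simp
  have nz: "s n + of_nat i \<noteq> 0" "s n \<noteq> 0" for n i
    using s1[of n i] s1[of n 0] d by auto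
  have Tb: "norm (T n i j) \<le> u n * real (Suc i)" for n i j
  proof -
    have d1: "d \<le> norm (s n)" using s1[of n 0] by simp
    have e1: "d ^ p1 * real (Suc n) \<le> norm (s n + of_nat i) ^ p1 * real (Suc i)"
    proof -
      obtain k where k: "p1 = Suc k" using p(1) by (cases p1) auto
      have "d ^ k * (d * real (Suc n)) \<le> norm (s n + of_nat i) ^ k * (norm (s n + of_nat i) * real (Suc i))"
        by (intro mult_mono power_mono s1 s2) (use d in auto)
      then show ?thesis unfolding k by (simp add: mult_ac)
    qed
    have e2: "d ^ p2 \<le> norm (s n + of_nat j) ^ p2"
      using d s1[of n j] by (intro power_mono) auto
    have e3: "d ^ q * real (Suc n) \<le> norm (s n) ^ q"
    proof -
      obtain k where k: "q = Suc k" using p(3) by (cases q) auto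
      have "d ^ k * (d * real (Suc n)) \<le> norm (s n) ^ k * norm (s n)"
        by (intro mult_mono power_mono d1 s0) (use d in auto)
      then show ?thesis unfolding k by (simp add: mult_ac)
    qed
    define X where "X = norm (s n + of_nat i) ^ p1 * norm (s n + of_nat j) ^ p2 * norm (s n) ^ q"
    have X: "X > 0" unfolding X_def using nz by simp
    have "(d ^ p1 * real (Suc n)) * d ^ p2 * (d ^ q * real (Suc n))
        \<le> (norm (s n + of_nat i) ^ p1 * real (Suc i)) * norm (s n + of_nat j) ^ p2 * norm (s n) ^ q"
      using d by (intro mult_mono e1 e2 e3) auto
    then have le: "d ^ (p1 + p2 + q) * real (Suc n) ^ 2 \<le> X * real (Suc i)"
      unfolding X_def by (simp add: power_add power2_eq_square mult_ac del: of_nat_Suc)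
    have "norm (T n i j) \<le> 1 * (1 / X)"
      unfolding T_def X_def norm_mult norm_divide norm_power
      using c[of n] by (intro mult_mono) auto
    also have "1 * (1 / X) \<le> real (Suc i) / (d ^ (p1 + p2 + q) * real (Suc n) ^ 2)"
      using le X d by (simp add: divide_simps mult.commute del: of_nat_Suc)
    finally show ?thesis unfolding u_def K_def by simp
  qed
  have us: "summable u" unfolding u_def
    using inverse_power_summable[of 2, where 'a = real] summable_Suc_iff[of "\<lambda>n. 1 / real n ^ 2"]
    by (intro summable_mult) (simp add: inverse_eq_divide)
  have u0: "u n \<ge> 0" for n unfolding u_def using K by simp
  have uS: "u summable_on UNIV"
    using us u0 by (subst summable_on_UNIV_nonneg_real_iff) auto
  have v0: "v z \<ge> 0" for z unfolding v_def by (auto simp: case_prod_unfold)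
  have vS: "v summable_on UNIV"
  proof -
    have "summable (\<lambda>i. real (Suc i) * norm y1 ^ i)"
    proof -
      have "summable (\<lambda>i. real i * norm y1 ^ (i - 1))"
        using geometric_deriv_sums[of "norm y1"] y summable_Suc_iff[of "\<lambda>i. real i * norm y1 ^ (i - 1)"]
        by (simp add: sums_iff)
      then show ?thesis by (subst (asm) summable_Suc_iff[symmetric]) simp
    qed
    then have a: "(\<lambda>i. real (Suc i) * norm y1 ^ i) summable_on UNIV"
      by (subst summable_on_UNIV_nonneg_real_iff) auto
    have b: "(\<lambda>j. norm y2 ^ j) summable_on UNIV"
      using y by (subst summable_on_UNIV_nonneg_real_iff) (auto intro: summable_geometric)
    have "(\<lambda>z. complex_of_real (v z)) summable_on UNIV \<times> UNIV"
      by (rule summable_on_pair_bound[OF a b]) (auto simp: v_def norm_mult norm_power simp del: of_nat_Suc)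
    then have "(\<lambda>z. Re (complex_of_real (v z))) summable_on UNIV"
      by (intro summable_on_Re) simp
    then show ?thesis by simp
  qed
  have FS: "F summable_on UNIV \<times> UNIV"
  proof (rule summable_on_pair_bound[OF uS vS u0 v0])
    fix n :: nat and z :: "nat \<times> nat"
    obtain i j where z: "z = (i, j)" by (cases z)
    have "norm (F (n, z)) = norm y1 ^ i * norm y2 ^ j * norm (T n i j)"
      unfolding F_def z by (simp add: norm_mult norm_power)
    also have "\<dots> \<le> norm y1 ^ i * norm y2 ^ j * (u n * real (Suc i))"
      by (intro mult_left_mono Tb) auto
    finally show "norm (F (n, z)) \<le> u n * v z" unfolding v_def z by (simp add: mult_ac)
  qed
  then obtain S where S: "(F has_sum S) (UNIV \<times> UNIV)"
    using has_sum_infsum by blast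
  have "((\<lambda>n. c n * (lerch (s n - 1) p1 y1 * lerch (s n - 1) p2 y2 / s n ^ q)) has_sum S) UNIV"
  proof (rule has_sum_SigmaD[OF S])
    fix n
    have hwb: "hw (s n - 1) r k = 1 / (s n + of_nat k) ^ r" for r k
      unfolding hw_def by (simp add: add.commute)
    have "norm (hw (s n - 1) r k) \<le> 1 / d ^ r" for r k
      unfolding hwb using d s1[of n k] nz(1)[of n k]
      by (auto simp: norm_divide norm_power intro!: divide_left_mono power_mono)
    then have L: "((\<lambda>k. y ^ k * hw (s n - 1) r k) has_sum lerch (s n - 1) r y) UNIV"
      if "norm y < 1" for r y
      unfolding lerch_def using that by (rule has_sum_nat_bounded[rotated])
    have "((\<lambda>z. (c n / s n ^ q) * (case z of (i, j) \<Rightarrow> y1 ^ i * hw (s n - 1) p1 i * (y2 ^ j * hw (s n - 1) p2 j)))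
        has_sum ((c n / s n ^ q) * (lerch (s n - 1) p1 y1 * lerch (s n - 1) p2 y2))) (UNIV \<times> UNIV)"
      by (intro has_sum_cmult_right has_sum_product L y)
    moreover have "(c n / s n ^ q) * (case z of (i, j) \<Rightarrow> y1 ^ i * hw (s n - 1) p1 i * (y2 ^ j * hw (s n - 1) p2 j))
        = F (n, z)" for z
      unfolding F_def T_def hwb by (simp add: case_prod_unfold mult_ac)
    ultimately show "((\<lambda>z. F (n, z)) has_sum (c n * (lerch (s n - 1) p1 y1 * lerch (s n - 1) p2 y2 / s n ^ q))) UNIV"
      by (simp add: mult_ac)
  qed
  moreover have "((\<lambda>(i, j). y1 ^ i * y2 ^ j * V i j) has_sum S) UNIV"
  proof (rule has_sum_SigmaD)
    show "((\<lambda>(z, n). F (n, z)) has_sum S) (UNIV \<times> UNIV)"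
      using S by (subst (asm) has_sum_swap)
    fix z :: "nat \<times> nat"
    obtain i j where z: "z = (i, j)" by (cases z)
    have "((\<lambda>n. T n i j) has_sum V i j) UNIV"
    proof (rule norm_summable_imp_has_sum)
      show "summable (\<lambda>n. norm (T n i j))"
        using Tb[of _ i j] by (intro summable_comparison_test[OF _ summable_mult2[OF us, of "real (Suc i)"]])
          (auto simp del: of_nat_Suc)
      show "(\<lambda>n. T n i j) sums V i j" unfolding T_def by (rule V)
    qed
    then show "((\<lambda>n. case (z, n) of (z, n) \<Rightarrow> F (n, z)) has_sum (case z of (i, j) \<Rightarrow> y1 ^ i * y2 ^ j * V i j)) UNIV"
      unfolding F_def z by (simp add: has_sum_cmult_right)
  qed
  ultimately show ?thesis by (intro that[of S] has_sum_imp_sums)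
qed

lemma regularised_bisum:
  assumes x: "norm x = 1" "x \<noteq> 1" and a: "a \<notin> \<int>" and p: "p1 \<ge> 1" "p2 \<ge> 1" "q \<ge> 1"
    and y: "norm y1 < 1" "norm y2 < 1"
  obtains S1 S2 where
    "(\<lambda>n. inverse x ^ n * (lerch (a + of_nat n - 1) p1 y1 * lerch (a + of_nat n - 1) p2 y2 / (a + of_nat n) ^ q)) sums S1"
    "(\<lambda>n. x ^ Suc n * (lerch (a - of_nat (Suc n) - 1) p1 y1 * lerch (a - of_nat (Suc n) - 1) p2 y2
        / (a - of_nat (Suc n)) ^ q)) sums S2"
    "((\<lambda>(i, j). y1 ^ i * y2 ^ j * - (res_origin x a p1 p2 q i j + res_off x a p1 p2 q i j
        + res_off x a p2 p1 q j i + res_diag x a p1 p2 q i j)) has_sum (S1 + S2)) UNIV"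
proof -
  define V where "V = (\<lambda>i j. - (res_origin x a p1 p2 q i j + res_off x a p1 p2 q i j
        + res_off x a p2 p1 q j i + res_diag x a p1 p2 q i j))"
  have "has_bisum x a (\<lambda>s. 1 / ((s + of_nat i) ^ p1 * (s + of_nat j) ^ p2 * s ^ q)) (V i j)" for i j
    unfolding V_def by (rule has_bisum_triple[OF x a p])
  note bisum = this
  define f where "f = (\<lambda>i j n. inverse x ^ n * (1 / ((a + of_nat n + of_nat i) ^ p1 * (a + of_nat n + of_nat j) ^ p2 * (a + of_nat n) ^ q)))"
  define g where "g = (\<lambda>i j n. x ^ Suc n * (1 / ((a - of_nat (Suc n) + of_nat i) ^ p1 * (a - of_nat (Suc n) + of_nat j) ^ p2 * (a - of_nat (Suc n)) ^ q)))"
  define A where "A = (\<lambda>i j. suminf (f i j))"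
  define B where "B = (\<lambda>i j. suminf (g i j))"
  have "f i j sums A i j \<and> g i j sums B i j \<and> V i j = A i j + B i j" for i j
  proof -
    obtain A' B' where "f i j sums A'" "g i j sums B'" "V i j = A' + B'"
      using bisum[of i j] unfolding has_bisum_def f_def g_def by blast
    then show ?thesis unfolding A_def B_def by (simp add: sums_iff)
  qed
  then have A: "(\<lambda>n. inverse x ^ n * (1 / ((a + of_nat n + of_nat i) ^ p1 * (a + of_nat n + of_nat j) ^ p2 * (a + of_nat n) ^ q))) sums A i j"
    and B: "(\<lambda>n. x ^ Suc n * (1 / ((a - of_nat (Suc n) + of_nat i) ^ p1 * (a - of_nat (Suc n) + of_nat j) ^ p2 * (a - of_nat (Suc n)) ^ q))) sums B i j"
    and AB: "V i j = A i j + B i j" for i j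
    unfolding f_def g_def by blast+
  obtain d1 where d1: "d1 > 0" "\<And>n. d1 * real (Suc n) \<le> norm (of_nat (Suc n) + (a - 1))"
    using shift_lower_bound[OF nonint_shift(1)[OF a]] by blast
  obtain d2 where d2: "d2 > 0" "\<And>n. d2 * real (Suc n) \<le> norm (of_nat (Suc n) + - a)"
    using shift_lower_bound[OF nonint_shift(2)[OF a]] by blast
  define d where "d = min d1 d2"
  have d: "d > 0" using d1 d2 unfolding d_def by simp
  have up: "d * real (Suc n) \<le> norm (a + of_nat n)" for n
  proof -
    have "d * real (Suc n) \<le> d1 * real (Suc n)" unfolding d_def by (intro mult_right_mono) auto
    also have "\<dots> \<le> norm (a + of_nat n)" using d1(2)[of n] by (simp add: add.commute)
    finally show ?thesis .
  qed
  have dn: "d * real (Suc n) \<le> norm (a - of_nat (Suc n))" for n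
  proof -
    have "d * real (Suc n) \<le> d2 * real (Suc n)" unfolding d_def by (intro mult_right_mono) auto
    also have "\<dots> \<le> norm (a - of_nat (Suc n))" using d2(2)[of n] by (simp add: norm_minus_commute)
    finally show ?thesis .
  qed
  have grow: "d \<le> d * real (Suc n)" for n using d by simp
  have stepd: "d * real m \<le> t * real k" if "d * real l \<le> t" "m \<le> l * k" for l m k t
  proof -
    have "d * real m \<le> d * real l * real k" using that(2) d by (simp add: mult.assoc flip: of_nat_mult)
    also have "\<dots> \<le> t * real k" using that(1) by (intro mult_right_mono) auto
    finally show ?thesis .
  qed
  \<comment> \<open>On the negative side \<open>s n + of_nat i\<close> can be small, but only when
    \<open>i\<close> is close to \<open>n\<close>. With \<open>l\<close> the distance index of the
    shifted point, \<open>Suc n \<le> Suc l * Suc i\<close> holds both for \<open>i \<le> n\<close>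
    and for \<open>i > n\<close>.\<close>
  have low: "\<exists>l. d * real (Suc l) \<le> norm (a - of_nat (Suc n) + of_nat i) \<and> Suc n \<le> Suc l * Suc i" for n i
  proof (cases "i \<le> n")
    case True
    have "a - of_nat (Suc n) + of_nat i = a - of_nat (Suc (n - i))" using True by (simp add: of_nat_diff)
    moreover have "Suc n \<le> Suc (n - i) * Suc i" using True by (simp add: le_diff_conv)
    ultimately show ?thesis using dn[of "n - i"] by (intro exI[of _ "n - i"] conjI; simp only:)
  next
    case False
    have "a - of_nat (Suc n) + of_nat i = a + of_nat (i - Suc n)" using False by (simp add: of_nat_diff)
    moreover have "Suc n \<le> Suc (i - Suc n) * Suc i" using False by simp
    ultimately show ?thesis using up[of "i - Suc n"] by (intro exI[of _ "i - Suc n"] conjI; simp only:)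
  qed
  obtain S1 where S1: "(\<lambda>n. inverse x ^ n * (lerch (a + of_nat n - 1) p1 y1 * lerch (a + of_nat n - 1) p2 y2 / (a + of_nat n) ^ q)) sums S1"
    "((\<lambda>(i, j). y1 ^ i * y2 ^ j * A i j) has_sum S1) UNIV"
  proof (rule triple_fubini[where s = "\<lambda>n. a + of_nat n" and c = "\<lambda>n. inverse x ^ n", OF d _ up _ _ p y A])
    show "norm (inverse x ^ n) \<le> 1" for n using x by (simp add: norm_power norm_inverse)
    show "d \<le> norm (a + of_nat n + of_nat i)" for n i
      using order.trans[OF grow up[of "n + i"]] by (simp add: add.assoc)
    show "d * real (Suc n) \<le> norm (a + of_nat n + of_nat i) * real (Suc i)" for n i
      using stepd[OF up[of "n + i"], of "Suc n" "Suc i"] by (simp add: add.assoc)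
  qed blast
  obtain S2 where S2: "(\<lambda>n. x ^ Suc n * (lerch (a - of_nat (Suc n) - 1) p1 y1 * lerch (a - of_nat (Suc n) - 1) p2 y2
        / (a - of_nat (Suc n)) ^ q)) sums S2"
    "((\<lambda>(i, j). y1 ^ i * y2 ^ j * B i j) has_sum S2) UNIV"
  proof (rule triple_fubini[where s = "\<lambda>n. a - of_nat (Suc n)" and c = "\<lambda>n. x ^ Suc n", OF d _ dn _ _ p y B])
    show "norm (x ^ Suc n) \<le> 1" for n using x by (simp add: norm_power norm_mult)
    show "d \<le> norm (a - of_nat (Suc n) + of_nat i)" for n i
      using low[of n i] grow order.trans by blast
    show "d * real (Suc n) \<le> norm (a - of_nat (Suc n) + of_nat i) * real (Suc i)" for n i
      using low[of n i] stepd by blast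
  qed blast
  have "((\<lambda>(i, j). y1 ^ i * y2 ^ j * V i j) has_sum (S1 + S2)) UNIV"
    using has_sum_add[OF S1(2) S2(2)] by (simp add: AB case_prod_unfold distrib_left)
  then show ?thesis using that[OF S1(1) S2(1)] unfolding V_def by blast
qed

section \<open>Summing the pole contributions over all pairs of indices\<close>

lemma inv_lin_pow_nth':
  assumes "p \<ge> 1" "c \<noteq> 0"
  shows "fps_nth (inv_lin_pow p c) k = (-1) ^ k * of_nat ((k + p - 1) choose (p - 1)) / c ^ (k + p)"
proof -
  obtain r where "p = Suc r" using assms(1) by (cases p) auto
  then show ?thesis using inv_lin_pow_nth[OF assms(2), of r k] by simp
qed

lemma inv_lin_pow_nth_pos:
  assumes "p \<ge> 1"
  shows "fps_nth (inv_lin_pow p (of_nat (Suc i))) k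
    = (-1) ^ k * of_nat ((k + p - 1) choose (p - 1)) * hw 0 (k + p) i"
  using inv_lin_pow_nth'[OF assms, of "of_nat (Suc i)" k] unfolding hw_0 by (simp del: of_nat_Suc)

text \<open>At a negative base the alternating \<open>(-1) ^ k\<close> cancels against the sign of
  the denominator and only \<open>(-1) ^ p\<close> survives. This explains the signs independent of
  \<open>k\<close> in front of the Euler sums and of the sums with the global factor
  \<open>(-1) ^ q\<close>.\<close>

lemma inv_lin_pow_nth_neg:
  assumes "p \<ge> 1"
  shows "fps_nth (inv_lin_pow p (- of_nat (Suc i))) k
    = (-1) ^ p * of_nat ((k + p - 1) choose (p - 1)) * hw 0 (k + p) i"
proof -
  have "(- of_nat (Suc i)) ^ (k + p) = ((-1) ^ k * (-1) ^ p * of_nat (Suc i) ^ (k + p) :: complex)"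
    by (simp only: power_minus[of "of_nat (Suc i)"] power_add mult_ac)
  then show ?thesis
    using inv_lin_pow_nth'[OF assms, of "- of_nat (Suc i)" k] unfolding hw_0
    by (cases "even k"; cases "even p"; simp del: of_nat_Suc)
qed

text \<open>The bound does not depend on \<open>c\<close>: distinct integers differ by at least 1,
  so geometric weights alone make the double families summable.\<close>

lemma norm_inv_lin_pow_nth:
  assumes p: "p \<ge> 1" and c: "1 \<le> norm c"
  shows "norm (fps_nth (inv_lin_pow p c) k) \<le> real ((k + p - 1) choose (p - 1))"
proof -
  have "c \<noteq> 0" using c by auto
  moreover have "1 \<le> norm c ^ (k + p)" using c by (rule one_le_power)
  ultimately show ?thesis unfolding inv_lin_pow_nth'[OF p \<open>c \<noteq> 0\<close>]
    by (simp add: norm_mult norm_divide norm_power divide_le_eq mult_le_cancel_left1)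
qed

text \<open>The coefficient of \<open>X ^ k\<close> in the sum over \<open>i \<ge> 1\<close> of
  \<open>y ^ i / (i + X) ^ p\<close>, that is, in the expansion at the origin of the Lerch sum
  without its singular term.\<close>

definition Li_coeff :: "nat \<Rightarrow> complex \<Rightarrow> nat \<Rightarrow> complex" where
  "Li_coeff p y k = (-1) ^ k * of_nat ((k + p - 1) choose (p - 1)) * Li (k + p) y"

text \<open>For \<open>y \<noteq> 0\<close> this is \<open>S_cyc P Q (1 / y) (y * v)\<close>; the present form also makes sense for
  \<open>norm y < 1\<close>, where the factors of the latter are unbounded.\<close>

definition mixed_sum :: "nat \<Rightarrow> nat \<Rightarrow> complex \<Rightarrow> complex \<Rightarrow> complex" where
  "mixed_sum P Q y v = (\<Sum>n. v ^ Suc n * hsum 0 P y (Suc n) * hw 0 Q n)"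

text \<open>The sum over \<open>j \<ge> 1\<close> and \<open>i \<noteq> j\<close> of
  \<open>y ^ i * v ^ j\<close> times the Taylor coefficients of orders \<open>k\<close> and
  \<open>l\<close>, at the pole \<open>- j\<close>, of \<open>1 / (s + i) ^ p\<close> and
  \<open>1 / s ^ q\<close>. The indices \<open>i > j\<close> give the product of polylogarithms, the
  indices \<open>i < j\<close> the Euler sum.\<close>

definition off_coeff :: "nat \<Rightarrow> nat \<Rightarrow> complex \<Rightarrow> complex \<Rightarrow> nat \<Rightarrow> nat \<Rightarrow> complex" where
  "off_coeff p q y v k l = (-1) ^ q * of_nat ((k + p - 1) choose (p - 1)) * of_nat ((l + q - 1) choose (q - 1))
     * ((-1) ^ k * Li (k + p) y * Li (l + q) (y * v) + (-1) ^ p * mixed_sum (k + p) (l + q) y v)"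

lemma Li_coeff_has_sum:
  assumes "p \<ge> 1" "norm y < 1"
  shows "((\<lambda>i. y ^ Suc i * fps_nth (inv_lin_pow p (of_nat (Suc i))) k) has_sum Li_coeff p y k) UNIV"
  unfolding inv_lin_pow_nth_pos[OF assms(1)] Li_coeff_def
  using has_sum_cmult_right[OF Li_has_sum[OF assms(2), of "k + p"], of "(-1) ^ k * of_nat ((k + p - 1) choose (p - 1))"]
  by (simp add: mult_ac)

lemma has_sum_sum:
  fixes f :: "'i \<Rightarrow> 'a \<Rightarrow> complex"
  assumes "finite I" "\<And>i. i \<in> I \<Longrightarrow> (f i has_sum S i) A"
  shows "((\<lambda>x. \<Sum>i\<in>I. f i x) has_sum (\<Sum>i\<in>I. S i)) A"
  using assms by (induction I rule: finite_induct) (auto intro: has_sum_add)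

lemma has_sum_princ_C:
  assumes "\<And>k. ((\<lambda>z. w z * fps_nth (H z) k) has_sum S k) A"
  shows "((\<lambda>z. w z * princ_C x a p (H z)) has_sum (\<Sum>m<p. S (p - 1 - m) * C_coeff x a m)) A"
proof -
  have "((\<lambda>z. \<Sum>m<p. w z * fps_nth (H z) (p - 1 - m) * C_coeff x a m) has_sum
      (\<Sum>m<p. S (p - 1 - m) * C_coeff x a m)) A"
    by (intro has_sum_sum has_sum_cmult_left assms) auto
  then show ?thesis unfolding princ_C_def by (simp add: sum_distrib_left mult.assoc)
qed

text \<open>The four branches of \<open>res_origin\<close> are the corner, the two axes and the
  interior of the quadrant. In the interior the weights and series factor, so each coefficient is a
  Cauchy product of two \<open>Li_coeff\<close> sequences.\<close>

lemma res_origin_has_sum: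
  assumes p: "p1 \<ge> 1" "p2 \<ge> 1" "q \<ge> 1" and y: "norm y1 < 1" "norm y2 < 1"
  shows "((\<lambda>(i, j). y1 ^ i * y2 ^ j * res_origin x a p1 p2 q i j) has_sum
    (C_coeff x a (p1 + p2 + q - 1)
     + (\<Sum>m<p1 + q. Li_coeff p2 y2 (p1 + q - 1 - m) * C_coeff x a m)
     + (\<Sum>m<p2 + q. Li_coeff p1 y1 (p2 + q - 1 - m) * C_coeff x a m)
     + (\<Sum>m<q. (\<Sum>k\<le>q - 1 - m. Li_coeff p1 y1 k * Li_coeff p2 y2 (q - 1 - m - k)) * C_coeff x a m))) UNIV"
    (is "(?f has_sum (?A + ?B + ?C + ?D)) UNIV")
proof -
  have A: "(?f has_sum ?A) {(0, 0)}"
  proof -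
    obtain P where P: "p1 + p2 + q = Suc P" using p by (cases "p1 + p2 + q") auto
    have "princ_C x a (p1 + p2 + q) 1 = C_coeff x a (p1 + p2 + q - 1)"
      unfolding princ_C_def P by (simp add: sum.neutral)
    then show ?thesis by (intro has_sum_finiteI) (auto simp: res_origin_def)
  qed
  have B: "(?f has_sum ?B) (range (\<lambda>j. (0, Suc j)))"
  proof (subst has_sum_reindex)
    have "((\<lambda>j. y2 ^ Suc j * princ_C x a (p1 + q) (inv_lin_pow p2 (of_nat (Suc j)))) has_sum ?B) UNIV"
      by (intro has_sum_princ_C Li_coeff_has_sum p y)
    then show "(?f \<circ> (\<lambda>j. (0, Suc j)) has_sum ?B) UNIV"
      by (simp add: o_def res_origin_def del: of_nat_Suc)
  qed (auto intro: injI)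
  have C: "(?f has_sum ?C) (range (\<lambda>i. (Suc i, 0)))"
  proof (subst has_sum_reindex)
    have "((\<lambda>j. y1 ^ Suc j * princ_C x a (p2 + q) (inv_lin_pow p1 (of_nat (Suc j)))) has_sum ?C) UNIV"
      by (intro has_sum_princ_C Li_coeff_has_sum p y)
    then show "(?f \<circ> (\<lambda>i. (Suc i, 0)) has_sum ?C) UNIV"
      by (simp add: o_def res_origin_def del: of_nat_Suc)
  qed (auto intro: injI)
  have D: "(?f has_sum ?D) (range (\<lambda>(i, j). (Suc i, Suc j)))"
  proof (subst has_sum_reindex)
    define H where "H = (\<lambda>z. inv_lin_pow p1 (of_nat (Suc (fst z))) * inv_lin_pow p2 (of_nat (Suc (snd z))))"
    have "((\<lambda>z. y1 ^ Suc (fst z) * y2 ^ Suc (snd z) * fps_nth (H z) k) has_sum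
      (\<Sum>l\<le>k. Li_coeff p1 y1 l * Li_coeff p2 y2 (k - l))) UNIV" for k
    proof -
      have "((\<lambda>z. \<Sum>l\<le>k. (case z of (i, j) \<Rightarrow> y1 ^ Suc i * fps_nth (inv_lin_pow p1 (of_nat (Suc i))) l
            * (y2 ^ Suc j * fps_nth (inv_lin_pow p2 (of_nat (Suc j))) (k - l)))) has_sum
          (\<Sum>l\<le>k. Li_coeff p1 y1 l * Li_coeff p2 y2 (k - l))) (UNIV \<times> UNIV)"
        by (intro has_sum_sum has_sum_product Li_coeff_has_sum p y) auto
      moreover have "(\<Sum>l\<le>k. (case z of (i, j) \<Rightarrow> y1 ^ Suc i * fps_nth (inv_lin_pow p1 (of_nat (Suc i))) l
            * (y2 ^ Suc j * fps_nth (inv_lin_pow p2 (of_nat (Suc j))) (k - l))))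
          = y1 ^ Suc (fst z) * y2 ^ Suc (snd z) * fps_nth (H z) k" for z
        unfolding H_def fps_mult_nth sum_distrib_left atLeast0AtMost
        by (intro sum.cong refl) (simp add: case_prod_unfold mult_ac)
      ultimately show ?thesis by simp
    qed
    then have "((\<lambda>z. y1 ^ Suc (fst z) * y2 ^ Suc (snd z) * princ_C x a q (H z)) has_sum ?D) UNIV"
      by (rule has_sum_princ_C)
    moreover have "?f \<circ> (\<lambda>(i, j). (Suc i, Suc j)) = (\<lambda>z. y1 ^ Suc (fst z) * y2 ^ Suc (snd z) * princ_C x a q (H z))"
      by (rule ext) (simp add: H_def res_origin_def case_prod_unfold)
    ultimately show "(?f \<circ> (\<lambda>(i, j). (Suc i, Suc j)) has_sum ?D) UNIV" by simp
  qed (auto intro: injI)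
  have "(?f has_sum (?A + ?B + ?C + ?D))
    ({(0, 0)} \<union> range (\<lambda>j. (0, Suc j)) \<union> range (\<lambda>i. (Suc i, 0)) \<union> range (\<lambda>(i, j). (Suc i, Suc j)))"
    by (intro has_sum_Un_disjoint A B C D) auto
  also have "{(0, 0)} \<union> range (\<lambda>j. (0, Suc j)) \<union> range (\<lambda>i. (Suc i, 0)) \<union> range (\<lambda>(i, j). (Suc i, Suc j)) = UNIV"
  proof -
    have "(i, j) \<in> {(0, 0)} \<union> range (\<lambda>j. (0, Suc j)) \<union> range (\<lambda>i. (Suc i, 0)) \<union> range (\<lambda>(i, j). (Suc i, Suc j))" for i j
      by (cases i; cases j) (auto simp: image_iff)
    then show ?thesis by auto
  qed
  finally show ?thesis .
qed

text \<open>Only \<open>i = j \<ge> 1\<close> contributes, and there the two weights and the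
  \<open>x ^ j\<close> from the shift merge into a single power series.\<close>

lemma res_diag_has_sum:
  assumes p: "p1 \<ge> 1" "p2 \<ge> 1" "q \<ge> 1" and y: "norm y1 < 1" "norm y2 < 1" and x: "norm x = 1"
  shows "((\<lambda>(i, j). y1 ^ i * y2 ^ j * res_diag x a p1 p2 q i j) has_sum
    (\<Sum>m<p1 + p2. (-1) ^ q * of_nat ((p1 + p2 - 1 - m + q - 1) choose (q - 1))
        * Li (p1 + p2 - 1 - m + q) (y1 * y2 * x) * C_coeff x a m)) UNIV" (is "(?f has_sum ?S) UNIV")
proof -
  have yx: "norm (y1 * y2 * x) < 1"
    using y x mult_strict_mono'[of "norm y1" 1 "norm y2" 1] by (simp add: norm_mult)
  have "((\<lambda>j. (y1 * y2 * x) ^ Suc j * fps_nth (inv_lin_pow q (- of_nat (Suc j))) k) has_sum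
      ((-1) ^ q * of_nat ((k + q - 1) choose (q - 1)) * Li (k + q) (y1 * y2 * x))) UNIV" for k
    unfolding inv_lin_pow_nth_neg[OF p(3)]
    using has_sum_cmult_right[OF Li_has_sum[OF yx, of "k + q"], of "(-1) ^ q * of_nat ((k + q - 1) choose (q - 1))"]
    by (simp add: mult_ac)
  then have h: "((\<lambda>j. (y1 * y2 * x) ^ Suc j * princ_C x a (p1 + p2) (inv_lin_pow q (- of_nat (Suc j)))) has_sum ?S) UNIV"
    by (rule has_sum_princ_C)
  have eq: "(\<lambda>j. (y1 * y2 * x) ^ Suc j * princ_C x a (p1 + p2) (inv_lin_pow q (- of_nat (Suc j)))) = ?f \<circ> (\<lambda>j. (Suc j, Suc j))"
    by (rule ext) (simp add: res_diag_def power_mult_distrib del: of_nat_Suc)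
  have "((?f \<circ> (\<lambda>j. (Suc j, Suc j))) has_sum ?S) UNIV" using h unfolding eq .
  then have "(?f has_sum ?S) (range (\<lambda>j. (Suc j, Suc j)))"
    by (subst has_sum_reindex) (auto intro: injI)
  then show ?thesis
  proof (subst has_sum_cong_neutral[of UNIV "range (\<lambda>j. (Suc j, Suc j))" ?f ?f, symmetric])
    fix z :: "nat \<times> nat" assume z: "z \<in> UNIV - range (\<lambda>j. (Suc j, Suc j))"
    obtain i j where ij: "z = (i, j)" by (cases z)
    have "j = 0 \<or> i \<noteq> j" using z unfolding ij by (cases j) auto
    then show "?f z = 0" unfolding ij res_diag_def by auto
  qed auto
qed

lemma hsum_0_eq:
  "hsum 0 P y n = (\<Sum>i<n. y ^ i * hw 0 P (n - 1 - i))"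
proof (induction n)
  case (Suc n)
  have "(\<Sum>i<Suc n. y ^ i * hw 0 P (Suc n - 1 - i)) = hw 0 P n + (\<Sum>i<n. y ^ Suc i * hw 0 P (n - Suc i))"
    by (subst sum.lessThan_Suc_shift) simp
  also have "(\<Sum>i<n. y ^ Suc i * hw 0 P (n - Suc i)) = y * hsum 0 P y n"
    unfolding Suc sum_distrib_left by (intro sum.cong refl) (simp add: mult.assoc)
  finally show ?case by simp
qed simp

text \<open>The excluded index cuts the sum in two. Below it the base is negative and the finite
  block, read by distance from the cut, is an \<open>hsum\<close>; above it a shift releases
  \<open>y ^ Suc j\<close> and leaves a polylogarithm.\<close>

lemma off_inner_has_sum:
  assumes p: "p \<ge> 1" and y: "norm y < 1"
  shows "((\<lambda>i. if i = Suc j then 0 else y ^ i * fps_nth (inv_lin_pow p (of_nat i - of_nat (Suc j))) k) has_sum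
    (of_nat ((k + p - 1) choose (p - 1)) *
      ((-1) ^ k * y ^ Suc j * Li (k + p) y + (-1) ^ p * hsum 0 (k + p) y (Suc j)))) UNIV"
    (is "(?f has_sum ?S) UNIV")
proof -
  let ?b = "of_nat ((k + p - 1) choose (p - 1)) :: complex"
  have "(?f has_sum (\<Sum>i<Suc j. ?f i)) {..<Suc j}" by (rule has_sum_finiteI) auto
  moreover have "(\<Sum>i<Suc j. ?f i) = ?b * (-1) ^ p * hsum 0 (k + p) y (Suc j)"
    unfolding hsum_0_eq sum_distrib_left
  proof (intro sum.cong refl)
    fix i assume i: "i \<in> {..<Suc j}"
    then have e: "of_nat i - of_nat (Suc j) = (- of_nat (Suc (j - i)) :: complex)"
      by (simp add: of_nat_diff)
    show "?f i = ?b * (-1) ^ p * (y ^ i * hw 0 (k + p) (Suc j - 1 - i))"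
      using i unfolding e inv_lin_pow_nth_neg[OF p] by simp
  qed
  ultimately have 1: "(?f has_sum (?b * (-1) ^ p * hsum 0 (k + p) y (Suc j))) {..<Suc j}" by simp
  have 2: "(?f has_sum 0) {Suc j}" by (rule has_sum_finiteI) auto
  have 3: "(?f has_sum (?b * (-1) ^ k * y ^ Suc j * Li (k + p) y)) (range (\<lambda>l. Suc j + Suc l))"
  proof (subst has_sum_reindex)
    have "((\<lambda>l. ?b * (-1) ^ k * y ^ Suc j * (y ^ Suc l * hw 0 (k + p) l)) has_sum (?b * (-1) ^ k * y ^ Suc j * Li (k + p) y)) UNIV"
      by (intro has_sum_cmult_right Li_has_sum y)
    moreover have "(?f \<circ> (\<lambda>l. Suc j + Suc l)) l = ?b * (-1) ^ k * y ^ Suc j * (y ^ Suc l * hw 0 (k + p) l)" for l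
    proof -
      have "of_nat (Suc j + Suc l) - of_nat (Suc j) = (of_nat (Suc l) :: complex)" by simp
      then show ?thesis unfolding o_def inv_lin_pow_nth_pos[OF p, symmetric]
        by (simp only: power_add inv_lin_pow_nth_pos[OF p]) simp
    qed
    ultimately show "(?f \<circ> (\<lambda>l. Suc j + Suc l) has_sum (?b * (-1) ^ k * y ^ Suc j * Li (k + p) y)) UNIV" by presburger
  qed (auto intro: injI)
  have "(?f has_sum (?b * (-1) ^ p * hsum 0 (k + p) y (Suc j) + 0 + ?b * (-1) ^ k * y ^ Suc j * Li (k + p) y))
    ({..<Suc j} \<union> {Suc j} \<union> range (\<lambda>l. Suc j + Suc l))"
    by (intro has_sum_Un_disjoint 1 2 3) auto
  moreover have "{..<Suc j} \<union> {Suc j} \<union> range (\<lambda>l. Suc j + Suc l) = UNIV"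
  proof -
    have "i \<in> {..<Suc j} \<union> {Suc j} \<union> range (\<lambda>l. Suc j + Suc l)" for i
    proof (cases i "Suc j" rule: linorder_cases)
      case greater
      then show ?thesis using less_imp_Suc_add[of "Suc j" i] by auto
    qed auto
    then show ?thesis by blast
  qed
  moreover have "?b * (-1) ^ p * hsum 0 (k + p) y (Suc j) + 0 + ?b * (-1) ^ k * y ^ Suc j * Li (k + p) y = ?S"
    by (simp add: algebra_simps)
  ultimately show ?thesis by simp
qed

lemma hsum_0_growth:
  assumes "norm y \<le> 1"
  shows "norm (hsum 0 P y n) \<le> real n"
proof (induction n)
  case (Suc n)
  have "norm (hsum 0 P y (Suc n)) \<le> norm (y * hsum 0 P y n) + norm (hw 0 P n)"
    unfolding hsum.simps by (rule norm_triangle_ineq)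
  also have "\<dots> \<le> 1 * norm (hsum 0 P y n) + 1"
    unfolding norm_mult using assms norm_hw_0 by (intro add_mono mult_right_mono) auto
  finally show ?case using Suc by simp
qed simp

text \<open>The coefficients are bounded by the product \<open>M\<close> of two binomials, so the
  family is absolutely summable and may be summed over \<open>i\<close> first, where
  \<open>off_inner_has_sum\<close> applies.\<close>

lemma off_term_has_sum:
  assumes p: "p \<ge> 1" "q \<ge> 1" and y: "norm y < 1" and v: "norm v < 1"
  shows "((\<lambda>(i, j). if j = 0 \<or> i = j then 0 else
      y ^ i * v ^ j * (fps_nth (inv_lin_pow p (of_nat i - of_nat j)) k * fps_nth (inv_lin_pow q (- of_nat j)) l))
    has_sum off_coeff p q y v k l) UNIV" (is "(?f has_sum _) UNIV")
proof -
  let ?b = "of_nat ((k + p - 1) choose (p - 1)) :: complex"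
  let ?b' = "of_nat ((l + q - 1) choose (q - 1)) :: complex"
  define M where "M = real ((k + p - 1) choose (p - 1)) * real ((l + q - 1) choose (q - 1))"
  define F where "F = (\<lambda>(j, i). ?f (i, j))"
  define g where "g = (\<lambda>j. if j = 0 then 0 else v ^ j * fps_nth (inv_lin_pow q (- of_nat j)) l *
    (?b * ((-1) ^ k * y ^ j * Li (k + p) y + (-1) ^ p * hsum 0 (k + p) y j)))"
  have geo: "(\<lambda>n. norm z ^ n) summable_on UNIV" if "norm z < 1" for z :: complex
    using that by (subst summable_on_UNIV_nonneg_real_iff) (auto intro: summable_geometric)
  have "F summable_on UNIV \<times> UNIV"
  proof (rule summable_on_pair_bound[OF summable_on_cmult_right[OF geo[OF v], of M] geo[OF y]])
    fix j i :: nat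
    show "norm (F (j, i)) \<le> M * norm v ^ j * norm y ^ i"
    proof (cases "j = 0 \<or> i = j")
      case True
      then show ?thesis unfolding F_def M_def by auto
    next
      case False
      have "1 \<le> norm (of_int (int i - int j) :: complex)"
        using False by (simp only: norm_of_int) linarith
      then have "1 \<le> norm (of_nat i - of_nat j :: complex)" by simp
      moreover have "1 \<le> norm (- of_nat j :: complex)" using False by simp
      ultimately have "norm (fps_nth (inv_lin_pow p (of_nat i - of_nat j)) k * fps_nth (inv_lin_pow q (- of_nat j)) l) \<le> M"
        unfolding M_def norm_mult by (intro mult_mono norm_inv_lin_pow_nth p) auto
      then have "norm y ^ i * norm v ^ j * norm (fps_nth (inv_lin_pow p (of_nat i - of_nat j)) k * fps_nth (inv_lin_pow q (- of_nat j)) l) \<le> norm y ^ i * norm v ^ j * M"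
        by (intro mult_left_mono) auto
      then show ?thesis using False unfolding F_def by (simp add: norm_mult norm_power mult_ac)
    qed
  qed (auto simp: M_def)
  moreover have "((\<lambda>i. F (j, i)) has_sum g j) UNIV" for j
  proof (cases j)
    case 0
    then show ?thesis by (simp add: F_def g_def)
  next
    case (Suc j')
    have "(\<lambda>i. F (j, i)) = (\<lambda>i. v ^ j * fps_nth (inv_lin_pow q (- of_nat j)) l *
        (if i = Suc j' then 0 else y ^ i * fps_nth (inv_lin_pow p (of_nat i - of_nat (Suc j'))) k))"
      unfolding F_def Suc by (rule ext) (simp del: of_nat_Suc)
    then show ?thesis
      using has_sum_cmult_right[OF off_inner_has_sum[OF p(1) y, of j' k], of "v ^ j * fps_nth (inv_lin_pow q (- of_nat j)) l"]
      unfolding g_def Suc by (simp del: of_nat_Suc power_Suc)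
  qed
  moreover have "(g has_sum off_coeff p q y v k l) UNIV"
  proof -
    have yv: "norm (y * v) < 1"
      using y v mult_strict_mono'[of "norm y" 1 "norm v" 1] by (simp add: norm_mult)
    have "((\<lambda>j. v ^ Suc j * hsum 0 (k + p) y (Suc j) * hw 0 (l + q) j) has_sum mixed_sum (k + p) (l + q) y v) UNIV"
      unfolding mixed_sum_def
    proof (rule norm_summable_imp_has_sum)
      show s: "summable (\<lambda>j. norm (v ^ Suc j * hsum 0 (k + p) y (Suc j) * hw 0 (l + q) j))"
      proof (rule summable_comparison_test)
        have "summable (\<lambda>n. real n * norm v ^ (n - 1))"
          using geometric_deriv_sums[of "norm v"] v summable_Suc_iff[of "\<lambda>i. real i * norm v ^ (i - 1)"]
          by (simp add: sums_iff)
        then have "summable (\<lambda>n. real (Suc n) * norm v ^ n)" by (subst (asm) summable_Suc_iff[symmetric]) simp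
        then show "summable (\<lambda>n. norm v * (real (Suc n) * norm v ^ n))" by (rule summable_mult)
        have "norm (v ^ Suc n * hsum 0 (k + p) y (Suc n) * hw 0 (l + q) n) \<le> norm v ^ Suc n * real (Suc n) * 1" for n
          unfolding norm_mult norm_power using y hsum_0_growth[of y "k + p" "Suc n"] norm_hw_0
          by (intro mult_mono) auto
        then show "\<exists>N. \<forall>n\<ge>N. norm (norm (v ^ Suc n * hsum 0 (k + p) y (Suc n) * hw 0 (l + q) n)) \<le> norm v * (real (Suc n) * norm v ^ n)"
          by (simp add: mult_ac)
      qed
      show "(\<lambda>j. v ^ Suc j * hsum 0 (k + p) y (Suc j) * hw 0 (l + q) j) sums (\<Sum>j. v ^ Suc j * hsum 0 (k + p) y (Suc j) * hw 0 (l + q) j)"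
        using s by (intro summable_sums) (rule summable_norm_cancel)
    qed
    from has_sum_add[OF has_sum_cmult_right[OF Li_has_sum[OF yv, of "l + q"], of "(-1) ^ q * ?b * ?b' * ((-1) ^ k * Li (k + p) y)"]
      has_sum_cmult_right[OF this, of "(-1) ^ q * ?b * ?b' * (-1) ^ p"]]
    have "((\<lambda>j. g (Suc j)) has_sum ((-1) ^ q * ?b * ?b' * ((-1) ^ k * Li (k + p) y) * Li (l + q) (y * v) + (-1) ^ q * ?b * ?b' * (-1) ^ p * mixed_sum (k + p) (l + q) y v)) UNIV"
      unfolding g_def inv_lin_pow_nth_neg[OF p(2)]
      by (simp add: power_mult_distrib algebra_simps del: of_nat_Suc power_Suc hsum.simps)
    from has_sum_Suc[OF this]
    show ?thesis unfolding off_coeff_def by (simp add: g_def algebra_simps)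
  qed
  ultimately have "(F has_sum off_coeff p q y v k l) (UNIV \<times> UNIV)"
    by (intro has_sum_SigmaI)
  then have "((\<lambda>(i, j). F (j, i)) has_sum off_coeff p q y v k l) (UNIV \<times> UNIV)"
    by (subst (asm) has_sum_swap)
  moreover have "(\<lambda>(i, j). F (j, i)) = ?f" by (rule ext) (auto simp: F_def)
  ultimately show ?thesis by simp
qed

text \<open>The factor \<open>x ^ j\<close> of the shifted bilateral sum joins
  \<open>y2 ^ j\<close>, whence the argument \<open>y2 * x\<close>; the inner sum over
  \<open>k\<close> is the coefficient of a product of two series.\<close>

lemma res_off_has_sum:
  assumes p: "p1 \<ge> 1" "p2 \<ge> 1" "q \<ge> 1" and y: "norm y1 < 1" "norm y2 < 1" and x: "norm x = 1"
  shows "((\<lambda>(i, j). y1 ^ i * y2 ^ j * res_off x a p1 p2 q i j) has_sum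
    (\<Sum>m<p2. (\<Sum>k\<le>p2 - 1 - m. off_coeff p1 q y1 (y2 * x) k (p2 - 1 - m - k)) * C_coeff x a m)) UNIV"
    (is "(?f has_sum ?S) UNIV")
proof -
  have yx: "norm (y2 * x) < 1" using y x by (simp add: norm_mult)
  define w where "w = (\<lambda>(i, j). if j = 0 \<or> i = j then 0 else y1 ^ i * (y2 * x) ^ j)"
  define H where "H = (\<lambda>(i, j). inv_lin_pow p1 (of_nat i - of_nat j) * inv_lin_pow q (- of_nat j))"
  have "((\<lambda>z. w z * fps_nth (H z) k) has_sum (\<Sum>l\<le>k. off_coeff p1 q y1 (y2 * x) l (k - l))) UNIV" for k
  proof -
    have "((\<lambda>z. \<Sum>l\<le>k. (case z of (i, j) \<Rightarrow> if j = 0 \<or> i = j then 0 else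
        y1 ^ i * (y2 * x) ^ j * (fps_nth (inv_lin_pow p1 (of_nat i - of_nat j)) l * fps_nth (inv_lin_pow q (- of_nat j)) (k - l))))
      has_sum (\<Sum>l\<le>k. off_coeff p1 q y1 (y2 * x) l (k - l))) UNIV"
      by (intro has_sum_sum off_term_has_sum p y yx) auto
    moreover have "(\<Sum>l\<le>k. (case z of (i, j) \<Rightarrow> if j = 0 \<or> i = j then 0 else
        y1 ^ i * (y2 * x) ^ j * (fps_nth (inv_lin_pow p1 (of_nat i - of_nat j)) l * fps_nth (inv_lin_pow q (- of_nat j)) (k - l))))
      = w z * fps_nth (H z) k" for z
      unfolding H_def w_def fps_mult_nth sum_distrib_left atLeast0AtMost
      by (auto simp: case_prod_unfold fps_mult_nth sum_distrib_left atLeast0AtMost)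
    ultimately show ?thesis by simp
  qed
  then have "((\<lambda>z. w z * princ_C x a p2 (H z)) has_sum ?S) UNIV" by (rule has_sum_princ_C)
  moreover have "(\<lambda>z. w z * princ_C x a p2 (H z)) = ?f"
    by (rule ext) (auto simp: w_def H_def res_off_def power_mult_distrib)
  ultimately show ?thesis by simp
qed

section \<open>The limit on the unit circle\<close>

definition away_from_one :: "'a set \<Rightarrow> ('a \<Rightarrow> complex) \<Rightarrow> bool" where
  "away_from_one A z \<longleftrightarrow> (\<exists>d>0. \<forall>r\<in>A. d \<le> norm (1 - z r))"

lemma away_from_one_gap:
  assumes "P \<Longrightarrow> away_from_one A z"
  obtains d where "d > 0" "\<And>r. P \<Longrightarrow> r \<in> A \<Longrightarrow> d \<le> norm (1 - z r)"
proof (cases P)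
  case True
  then show ?thesis using assms that unfolding away_from_one_def by blast
qed (use that[of 1] in auto)

text \<open>Unlike plain boundedness, this class controls the conditionally convergent case \<open>q = 1\<close>, and
  it is closed under products, so that it covers the products of zeta sums in the Euler sums.\<close>

definition almost_geom :: "'a set \<Rightarrow> ('a \<Rightarrow> complex) \<Rightarrow> (nat \<Rightarrow> 'a \<Rightarrow> complex) \<Rightarrow> bool" where
  "almost_geom A z G \<longleftrightarrow> (\<forall>r\<in>A. norm (z r) \<le> 1) \<and>
     (\<exists>B\<ge>0. \<forall>r\<in>A. \<forall>n. norm (G n r) \<le> B \<and> norm (G (Suc n) r - z r * G n r) \<le> B / real (Suc n))"

lemma almost_geomI:
  assumes "\<And>r. r \<in> A \<Longrightarrow> norm (z r) \<le> 1"
    and "\<And>r n. r \<in> A \<Longrightarrow> norm (G n r) \<le> B"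
    and "\<And>r n. r \<in> A \<Longrightarrow> norm (G (Suc n) r - z r * G n r) \<le> B / real (Suc n)"
    and "0 \<le> B"
  shows "almost_geom A z G"
  using assms unfolding almost_geom_def by blast

lemma almost_geom_cong:
  assumes "almost_geom A z F" "\<And>r n. r \<in> A \<Longrightarrow> F n r = G n r"
  shows "almost_geom A z G"
proof -
  obtain B where "0 \<le> B" "\<And>r n. r \<in> A \<Longrightarrow> norm (F n r) \<le> B"
    "\<And>r n. r \<in> A \<Longrightarrow> norm (F (Suc n) r - z r * F n r) \<le> B / real (Suc n)"
    "\<And>r. r \<in> A \<Longrightarrow> norm (z r) \<le> 1"
    using assms(1) unfolding almost_geom_def by blast
  then show ?thesis using assms(2) by (intro almost_geomI[where B = B]) simp_all
qed

text \<open>A discrete product rule: the recurrence error of the product is the error of one factor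
  times the bounded other one, twice.\<close>

lemma almost_geom_mult:
  assumes "almost_geom A y F" "almost_geom A z G"
  shows "almost_geom A (\<lambda>r. y r * z r) (\<lambda>n r. F n r * G n r)"
proof -
  obtain B where B: "0 \<le> B" "\<And>r n. r \<in> A \<Longrightarrow> norm (F n r) \<le> B"
    "\<And>r n. r \<in> A \<Longrightarrow> norm (F (Suc n) r - y r * F n r) \<le> B / real (Suc n)"
    using assms(1) unfolding almost_geom_def by blast
  obtain C where C: "0 \<le> C" "\<And>r n. r \<in> A \<Longrightarrow> norm (G n r) \<le> C"
    "\<And>r n. r \<in> A \<Longrightarrow> norm (G (Suc n) r - z r * G n r) \<le> C / real (Suc n)"
    using assms(2) unfolding almost_geom_def by blast
  have yz: "norm (y r) \<le> 1" "norm (z r) \<le> 1" if "r \<in> A" for r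
    using assms that unfolding almost_geom_def by auto
  show ?thesis
  proof (rule almost_geomI)
    fix r n assume r: "r \<in> A"
    show "norm (y r * z r) \<le> 1" unfolding norm_mult using yz[OF r] by (intro mult_le_one) auto
    have BC: "norm (F n r * G n r) \<le> B * C" for n
      unfolding norm_mult using B C r by (intro mult_mono) auto
    show "norm (F n r * G n r) \<le> 2 * (B * C)"
      using BC[of n] B C by (simp add: order.trans[OF BC])
    have "F (Suc n) r * G (Suc n) r - y r * z r * (F n r * G n r)
        = (F (Suc n) r - y r * F n r) * G (Suc n) r + (y r * F n r) * (G (Suc n) r - z r * G n r)"
      by (simp add: algebra_simps)
    also have "norm \<dots> \<le> norm ((F (Suc n) r - y r * F n r) * G (Suc n) r) + norm ((y r * F n r) * (G (Suc n) r - z r * G n r))"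
      by (rule norm_triangle_ineq)
    also have "\<dots> \<le> (B / real (Suc n)) * C + (1 * B) * (C / real (Suc n))"
      unfolding norm_mult using r B C yz by (intro add_mono mult_mono) auto
    also have "\<dots> = 2 * (B * C) / real (Suc n)" by (simp del: of_nat_Suc)
    finally show "norm (F (Suc n) r * G (Suc n) r - y r * z r * (F n r * G n r)) \<le> 2 * (B * C) / real (Suc n)" .
  qed (use B C in auto)
qed

lemma almost_geom_add:
  assumes "almost_geom A z F" "almost_geom A z G"
  shows "almost_geom A z (\<lambda>n r. F n r + G n r)"
proof -
  obtain B where B: "0 \<le> B" "\<And>r n. r \<in> A \<Longrightarrow> norm (F n r) \<le> B"
    "\<And>r n. r \<in> A \<Longrightarrow> norm (F (Suc n) r - z r * F n r) \<le> B / real (Suc n)"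
    using assms(1) unfolding almost_geom_def by blast
  obtain C where C: "0 \<le> C" "\<And>r n. r \<in> A \<Longrightarrow> norm (G n r) \<le> C"
    "\<And>r n. r \<in> A \<Longrightarrow> norm (G (Suc n) r - z r * G n r) \<le> C / real (Suc n)"
    using assms(2) unfolding almost_geom_def by blast
  show ?thesis
  proof (rule almost_geomI)
    fix r n assume r: "r \<in> A"
    show "norm (z r) \<le> 1" using assms r unfolding almost_geom_def by auto
    show "norm (F n r + G n r) \<le> B + C"
      using B(2)[OF r] C(2)[OF r] by (intro norm_triangle_le add_mono)
    have e: "F (Suc n) r + G (Suc n) r - z r * (F n r + G n r) = (F (Suc n) r - z r * F n r) + (G (Suc n) r - z r * G n r)"
      by (simp add: algebra_simps)
    show "norm (F (Suc n) r + G (Suc n) r - z r * (F n r + G n r)) \<le> (B + C) / real (Suc n)"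
      unfolding e add_divide_distrib using B(3)[OF r] C(3)[OF r] by (intro norm_triangle_le add_mono)
  qed (use B C in auto)
qed

lemma almost_geom_cmult:
  assumes "almost_geom A z G" and f: "\<And>r. r \<in> A \<Longrightarrow> norm (f r) \<le> M"
  shows "almost_geom A z (\<lambda>n r. f r * G n r)"
proof -
  obtain C where C: "0 \<le> C" "\<And>r n. r \<in> A \<Longrightarrow> norm (G n r) \<le> C"
    "\<And>r n. r \<in> A \<Longrightarrow> norm (G (Suc n) r - z r * G n r) \<le> C / real (Suc n)"
    using assms(1) unfolding almost_geom_def by blast
  have M: "norm (f r) \<le> \<bar>M\<bar>" if "r \<in> A" for r using f[OF that] by simp
  show ?thesis
  proof (rule almost_geomI)
    fix r n assume r: "r \<in> A"
    show "norm (z r) \<le> 1" using assms r unfolding almost_geom_def by auto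
    show "norm (f r * G n r) \<le> \<bar>M\<bar> * C"
      unfolding norm_mult using C(2)[OF r] M[OF r] C(1) by (intro mult_mono) auto
    have e: "f r * G (Suc n) r - z r * (f r * G n r) = f r * (G (Suc n) r - z r * G n r)"
      by (simp add: algebra_simps)
    have "norm (f r * (G (Suc n) r - z r * G n r)) \<le> \<bar>M\<bar> * (C / real (Suc n))"
      unfolding norm_mult using C(3)[OF r] M[OF r] C(1) by (intro mult_mono) auto
    then show "norm (f r * G (Suc n) r - z r * (f r * G n r)) \<le> \<bar>M\<bar> * C / real (Suc n)"
      unfolding e by simp
  qed (use C in auto)
qed

lemma almost_geom_power:
  assumes "\<And>r. r \<in> A \<Longrightarrow> norm (z r) \<le> 1"
  shows "almost_geom A z (\<lambda>n r. z r ^ n)" "almost_geom A z (\<lambda>n r. z r ^ Suc n)"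
proof -
  show "almost_geom A z (\<lambda>n r. z r ^ n)" "almost_geom A z (\<lambda>n r. z r ^ Suc n)"
    by (rule almost_geomI[where B = 1]; use assms in \<open>simp add: norm_power norm_mult power_le_one mult_le_one\<close>)+
qed

text \<open>The recurrence of \<open>hsum\<close> has ratio \<open>y\<close> exactly, up to the
  newly added weight, which is of order \<open>1 / n\<close>.\<close>

lemma almost_geom_hsum:
  assumes b: "\<And>n. of_nat (Suc n) + b \<noteq> 0" and p: "p \<ge> 1"
    and y: "\<And>r. r \<in> A \<Longrightarrow> norm (y r) \<le> 1" and away: "p = 1 \<Longrightarrow> away_from_one A y"
  shows "almost_geom A y (\<lambda>n r. hsum b p (y r) (Suc n))"
proof -
  obtain d where d: "d > 0" "\<And>r. p = 1 \<Longrightarrow> r \<in> A \<Longrightarrow> d \<le> norm (1 - y r)"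
    using away_from_one_gap[OF away] by blast
  obtain B where B: "0 \<le> B"
    "\<And>y n. norm y \<le> 1 \<Longrightarrow> (p = 1 \<Longrightarrow> d \<le> norm (1 - y)) \<Longrightarrow> norm (hsum b p y n) \<le> B"
    using hsum_bound[OF b p d(1)] by blast
  obtain K where K: "K > 0" "\<And>n. norm (hw b p n) \<le> K / real (Suc n)"
    "\<And>n. norm (hw b p n - hw b p (Suc n)) \<le> K / real (Suc n) ^ 2"
    "\<And>n. p \<noteq> 1 \<Longrightarrow> norm (hw b p n) \<le> K / real (Suc n) ^ 2"
    using hw_bounds[OF b p] by blast
  show ?thesis
  proof (rule almost_geomI)
    fix r n assume r: "r \<in> A"
    show "norm (y r) \<le> 1" by (rule y[OF r])
    have "norm (hsum b p (y r) (Suc n)) \<le> B" by (rule B(2)) (use y d r in auto)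
    then show "norm (hsum b p (y r) (Suc n)) \<le> B + K" using K by simp
    have "norm (hsum b p (y r) (Suc (Suc n)) - y r * hsum b p (y r) (Suc n)) = norm (hw b p (Suc n))"
      by simp
    also have "\<dots> \<le> K / real (Suc (Suc n))" by (rule K)
    also have "\<dots> \<le> (B + K) / real (Suc n)" using K(1) B(1) by (intro frac_le) auto
    finally show "norm (hsum b p (y r) (Suc (Suc n)) - y r * hsum b p (y r) (Suc n)) \<le> (B + K) / real (Suc n)" .
  qed (use B K in auto)
qed

text \<open>Decay of order \<open>1 / n\<close> is absorbed by the permitted error, so the ratio may
  be taken as 0, which has distance 1 from 1 whatever the other factors are.\<close>

lemma almost_geom_decay:
  assumes "\<And>r n. r \<in> A \<Longrightarrow> norm (G n r) \<le> C / real (Suc n)" "0 \<le> C"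
  shows "almost_geom A (\<lambda>_. 0) G"
proof (rule almost_geomI)
  fix r n assume r: "r \<in> A"
  have mono: "C / real (Suc n) \<le> C" for n
    using assms(2) by (simp add: divide_le_eq mult_le_cancel_left1)
  show "norm (G n r) \<le> C" using assms(1)[OF r] mono by (rule order.trans)
  have "norm (G (Suc n) r) \<le> C / real (Suc (Suc n))" using assms(1)[OF r] .
  also have "\<dots> \<le> C / real (Suc n)" using assms(2) by (intro divide_left_mono) auto
  finally show "norm (G (Suc n) r - 0 * G n r) \<le> C / real (Suc n)" by simp
qed (use assms in auto)

lemma almost_geom_series:
  fixes G :: "nat \<Rightarrow> 'a \<Rightarrow> complex"
  assumes b: "\<And>n. of_nat (Suc n) + b \<noteq> 0" and q: "q \<ge> 1"
    and G: "almost_geom A z G" and away: "q = 1 \<Longrightarrow> away_from_one A z"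
  obtains C where "\<And>m N r. r \<in> A \<Longrightarrow> norm (\<Sum>n\<in>{m..<N}. G n r * hw b q n) \<le> C / real (Suc m)"
proof -
  obtain d where d: "d > 0" "\<And>r. q = 1 \<Longrightarrow> r \<in> A \<Longrightarrow> d \<le> norm (1 - z r)"
    using away_from_one_gap[OF away] by blast
  obtain B where B: "0 \<le> B" "\<And>r n. r \<in> A \<Longrightarrow> norm (G n r) \<le> B"
    "\<And>r n. r \<in> A \<Longrightarrow> norm (G (Suc n) r - z r * G n r) \<le> B / real (Suc n)"
    using G unfolding almost_geom_def by blast
  show ?thesis
    by (rule hw_series_tail[where z = z and G = G and A = A, OF b q B(1) d B(2) B(3)]) (use that in blast)+
qed

lemma almost_geom_summable:
  assumes "\<And>n. of_nat (Suc n) + b \<noteq> 0" "q \<ge> 1"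
    "almost_geom A z G" "q = 1 \<Longrightarrow> away_from_one A z" "r \<in> A"
  shows "summable (\<lambda>n. G n r * hw b q n)"
proof -
  obtain C where "\<And>m N r. r \<in> A \<Longrightarrow> norm (\<Sum>n\<in>{m..<N}. G n r * hw b q n) \<le> C / real (Suc m)"
    using almost_geom_series[OF assms(1-4)] by blast
  then show ?thesis
    using uniform_tail_summable[where g = "\<lambda>n r. G n r * hw b q n" and r = r] assms(5) by blast
qed

lemma almost_geom_continuous:
  fixes G :: "nat \<Rightarrow> 'a::topological_space \<Rightarrow> complex"
  assumes "\<And>n. of_nat (Suc n) + b \<noteq> 0" "q \<ge> 1"
    "almost_geom A z G" "q = 1 \<Longrightarrow> away_from_one A z" "\<And>n. continuous_on A (G n)"
  shows "continuous_on A (\<lambda>r. \<Sum>n. G n r * hw b q n)"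
proof -
  obtain C where "\<And>m N r. r \<in> A \<Longrightarrow> norm (\<Sum>n\<in>{m..<N}. G n r * hw b q n) \<le> C / real (Suc m)"
    using almost_geom_series[OF assms(1-4)] by blast
  then show ?thesis
    by (intro uniform_tail_continuous[where C = C] continuous_intros assms(5)) auto
qed

section \<open>Continuity of both sides up to the unit circle\<close>

lemma continuous_lerch:
  fixes f :: "'a::topological_space \<Rightarrow> complex"
  assumes b: "\<And>n. of_nat (Suc n) + b \<noteq> 0" and p: "p \<ge> 1"
    and f: "continuous_on A f" "\<And>r. r \<in> A \<Longrightarrow> norm (f r) \<le> 1"
    and df: "p = 1 \<Longrightarrow> away_from_one A f"
  shows "continuous_on A (\<lambda>r. lerch b p (f r))"
  unfolding lerch_def
  by (rule almost_geom_continuous[OF b p almost_geom_power(1)]) (use f df in \<open>auto intro!: continuous_intros\<close>)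

lemma zero_shift: "of_nat (Suc n) + 0 \<noteq> (0::complex)"
  by (simp del: of_nat_Suc)

lemma away_from_one_neq:
  assumes "away_from_one A f" "r \<in> A"
  shows "f r \<noteq> 1"
  using assms unfolding away_from_one_def by force

lemma continuous_Li:
  fixes f :: "'a::topological_space \<Rightarrow> complex"
  assumes p: "p \<ge> 1" and f: "continuous_on A f" "\<And>r. r \<in> A \<Longrightarrow> norm (f r) \<le> 1"
    and df: "p = 1 \<Longrightarrow> away_from_one A f"
  shows "continuous_on A (\<lambda>r. Li p (f r))"
proof -
  have "continuous_on A (\<lambda>r. f r * lerch 0 p (f r))"
    by (intro continuous_intros f continuous_lerch zero_shift p df)
  moreover have "f r * lerch 0 p (f r) = Li p (f r)" if r: "r \<in> A" for r
  proof -
    have "f r = 1 \<longrightarrow> p \<noteq> 1" using away_from_one_neq[OF df r] by blast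
    then have "(\<Sum>n. f r * (f r ^ n * hw 0 p n)) = f r * lerch 0 p (f r)"
      unfolding lerch_def by (intro suminf_mult summable_lerch zero_shift p f r)
    moreover have "(\<Sum>n. f r * (f r ^ n * hw 0 p n)) = Li p (f r)"
      unfolding Li_def hw_0 by (simp only: power_Suc mult_1_right times_divide_eq_right mult.assoc)
    ultimately show ?thesis by simp
  qed
  ultimately show ?thesis by (simp cong: continuous_on_cong)
qed

lemma continuous_hsum:
  assumes "continuous_on A f"
  shows "continuous_on A (\<lambda>r. hsum b p (f r) n)"
  by (induction n) (auto intro!: continuous_intros assms)

text \<open>The ratio of the summand is \<open>v * y\<close>, so for \<open>Q = 1\<close> the gap is
  required of the product only; \<open>v\<close> itself may take the value 1.\<close>

lemma continuous_mixed_sum: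
  fixes y v :: "'a::topological_space \<Rightarrow> complex"
  assumes PQ: "P \<ge> 1" "Q \<ge> 1"
    and y: "continuous_on A y" "\<And>r. r \<in> A \<Longrightarrow> norm (y r) \<le> 1"
    and v: "continuous_on A v" "\<And>r. r \<in> A \<Longrightarrow> norm (v r) \<le> 1"
    and dy: "P = 1 \<Longrightarrow> away_from_one A y" and dv: "Q = 1 \<Longrightarrow> away_from_one A (\<lambda>r. y r * v r)"
  shows "continuous_on A (\<lambda>r. mixed_sum P Q (y r) (v r))"
  unfolding mixed_sum_def
proof (rule almost_geom_continuous[OF zero_shift PQ(2), where z = "\<lambda>r. v r * y r"])
  show "almost_geom A (\<lambda>r. v r * y r) (\<lambda>n r. v r ^ Suc n * hsum 0 P (y r) (Suc n))"
    by (intro almost_geom_mult almost_geom_power(2) almost_geom_hsum zero_shift PQ v y dy)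
  show "continuous_on A (\<lambda>r. v r ^ Suc n * hsum 0 P (y r) (Suc n))" for n
    by (intro continuous_intros v y continuous_hsum)
qed (use dv in \<open>simp add: mult.commute\<close>)

text \<open>In the lower half \<open>1 / (a - of_nat (Suc n)) ^ q\<close> is written as
  \<open>(-1) ^ q * hw (- a) q n\<close>, so that both halves have the form covered by
  \<open>almost_geom_continuous\<close>.\<close>

definition bilateral_sum :: "complex \<Rightarrow> complex \<Rightarrow> nat \<Rightarrow> nat \<Rightarrow> nat \<Rightarrow> complex \<Rightarrow> complex \<Rightarrow> complex" where
  "bilateral_sum x a p1 p2 q y1 y2 =
    (\<Sum>n. inverse x ^ n * lerch (a - 1 + of_nat n) p1 y1 * lerch (a - 1 + of_nat n) p2 y2 * hw (a - 1) q n)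
    + (-1) ^ q * (\<Sum>n. x ^ Suc n * lerch (a - 1 - of_nat (Suc n)) p1 y1 * lerch (a - 1 - of_nat (Suc n)) p2 y2 * hw (- a) q n)"

text \<open>The bracket belongs to the pole at the origin, the remaining sums to the poles at
  \<open>- j\<close>, at \<open>- i\<close> and at \<open>- i = - j\<close>, each already summed
  over all pairs with weights \<open>y1 ^ i * y2 ^ j\<close>.\<close>

definition residue_total :: "complex \<Rightarrow> complex \<Rightarrow> nat \<Rightarrow> nat \<Rightarrow> nat \<Rightarrow> complex \<Rightarrow> complex \<Rightarrow> complex" where
  "residue_total x a p1 p2 q y1 y2 =
    (C_coeff x a (p1 + p2 + q - 1)
     + (\<Sum>m<p1 + q. Li_coeff p2 y2 (p1 + q - 1 - m) * C_coeff x a m)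
     + (\<Sum>m<p2 + q. Li_coeff p1 y1 (p2 + q - 1 - m) * C_coeff x a m)
     + (\<Sum>m<q. (\<Sum>k\<le>q - 1 - m. Li_coeff p1 y1 k * Li_coeff p2 y2 (q - 1 - m - k)) * C_coeff x a m))
    + (\<Sum>m<p2. (\<Sum>k\<le>p2 - 1 - m. off_coeff p1 q y1 (y2 * x) k (p2 - 1 - m - k)) * C_coeff x a m)
    + (\<Sum>m<p1. (\<Sum>k\<le>p1 - 1 - m. off_coeff p2 q y2 (y1 * x) k (p1 - 1 - m - k)) * C_coeff x a m)
    + (\<Sum>m<p1 + p2. (-1) ^ q * of_nat ((p1 + p2 - 1 - m + q - 1) choose (q - 1))
        * Li (p1 + p2 - 1 - m + q) (y1 * y2 * x) * C_coeff x a m)"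

text \<open>One family over the pairs \<open>(i, j)\<close> has two evaluations: the bilateral sum
  by interchange of summation, and the pole contributions summed separately. Uniqueness of sums
  equates them.\<close>

lemma regularised_identity:
  assumes x: "norm x = 1" "x \<noteq> 1" and a: "a \<notin> \<int>" and p: "p1 \<ge> 1" "p2 \<ge> 1" "q \<ge> 1"
    and y: "norm y1 < 1" "norm y2 < 1"
  shows "bilateral_sum x a p1 p2 q y1 y2 = - residue_total x a p1 p2 q y1 y2"
proof -
  obtain S1 S2 where
    S1: "(\<lambda>n. inverse x ^ n * (lerch (a + of_nat n - 1) p1 y1 * lerch (a + of_nat n - 1) p2 y2 / (a + of_nat n) ^ q)) sums S1"
    and S2: "(\<lambda>n. x ^ Suc n * (lerch (a - of_nat (Suc n) - 1) p1 y1 * lerch (a - of_nat (Suc n) - 1) p2 y2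
        / (a - of_nat (Suc n)) ^ q)) sums S2"
    and S: "((\<lambda>(i, j). y1 ^ i * y2 ^ j * - (res_origin x a p1 p2 q i j + res_off x a p1 p2 q i j
        + res_off x a p2 p1 q j i + res_diag x a p1 p2 q i j)) has_sum (S1 + S2)) UNIV"
    using regularised_bisum[OF x a p y] by blast
  have sw: "((\<lambda>(i, j). y1 ^ i * y2 ^ j * res_off x a p2 p1 q j i) has_sum
    (\<Sum>m<p1. (\<Sum>k\<le>p1 - 1 - m. off_coeff p2 q y2 (y1 * x) k (p1 - 1 - m - k)) * C_coeff x a m)) UNIV"
  proof -
    have "((\<lambda>(i, j). y2 ^ i * y1 ^ j * res_off x a p2 p1 q i j) has_sum
      (\<Sum>m<p1. (\<Sum>k\<le>p1 - 1 - m. off_coeff p2 q y2 (y1 * x) k (p1 - 1 - m - k)) * C_coeff x a m)) (UNIV \<times> UNIV)"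
      using res_off_has_sum[OF p(2,1,3) y(2,1) x(1)] by simp
    then show ?thesis by (subst (asm) has_sum_swap) (simp add: case_prod_unfold mult.commute)
  qed
  have "((\<lambda>(i, j). y1 ^ i * y2 ^ j * (res_origin x a p1 p2 q i j + res_off x a p1 p2 q i j
        + res_off x a p2 p1 q j i + res_diag x a p1 p2 q i j)) has_sum residue_total x a p1 p2 q y1 y2) UNIV"
    using has_sum_add[OF has_sum_add[OF has_sum_add[OF res_origin_has_sum[where x = x and a = a, OF p y]
      res_off_has_sum[where x = x and a = a, OF p y x(1)]] sw] res_diag_has_sum[where x = x and a = a, OF p y x(1)]]
    unfolding residue_total_def by (simp add: case_prod_unfold distrib_left)
  from has_sum_cmult_right[OF this, of "-1"]
  have "((\<lambda>(i, j). y1 ^ i * y2 ^ j * - (res_origin x a p1 p2 q i j + res_off x a p1 p2 q i j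
        + res_off x a p2 p1 q j i + res_diag x a p1 p2 q i j)) has_sum - residue_total x a p1 p2 q y1 y2) UNIV"
    by (simp only: case_prod_unfold mult_minus_right mult_minus_left mult_1_left)
  from has_sum_unique[OF S this] have eq: "S1 + S2 = - residue_total x a p1 p2 q y1 y2" .
  have h1: "hw (a - 1) q n = 1 / (a + of_nat n) ^ q" for n
    unfolding hw_def by (simp add: add.commute)
  have h2: "(-1) ^ q * hw (- a) q n = 1 / (a - of_nat (Suc n)) ^ q" for n
  proof -
    have e: "a - of_nat (Suc n) = - (of_nat (Suc n) + - a)" by simp
    show ?thesis unfolding hw_def e power_minus[of "of_nat (Suc n) + - a"] by (cases "even q"; simp)
  qed
  have "(\<lambda>n. inverse x ^ n * lerch (a - 1 + of_nat n) p1 y1 * lerch (a - 1 + of_nat n) p2 y2 * hw (a - 1) q n) sums S1"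
    using S1 unfolding h1 by (simp add: algebra_simps)
  moreover have "(\<lambda>n. (-1) ^ q * (x ^ Suc n * lerch (a - 1 - of_nat (Suc n)) p1 y1 * lerch (a - 1 - of_nat (Suc n)) p2 y2 * hw (- a) q n)) sums S2"
  proof -
    have "(-1) ^ q * (x ^ Suc n * lerch (a - 1 - of_nat (Suc n)) p1 y1 * lerch (a - 1 - of_nat (Suc n)) p2 y2 * hw (- a) q n)
      = x ^ Suc n * (lerch (a - of_nat (Suc n) - 1) p1 y1 * lerch (a - of_nat (Suc n) - 1) p2 y2 / (a - of_nat (Suc n)) ^ q)" for n
    proof -
      have e: "a - of_nat (Suc n) - 1 = a - 1 - of_nat (Suc n)" by simp
      have "(-1) ^ q * (x ^ Suc n * lerch (a - 1 - of_nat (Suc n)) p1 y1 * lerch (a - 1 - of_nat (Suc n)) p2 y2 * hw (- a) q n)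
        = x ^ Suc n * (lerch (a - 1 - of_nat (Suc n)) p1 y1 * lerch (a - 1 - of_nat (Suc n)) p2 y2 * ((-1) ^ q * hw (- a) q n))"
        by (simp only: mult_ac)
      then show ?thesis unfolding h2 e by simp
    qed
    then show ?thesis using S2 by presburger
  qed
  then have "(\<lambda>n. x ^ Suc n * lerch (a - 1 - of_nat (Suc n)) p1 y1 * lerch (a - 1 - of_nat (Suc n)) p2 y2 * hw (- a) q n) sums ((-1) ^ q * S2)"
    using sums_mult[of _ S2 "(-1) ^ q"] by (fastforce simp: mult.assoc[symmetric] power_mult_distrib[symmetric])
  ultimately show ?thesis unfolding bilateral_sum_def using eq
    by (simp add: sums_iff mult.assoc[symmetric] power_mult_distrib[symmetric])
qed

text \<open>All exponents have the form \<open>k + p1\<close>, \<open>k + p2\<close> or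
  \<open>l + q\<close>, so they equal 1 only if \<open>p1\<close>, \<open>p2\<close> or
  \<open>q\<close> does, and the arguments paired with \<open>q\<close> are always
  \<open>y1 * y2 * x\<close>. Hence three gap conditions cover every term.\<close>

lemma continuous_residue_total:
  fixes y1 y2 :: "'a::topological_space \<Rightarrow> complex"
  assumes x: "norm x = 1" and p: "p1 \<ge> 1" "p2 \<ge> 1" "q \<ge> 1"
    and y1: "continuous_on A y1" "\<And>r. r \<in> A \<Longrightarrow> norm (y1 r) \<le> 1"
    and y2: "continuous_on A y2" "\<And>r. r \<in> A \<Longrightarrow> norm (y2 r) \<le> 1"
    and away: "p1 = 1 \<Longrightarrow> away_from_one A y1" "p2 = 1 \<Longrightarrow> away_from_one A y2"
      "q = 1 \<Longrightarrow> away_from_one A (\<lambda>r. y1 r * y2 r * x)"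
  shows "continuous_on A (\<lambda>r. residue_total x a p1 p2 q (y1 r) (y2 r))"
proof -
  have L: "continuous_on A (\<lambda>r. Li (k + p) (f r))"
    if "p \<ge> 1" "continuous_on A f" "\<And>r. r \<in> A \<Longrightarrow> norm (f r) \<le> 1" "p = 1 \<Longrightarrow> away_from_one A f" for k p f
    by (rule continuous_Li) (use that in auto)
  have yx: "continuous_on A (\<lambda>r. y1 r * x)" "continuous_on A (\<lambda>r. y2 r * x)" "continuous_on A (\<lambda>r. y1 r * y2 r * x)"
    by (intro continuous_intros y1 y2)+
  have nyx: "norm (y1 r * x) \<le> 1" "norm (y2 r * x) \<le> 1" "norm (y1 r * y2 r * x) \<le> 1" if "r \<in> A" for r
    using y1(2)[OF that] y2(2)[OF that] x by (auto simp: norm_mult mult_le_one)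
  have O: "continuous_on A (\<lambda>r. off_coeff p q (y r) (v r) k l)"
    if "p \<ge> 1" "continuous_on A y" "\<And>r. r \<in> A \<Longrightarrow> norm (y r) \<le> 1" "p = 1 \<Longrightarrow> away_from_one A y"
      "continuous_on A v" "\<And>r. r \<in> A \<Longrightarrow> norm (v r) \<le> 1" "\<And>r. y r * v r = y1 r * y2 r * x" for p y v k l
  proof -
    have "continuous_on A (\<lambda>r. mixed_sum (k + p) (l + q) (y r) (v r))"
      by (rule continuous_mixed_sum) (use that away(3) p in auto)
    moreover have "continuous_on A (\<lambda>r. Li (l + q) (y r * v r))"
      unfolding that(7) using yx nyx p away by (intro L) auto
    ultimately show ?thesis unfolding off_coeff_def
      using L[OF that(1-4)] by (intro continuous_intros) auto
  qed
  have o1: "continuous_on A (\<lambda>r. off_coeff p1 q (y1 r) (y2 r * x) k l)" for k l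
    by (rule O) (use p y1 away yx nyx in auto)
  have o2: "continuous_on A (\<lambda>r. off_coeff p2 q (y2 r) (y1 r * x) k l)" for k l
    by (rule O) (use p y2 away yx nyx in auto)
  show ?thesis
    unfolding residue_total_def Li_coeff_def
    by (intro continuous_intros o1 o2 L p y1 y2 away yx nyx)
qed

lemma nonint_neg_shift:
  assumes "a \<notin> \<int>"
  shows "of_nat (Suc n) + (a - 1 - of_nat m) \<noteq> (0::complex)"
proof
  assume "of_nat (Suc n) + (a - 1 - of_nat m) = 0"
  then have "a = of_int (int m - int n)" by (simp add: algebra_simps)
  then show False using assms by simp
qed

text \<open>Along negative shifts there is no decay in general: by \<open>lerch_backward\<close> the
  function is an \<open>hsum\<close> plus a bounded multiple of \<open>y ^ Suc n\<close>, both of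
  ratio \<open>y\<close>.\<close>

lemma almost_geom_lerch_backward:
  assumes a: "a \<notin> \<int>" and p: "p \<ge> 1"
    and y: "\<And>r. r \<in> A \<Longrightarrow> norm (y r) \<le> 1" and away: "p = 1 \<Longrightarrow> away_from_one A y"
  shows "almost_geom A y (\<lambda>n r. lerch (a - 1 - of_nat (Suc n)) p (y r))"
proof -
  obtain d where d: "d > 0" "\<And>r. p = 1 \<Longrightarrow> r \<in> A \<Longrightarrow> d \<le> norm (1 - y r)"
    using away_from_one_gap[OF away] by blast
  obtain C where C: "0 \<le> C" "\<And>y n. norm y \<le> 1 \<Longrightarrow> (p = 1 \<Longrightarrow> d \<le> norm (1 - y)) \<Longrightarrow>
    norm (lerch (a - 1 + of_nat n) p y) \<le> C / real (Suc n)"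
    using lerch_bound[OF nonint_shift(1)[OF a] p d(1)] by blast
  have l: "norm (lerch (a - 1) p (y r)) \<le> C" if "r \<in> A" for r
    using C(2)[of "y r" 0] y[OF that] d(2)[of r] that by simp
  have "almost_geom A y (\<lambda>n r. (-1) ^ p * hsum (- a) p (y r) (Suc n) + lerch (a - 1) p (y r) * y r ^ Suc n)"
    by (intro almost_geom_add almost_geom_cmult[where M = 1] almost_geom_cmult[where M = C]
        almost_geom_hsum almost_geom_power nonint_shift a p y away l) (auto simp: norm_power)
  moreover have "(-1) ^ p * hsum (- a) p (y r) (Suc n) + lerch (a - 1) p (y r) * y r ^ Suc n
      = lerch (a - 1 - of_nat (Suc n)) p (y r)" if "r \<in> A" for r n
  proof -
    have "y r = 1 \<longrightarrow> p \<noteq> 1" using away_from_one_neq[OF away that] by blast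
    then show ?thesis using lerch_backward[OF a p y[OF that], of "Suc n"] by (simp only: mult.commute[of "lerch _ _ _"])
  qed
  ultimately show ?thesis by (rule almost_geom_cong)
qed

lemma almost_geom_lerch_forward:
  assumes a: "a \<notin> \<int>" and p: "p \<ge> 1"
    and y: "\<And>r. r \<in> A \<Longrightarrow> norm (y r) \<le> 1" and away: "p = 1 \<Longrightarrow> away_from_one A y"
  shows "almost_geom A (\<lambda>_. 0) (\<lambda>n r. lerch (a - 1 + of_nat n) p (y r))"
proof -
  obtain d where d: "d > 0" "\<And>r. p = 1 \<Longrightarrow> r \<in> A \<Longrightarrow> d \<le> norm (1 - y r)"
    using away_from_one_gap[OF away] by blast
  obtain C where C: "0 \<le> C" "\<And>y n. norm y \<le> 1 \<Longrightarrow> (p = 1 \<Longrightarrow> d \<le> norm (1 - y)) \<Longrightarrow>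
    norm (lerch (a - 1 + of_nat n) p y) \<le> C / real (Suc n)"
    using lerch_bound[OF nonint_shift(1)[OF a] p d(1)] by blast
  show ?thesis
    by (rule almost_geom_decay[OF C(2) C(1)]) (use y d in auto)
qed

text \<open>The upper half has ratio 0 thanks to the decay of its Lerch factors. The lower half has
  ratio \<open>x * y1 * y2\<close>, and this is where the condition for \<open>q = 1\<close>
  acts.\<close>

lemma continuous_bilateral_sum:
  fixes y1 y2 :: "'a::topological_space \<Rightarrow> complex"
  assumes x: "norm x = 1" and a: "a \<notin> \<int>" and p: "p1 \<ge> 1" "p2 \<ge> 1" "q \<ge> 1"
    and y1: "continuous_on A y1" "\<And>r. r \<in> A \<Longrightarrow> norm (y1 r) \<le> 1"
    and y2: "continuous_on A y2" "\<And>r. r \<in> A \<Longrightarrow> norm (y2 r) \<le> 1"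
    and away: "p1 = 1 \<Longrightarrow> away_from_one A y1" "p2 = 1 \<Longrightarrow> away_from_one A y2"
      "q = 1 \<Longrightarrow> away_from_one A (\<lambda>r. y1 r * y2 r * x)"
  shows "continuous_on A (\<lambda>r. bilateral_sum x a p1 p2 q (y1 r) (y2 r))"
proof -
  have nf: "of_nat (Suc k) + (a - 1 + of_nat n) \<noteq> 0" for n k
    using nonint_shift(1)[OF a, of "k + n"] by (simp add: add_ac)
  have "continuous_on A (\<lambda>r. \<Sum>n. inverse x ^ n * lerch (a - 1 + of_nat n) p1 (y1 r) * lerch (a - 1 + of_nat n) p2 (y2 r) * hw (a - 1) q n)"
  proof (rule almost_geom_continuous[OF nonint_shift(1)[OF a] p(3)])
    show "almost_geom A (\<lambda>r. inverse x * 0 * 0) (\<lambda>n r. inverse x ^ n * lerch (a - 1 + of_nat n) p1 (y1 r) * lerch (a - 1 + of_nat n) p2 (y2 r))"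
      by (intro almost_geom_mult almost_geom_power(1) almost_geom_lerch_forward a p y1 y2 away)
        (use x in \<open>simp add: norm_inverse\<close>)
    show "away_from_one A (\<lambda>r. inverse x * 0 * 0)" unfolding away_from_one_def by (intro exI[of _ 1]) auto
    show "continuous_on A (\<lambda>r. inverse x ^ n * lerch (a - 1 + of_nat n) p1 (y1 r) * lerch (a - 1 + of_nat n) p2 (y2 r))" for n
      by (intro continuous_intros continuous_lerch nf p y1 y2 away)
  qed
  moreover have "continuous_on A (\<lambda>r. \<Sum>n. x ^ Suc n * lerch (a - 1 - of_nat (Suc n)) p1 (y1 r) * lerch (a - 1 - of_nat (Suc n)) p2 (y2 r) * hw (- a) q n)"
  proof (rule almost_geom_continuous[OF nonint_shift(2)[OF a] p(3)])
    show "almost_geom A (\<lambda>r. x * y1 r * y2 r) (\<lambda>n r. x ^ Suc n * lerch (a - 1 - of_nat (Suc n)) p1 (y1 r) * lerch (a - 1 - of_nat (Suc n)) p2 (y2 r))"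
      by (intro almost_geom_mult almost_geom_power(2) almost_geom_lerch_backward a p y1 y2 away)
        (use x in simp)
    show "away_from_one A (\<lambda>r. x * y1 r * y2 r)" if "q = 1" using away(3)[OF that] by (simp add: mult_ac)
    show "continuous_on A (\<lambda>r. x ^ Suc n * lerch (a - 1 - of_nat (Suc n)) p1 (y1 r) * lerch (a - 1 - of_nat (Suc n)) p2 (y2 r))" for n
      by (intro continuous_intros continuous_lerch nonint_neg_shift a p y1 y2 away)
  qed
  ultimately show ?thesis unfolding bilateral_sum_def by (intro continuous_intros)
qed

text \<open>The parameter runs over the closed interval: it is compact, so \<open>unit_gap\<close>
  yields the gaps, and it contains the end point, so continuity gives the value at
  \<open>r = 1\<close>.\<close>

lemma bilateral_sum_eq_residue_total:
  assumes x: "norm x = 1" "x \<noteq> 1" and a: "a \<notin> \<int>" and p: "p1 \<ge> 1" "p2 \<ge> 1" "q \<ge> 1"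
    and n: "norm x1 = 1" "norm x2 = 1"
    and ne: "p1 = 1 \<Longrightarrow> x1 \<noteq> 1" "p2 = 1 \<Longrightarrow> x2 \<noteq> 1" "q = 1 \<Longrightarrow> x1 * x2 * x \<noteq> 1"
  shows "bilateral_sum x a p1 p2 q x1 x2 = - residue_total x a p1 p2 q x1 x2"
proof -
  let ?A = "{0..1::real}"
  let ?D = "\<lambda>r. bilateral_sum x a p1 p2 q (of_real r * x1) (of_real r * x2) + residue_total x a p1 p2 q (of_real r * x1) (of_real r * x2)"
  have gap: "away_from_one ?A (\<lambda>r. of_real r * u)" if "norm u = 1" "u \<noteq> 1" for u
    using unit_gap[of u] that unfolding away_from_one_def by (metis order.refl)
  \<comment> \<open>Both arguments carry a factor \<open>r\<close>, so the gap for the product is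
    \<open>unit_gap\<close> at the parameter \<open>r * r\<close>.\<close>
  have gap2: "away_from_one ?A (\<lambda>r. of_real r * x1 * (of_real r * x2) * x)" if "q = 1"
  proof -
    have "x1 * x2 * x \<noteq> 1" by (rule ne(3)[OF that])
    then obtain d where d: "0 < d" "\<And>r. r \<in> {0..1::real} \<Longrightarrow> d \<le> norm (1 - of_real r * (x1 * x2 * x))"
      using unit_gap[of "x1 * x2 * x"] n x by (auto simp: norm_mult)
    have "d \<le> norm (1 - of_real r * x1 * (of_real r * x2) * x)" if "r \<in> ?A" for r
      using d(2)[of "r * r"] that by (simp add: mult_le_one mult_ac)
    then show ?thesis unfolding away_from_one_def using d(1) by blast
  qed
  have c1: "continuous_on ?A (\<lambda>r. of_real r * u)" for u :: complex by (intro continuous_intros)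
  have n1: "norm (of_real r * u) \<le> 1" if "r \<in> ?A" "norm u = 1" for r and u :: complex
    using that by (simp add: norm_mult)
  have cont: "continuous_on ?A ?D"
    by (intro continuous_on_add continuous_bilateral_sum continuous_residue_total x a p c1 n1 n gap gap2 ne)
  define s where "s = (\<lambda>n. 1 - 1 / real (Suc n))"
  have s: "s n \<in> ?A" "s n < 1" "0 \<le> s n" for n unfolding s_def by auto
  have "s \<longlonglongrightarrow> 1 - 0" unfolding s_def
    by (intro tendsto_diff tendsto_const) (use LIMSEQ_Suc[OF lim_const_over_n[of 1]] in simp)
  then have "(\<lambda>n. ?D (s n)) \<longlonglongrightarrow> ?D 1"
    using s by (intro continuous_on_tendsto_compose[OF cont]) auto
  moreover have "?D (s n) = 0" for n
    using s[of n] n by (subst regularised_identity[OF x a p]) (auto simp: norm_mult)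
  ultimately have "?D 1 = 0" by (simp add: LIMSEQ_const_iff)
  then show ?thesis by (simp add: eq_neg_iff_add_eq_0)
qed

section \<open>Evaluation at roots of unity\<close>

lemma away_from_one_const:
  assumes "u \<noteq> 1"
  shows "away_from_one A (\<lambda>_. u)"
  using assms unfolding away_from_one_def by (intro exI[of _ "norm (1 - u)"]) auto

text \<open>At modulus one the renormalising power has ratio \<open>u\<close> and
  \<open>hsum\<close> at \<open>1 / u\<close> has ratio \<open>inverse u\<close>, so the partial
  zeta sum has ratio 1. Products with \<open>v ^ n\<close> thus have ratio \<open>v\<close>, and for
  \<open>q = 1\<close> the Euler sums need only \<open>v \<noteq> 1\<close>.\<close>

lemma zeta_hurwitz_almost_geom:
  assumes b: "\<And>n. of_nat (Suc n) + b \<noteq> 0" and p: "p \<ge> 1" and u: "norm u = 1" "p = 1 \<Longrightarrow> u \<noteq> 1"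
  shows "almost_geom A (\<lambda>_. 1) (\<lambda>n _. zeta_hurwitz (Suc n) p u b)"
proof -
  have u0: "u \<noteq> 0" using u by auto
  have "almost_geom A (\<lambda>_. u * inverse u) (\<lambda>n _. u ^ Suc n * hsum b p (inverse u) (Suc n))"
  proof (intro almost_geom_mult almost_geom_power(2) almost_geom_hsum b p)
    show "away_from_one A (\<lambda>_. inverse u)" if "p = 1"
      using u(2)[OF that] by (intro away_from_one_const) (simp add: inverse_eq_1_iff)
  qed (use u in \<open>auto simp: norm_inverse\<close>)
  moreover have "u * inverse u = 1" using u0 by simp
  ultimately show ?thesis unfolding zeta_hurwitz_eq_hsum[OF u0] by (simp only:)
qed

lemma S_hurwitz_1_sums:
  assumes b: "\<And>n. of_nat (Suc n) + b \<noteq> 0" and p: "p \<ge> 1" "q \<ge> 1"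
    and u: "norm u = 1" "p = 1 \<Longrightarrow> u \<noteq> 1" and v: "norm v = 1" "q = 1 \<Longrightarrow> v \<noteq> 1"
  shows "(\<lambda>n. zeta_hurwitz (Suc n) p u b * v ^ Suc n * hw b q n) sums S_hurwitz b [(p, u)] q v"
proof -
  have "summable (\<lambda>n. zeta_hurwitz (Suc n) p u b * v ^ Suc n * hw b q n)"
  proof (rule almost_geom_summable[where z = "\<lambda>_. 1 * v" and A = UNIV and r = "()"
        and G = "\<lambda>n _. zeta_hurwitz (Suc n) p u b * v ^ Suc n", OF b p(2)])
    show "almost_geom UNIV (\<lambda>_. 1 * v) (\<lambda>n _. zeta_hurwitz (Suc n) p u b * v ^ Suc n)"
      by (intro almost_geom_mult zeta_hurwitz_almost_geom almost_geom_power(2) b p u) (use v in auto)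
    show "away_from_one UNIV (\<lambda>_. 1 * v)" if "q = 1"
      using v(2)[OF that] by (intro away_from_one_const) simp
  qed auto
  moreover have "S_hurwitz b [(p, u)] q v = (\<Sum>n. zeta_hurwitz (Suc n) p u b * v ^ Suc n * hw b q n)"
    unfolding S_hurwitz_def hw_def by simp
  ultimately show ?thesis by (simp only: summable_sums)
qed

lemma S_hurwitz_2_sums:
  assumes b: "\<And>n. of_nat (Suc n) + b \<noteq> 0" and p: "p1 \<ge> 1" "p2 \<ge> 1" "q \<ge> 1"
    and u: "norm u1 = 1" "p1 = 1 \<Longrightarrow> u1 \<noteq> 1" "norm u2 = 1" "p2 = 1 \<Longrightarrow> u2 \<noteq> 1"
    and v: "norm v = 1" "q = 1 \<Longrightarrow> v \<noteq> 1"
  shows "(\<lambda>n. zeta_hurwitz (Suc n) p1 u1 b * zeta_hurwitz (Suc n) p2 u2 b * v ^ Suc n * hw b q n)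
    sums S_hurwitz b [(p1, u1), (p2, u2)] q v"
proof -
  have "summable (\<lambda>n. zeta_hurwitz (Suc n) p1 u1 b * zeta_hurwitz (Suc n) p2 u2 b * v ^ Suc n * hw b q n)"
  proof (rule almost_geom_summable[where z = "\<lambda>_. 1 * 1 * v" and A = UNIV and r = "()"
        and G = "\<lambda>n _. zeta_hurwitz (Suc n) p1 u1 b * zeta_hurwitz (Suc n) p2 u2 b * v ^ Suc n", OF b p(3)])
    show "almost_geom UNIV (\<lambda>_. 1 * 1 * v) (\<lambda>n _. zeta_hurwitz (Suc n) p1 u1 b * zeta_hurwitz (Suc n) p2 u2 b * v ^ Suc n)"
      by (intro almost_geom_mult zeta_hurwitz_almost_geom almost_geom_power(2) b p u) (use v in auto)
    show "away_from_one UNIV (\<lambda>_. 1 * 1 * v)" if "q = 1"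
      using v(2)[OF that] by (intro away_from_one_const) simp
  qed auto
  moreover have "S_hurwitz b [(p1, u1), (p2, u2)] q v
      = (\<Sum>n. zeta_hurwitz (Suc n) p1 u1 b * zeta_hurwitz (Suc n) p2 u2 b * v ^ Suc n * hw b q n)"
    unfolding S_hurwitz_def hw_def by simp
  ultimately show ?thesis by (simp only: summable_sums)
qed

lemma Li_hurwitz_sums:
  assumes b: "\<And>n. of_nat (Suc n) + b \<noteq> 0" and q: "q \<ge> 1" and v: "norm v = 1" "q = 1 \<Longrightarrow> v \<noteq> 1"
  shows "(\<lambda>n. v ^ Suc n * hw b q n) sums Li_hurwitz q v (b + 1)"
proof -
  have "(\<lambda>n. v * (v ^ n * hw b q n)) sums (v * lerch b q v)"
    unfolding lerch_def by (intro sums_mult summable_sums summable_lerch b q) (use v in auto)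
  moreover have "Li_hurwitz q v (b + 1) = v * lerch b q v"
  proof -
    have "v = 1 \<longrightarrow> q \<noteq> 1" using v(2) by blast
    then show ?thesis using Li_hurwitz_lerch[of "b + 1" q v] b q v(1) by simp
  qed
  ultimately show ?thesis by (simp add: mult.assoc)
qed

text \<open>\<open>L1\<close> and \<open>L2\<close> are the values \<open>lerch (a - 1)\<close> at
  \<open>x1\<close> and \<open>x2\<close>. By \<open>lerch_backward\<close> each Lerch factor is a
  power times a signed zeta sum plus such a constant, and the product of two binomials gives the
  four sums.\<close>

lemma bilateral_negative_part:
  assumes a: "a \<notin> \<int>" and x: "norm x = 1" and p: "p1 \<ge> 1" "p2 \<ge> 1" "q \<ge> 1"
    and n: "norm x1 = 1" "norm x2 = 1"
    and ne: "p1 = 1 \<longrightarrow> x1 \<noteq> 1" "p2 = 1 \<longrightarrow> x2 \<noteq> 1" "q = 1 \<longrightarrow> x * x1 * x2 \<noteq> 1"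
  assumes L1_def: "L1 = inverse x1 * Li_hurwitz p1 x1 a" and L2_def: "L2 = inverse x2 * Li_hurwitz p2 x2 a"
  shows "(\<Sum>n. x ^ Suc n * lerch (a - 1 - of_nat (Suc n)) p1 x1 * lerch (a - 1 - of_nat (Suc n)) p2 x2 * hw (- a) q n)
    = (-1) ^ p1 * (-1) ^ p2 * S_hurwitz (- a) [(p1, inverse x1), (p2, inverse x2)] q (x * x1 * x2)
      + (-1) ^ p1 * L2 * S_hurwitz (- a) [(p1, inverse x1)] q (x * x1 * x2)
      + (-1) ^ p2 * L1 * S_hurwitz (- a) [(p2, inverse x2)] q (x * x1 * x2)
      + L1 * L2 * Li_hurwitz q (x * x1 * x2) (1 - a)"
proof -
  note b = nonint_shift(2)[OF a] and ne = ne[rule_format]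
  define V where "V = x * x1 * x2"
  define z1 where "z1 = (\<lambda>n. zeta_hurwitz (Suc n) p1 (inverse x1) (- a))"
  define z2 where "z2 = (\<lambda>n. zeta_hurwitz (Suc n) p2 (inverse x2) (- a))"
  have V: "norm V = 1" "q = 1 \<Longrightarrow> V \<noteq> 1" unfolding V_def using x n ne by (auto simp: norm_mult)
  have i: "norm (inverse x1) = 1" "norm (inverse x2) = 1" "p1 = 1 \<Longrightarrow> inverse x1 \<noteq> 1" "p2 = 1 \<Longrightarrow> inverse x2 \<noteq> 1"
    using n ne by (auto simp: norm_inverse inverse_eq_1_iff)
  have g: "lerch (a - 1 - of_nat (Suc n)) p y = y ^ Suc n * ((-1) ^ p * zeta_hurwitz (Suc n) p (inverse y) (- a) + inverse y * Li_hurwitz p y a)"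
    if "p \<ge> 1" "norm y = 1" "p = 1 \<Longrightarrow> y \<noteq> 1" for p y n
  proof -
    have y0: "y \<noteq> 0" "inverse y \<noteq> 0" using that by auto
    have "inverse y * Li_hurwitz p y a = lerch (a - 1) p y"
    proof -
      have "y = 1 \<longrightarrow> p \<noteq> 1" using that(3) by blast
      then have "Li_hurwitz p y a = y * lerch (a - 1) p y"
        using that by (intro Li_hurwitz_lerch nonint_shift(1)[OF a]) auto
      then show ?thesis using y0 by simp
    qed
    moreover have "y ^ Suc n * zeta_hurwitz (Suc n) p (inverse y) (- a) = hsum (- a) p y (Suc n)"
      unfolding zeta_hurwitz_eq_hsum[OF y0(2)] using y0
      by (simp only: power_inverse inverse_inverse_eq mult.assoc[symmetric]) (simp del: power_Suc hsum.simps)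
    moreover have "lerch (a - 1 - of_nat (Suc n)) p y = (-1) ^ p * hsum (- a) p y (Suc n) + y ^ Suc n * lerch (a - 1) p y"
      using that by (intro lerch_backward a) auto
    ultimately show ?thesis by (simp only: distrib_left mult.left_commute[of "y ^ Suc n" "(-1) ^ p"])
  qed
  have g1: "lerch (a - 1 - of_nat (Suc n)) p1 x1 = x1 ^ Suc n * ((-1) ^ p1 * z1 n + L1)" for n
    unfolding L1_def z1_def by (rule g[OF p(1) n(1) ne(1)])
  have g2: "lerch (a - 1 - of_nat (Suc n)) p2 x2 = x2 ^ Suc n * ((-1) ^ p2 * z2 n + L2)" for n
    unfolding L2_def z2_def by (rule g[OF p(2) n(2) ne(2)])
  have "(\<lambda>n. (-1) ^ p1 * (-1) ^ p2 * (z1 n * z2 n * V ^ Suc n * hw (- a) q n)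
      + (-1) ^ p1 * L2 * (z1 n * V ^ Suc n * hw (- a) q n)
      + (-1) ^ p2 * L1 * (z2 n * V ^ Suc n * hw (- a) q n)
      + L1 * L2 * (V ^ Suc n * hw (- a) q n)) sums
    ((-1) ^ p1 * (-1) ^ p2 * S_hurwitz (- a) [(p1, inverse x1), (p2, inverse x2)] q V
      + (-1) ^ p1 * L2 * S_hurwitz (- a) [(p1, inverse x1)] q V
      + (-1) ^ p2 * L1 * S_hurwitz (- a) [(p2, inverse x2)] q V
      + L1 * L2 * Li_hurwitz q V (- a + 1))"
    unfolding z1_def z2_def
    by (intro sums_add sums_mult S_hurwitz_2_sums S_hurwitz_1_sums Li_hurwitz_sums b p i V)
  moreover have "(-1) ^ p1 * (-1) ^ p2 * (z1 n * z2 n * V ^ Suc n * hw (- a) q n)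
      + (-1) ^ p1 * L2 * (z1 n * V ^ Suc n * hw (- a) q n)
      + (-1) ^ p2 * L1 * (z2 n * V ^ Suc n * hw (- a) q n)
      + L1 * L2 * (V ^ Suc n * hw (- a) q n)
    = x ^ Suc n * lerch (a - 1 - of_nat (Suc n)) p1 x1 * lerch (a - 1 - of_nat (Suc n)) p2 x2 * hw (- a) q n" for n
    unfolding g1 g2 V_def power_mult_distrib by (simp add: algebra_simps del: power_Suc)
  moreover have "- a + 1 = 1 - a" by simp
  ultimately show ?thesis unfolding V_def by (simp only: sums_iff)
qed

lemma hw_add: "hw b p n * hw b q n = hw b (p + q) n"
  unfolding hw_def by (simp add: power_add)

text \<open>\<open>lerch_forward\<close> subtracts the zeta sum up to \<open>n\<close>, whereas the
  Euler sums use it up to \<open>Suc n\<close>. The compensating term \<open>hw (a - 1) p n\<close>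
  turns each factor into a trinomial, and the resulting products of weights create the sums with
  exponents \<open>p2 + q\<close>, \<open>p1 + q\<close> and \<open>p1 + p2 + q\<close>. The
  prefactor \<open>x\<close> comes from
  \<open>inverse x ^ n = x * inverse x ^ Suc n\<close>.\<close>

lemma bilateral_positive_part:
  assumes a: "a \<notin> \<int>" and x: "norm x = 1" "x \<noteq> 1" and p: "p1 \<ge> 1" "p2 \<ge> 1" "q \<ge> 1"
    and n: "norm x1 = 1" "norm x2 = 1"
    and ne: "p1 = 1 \<longrightarrow> x1 \<noteq> 1" "p2 = 1 \<longrightarrow> x2 \<noteq> 1" "q = 1 \<longrightarrow> x * x1 * x2 \<noteq> 1"
  assumes L1_def: "L1 = Li_hurwitz p1 x1 a" and L2_def: "L2 = Li_hurwitz p2 x2 a"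
  shows "(\<Sum>n. inverse x ^ n * lerch (a - 1 + of_nat n) p1 x1 * lerch (a - 1 + of_nat n) p2 x2 * hw (a - 1) q n)
    = x * (S_hurwitz (a - 1) [(p1, x1), (p2, x2)] q (inverse (x * x1 * x2))
      - L1 * S_hurwitz (a - 1) [(p2, x2)] q (inverse (x * x1 * x2))
      - L2 * S_hurwitz (a - 1) [(p1, x1)] q (inverse (x * x1 * x2))
      + L1 * L2 * Li_hurwitz q (inverse (x * x1 * x2)) a
      + (L1 * Li_hurwitz (p2 + q) (inverse (x * x1)) a - S_hurwitz (a - 1) [(p1, x1)] (p2 + q) (inverse (x * x1)))
      + (L2 * Li_hurwitz (p1 + q) (inverse (x * x2)) a - S_hurwitz (a - 1) [(p2, x2)] (p1 + q) (inverse (x * x2)))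
      + Li_hurwitz (p1 + p2 + q) (inverse x) a)"
proof -
  note b = nonint_shift(1)[OF a] and ne = ne[rule_format]
  define h where "h = hw (a - 1)"
  define V where "V = inverse (x * x1 * x2)"
  define V1 where "V1 = inverse (x * x1)"
  define V2 where "V2 = inverse (x * x2)"
  define z1 where "z1 = (\<lambda>n. zeta_hurwitz (Suc n) p1 x1 (a - 1))"
  define z2 where "z2 = (\<lambda>n. zeta_hurwitz (Suc n) p2 x2 (a - 1))"
  have nz: "x \<noteq> 0" "x1 \<noteq> 0" "x2 \<noteq> 0" using x n by auto
  have V: "norm V = 1" "norm V1 = 1" "norm V2 = 1" "norm (inverse x) = 1" "q = 1 \<Longrightarrow> V \<noteq> 1"
    "p2 + q = 1 \<Longrightarrow> V1 \<noteq> 1" "p1 + q = 1 \<Longrightarrow> V2 \<noteq> 1" "p1 + p2 + q = 1 \<Longrightarrow> inverse x \<noteq> 1"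
    unfolding V_def V1_def V2_def using x n ne p by (auto simp only: norm_mult norm_inverse inverse_eq_1_iff)
  have pq: "p2 + q \<ge> 1" "p1 + q \<ge> 1" "p1 + p2 + q \<ge> 1" using p by auto
  have g: "lerch (a - 1 + of_nat n) p y = inverse y ^ Suc n * (Li_hurwitz p y a - zeta_hurwitz (Suc n) p y (a - 1)) + hw (a - 1) p n"
    if "p \<ge> 1" "norm y = 1" "p = 1 \<Longrightarrow> y \<noteq> 1" for p y n
  proof -
    have y0: "y \<noteq> 0" using that by auto
    have Li: "Li_hurwitz p y a = y * lerch (a - 1) p y"
      using that by (intro Li_hurwitz_lerch b) auto
    have "y ^ Suc n * lerch (a - 1 + of_nat n) p y = y * lerch (a - 1) p y - zeta_hurwitz n p y (a - 1)"
      using that by (intro lerch_forward b) auto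
    moreover have "zeta_hurwitz (Suc n) p y (a - 1) = zeta_hurwitz n p y (a - 1) + y ^ Suc n * hw (a - 1) p n"
      unfolding zeta_hurwitz_def hw_def by simp
    ultimately have "y ^ Suc n * lerch (a - 1 + of_nat n) p y = Li_hurwitz p y a - zeta_hurwitz (Suc n) p y (a - 1) + y ^ Suc n * hw (a - 1) p n"
      unfolding Li by (simp only:) simp
    moreover have "lerch (a - 1 + of_nat n) p y = inverse y ^ Suc n * (y ^ Suc n * lerch (a - 1 + of_nat n) p y)"
      using y0 by (simp only: power_inverse mult.assoc[symmetric]) (simp del: power_Suc)
    moreover have "inverse y ^ Suc n * (y ^ Suc n * hw (a - 1) p n) = hw (a - 1) p n"
      using y0 by (simp only: power_inverse mult.assoc[symmetric]) (simp del: power_Suc)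
    ultimately show ?thesis by (simp only: distrib_left)
  qed
  have "(\<lambda>n. x * (z1 n * z2 n * V ^ Suc n * h q n - L1 * (z2 n * V ^ Suc n * h q n) - L2 * (z1 n * V ^ Suc n * h q n)
      + L1 * L2 * (V ^ Suc n * h q n)
      + (L1 * (V1 ^ Suc n * h (p2 + q) n) - z1 n * V1 ^ Suc n * h (p2 + q) n)
      + (L2 * (V2 ^ Suc n * h (p1 + q) n) - z2 n * V2 ^ Suc n * h (p1 + q) n)
      + inverse x ^ Suc n * h (p1 + p2 + q) n)) sums
    (x * (S_hurwitz (a - 1) [(p1, x1), (p2, x2)] q V
      - L1 * S_hurwitz (a - 1) [(p2, x2)] q V
      - L2 * S_hurwitz (a - 1) [(p1, x1)] q V
      + L1 * L2 * Li_hurwitz q V (a - 1 + 1)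
      + (L1 * Li_hurwitz (p2 + q) V1 (a - 1 + 1) - S_hurwitz (a - 1) [(p1, x1)] (p2 + q) V1)
      + (L2 * Li_hurwitz (p1 + q) V2 (a - 1 + 1) - S_hurwitz (a - 1) [(p2, x2)] (p1 + q) V2)
      + Li_hurwitz (p1 + p2 + q) (inverse x) (a - 1 + 1)))"
    unfolding z1_def z2_def h_def
    by (intro sums_add sums_diff sums_mult S_hurwitz_2_sums S_hurwitz_1_sums Li_hurwitz_sums b p pq V n ne)
  moreover have "x * (z1 n * z2 n * V ^ Suc n * h q n - L1 * (z2 n * V ^ Suc n * h q n) - L2 * (z1 n * V ^ Suc n * h q n)
      + L1 * L2 * (V ^ Suc n * h q n)
      + (L1 * (V1 ^ Suc n * h (p2 + q) n) - z1 n * V1 ^ Suc n * h (p2 + q) n)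
      + (L2 * (V2 ^ Suc n * h (p1 + q) n) - z2 n * V2 ^ Suc n * h (p1 + q) n)
      + inverse x ^ Suc n * h (p1 + p2 + q) n)
    = inverse x ^ n * lerch (a - 1 + of_nat n) p1 x1 * lerch (a - 1 + of_nat n) p2 x2 * hw (a - 1) q n" for n
  proof -
    define X X1 X2 where "X = inverse x ^ Suc n" and "X1 = inverse x1 ^ Suc n" and "X2 = inverse x2 ^ Suc n"
    have Vs: "V ^ Suc n = X * X1 * X2" "V1 ^ Suc n = X * X1" "V2 ^ Suc n = X * X2"
      unfolding V_def V1_def V2_def X_def X1_def X2_def inverse_mult_distrib power_mult_distrib by simp_all
    have hs: "h (p2 + q) n = h p2 n * h q n" "h (p1 + q) n = h p1 n * h q n" "h (p1 + p2 + q) n = h p1 n * h p2 n * h q n"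
      unfolding h_def by (simp_all only: hw_add)
    have xx: "inverse x ^ n = x * X" unfolding X_def using nz by simp
    have g1: "lerch (a - 1 + of_nat n) p1 x1 = X1 * (L1 - z1 n) + h p1 n"
      unfolding X1_def L1_def z1_def h_def by (rule g[OF p(1) n(1) ne(1)])
    have g2: "lerch (a - 1 + of_nat n) p2 x2 = X2 * (L2 - z2 n) + h p2 n"
      unfolding X2_def L2_def z2_def h_def by (rule g[OF p(2) n(2) ne(2)])
    show ?thesis
      unfolding g1 g2 Vs hs xx X_def[symmetric] h_def[symmetric] by (simp add: algebra_simps)
  qed
  moreover have "a - 1 + 1 = a" by simp
  ultimately show ?thesis unfolding V_def V1_def V2_def by (simp only: sums_iff)
qed

section \<open>Finite index sums and Euler sums in the notation of the theorem\<close>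

lemma sum_antidiagonal:
  "(\<Sum>(m, k) \<in> {(m, k). m + k = N}. f m k) = (\<Sum>m<Suc N. f m (N - m) :: complex)"
  by (rule sum.reindex_bij_witness[where i = "\<lambda>m. (m, N - m)" and j = fst]) auto

lemma sum_triangle:
  "(\<Sum>(m, k) \<in> {(m, k). m + k \<le> N}. f m k) = (\<Sum>m<Suc N. \<Sum>k\<le>N - m. f m k :: complex)"
proof -
  have "{(m, k). m + k \<le> N} = (SIGMA m:{..<Suc N}. {..N - m})" by auto
  then show ?thesis by (simp only:) (subst sum.Sigma, auto)
qed

lemma sum_antidiagonal_3:
  "(\<Sum>(m, k, l) \<in> {(m, k, l). m + k + l = N}. f m k l) = (\<Sum>m<Suc N. \<Sum>k\<le>N - m. f m k (N - m - k) :: complex)"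
proof -
  have "(\<Sum>(m, k, l) \<in> {(m, k, l). m + k + l = N}. f m k l)
      = (\<Sum>(m, k) \<in> {(m, k). m + k \<le> N}. f m k (N - m - k))"
    by (rule sum.reindex_bij_witness[where i = "\<lambda>(m, k). (m, k, N - m - k)" and j = "\<lambda>(m, k, l). (m, k)"]) auto
  then show ?thesis by (simp only: sum_triangle)
qed

lemma mixed_sum_eq_S_cyc:
  assumes "y \<noteq> 0"
  shows "mixed_sum P Q y v = S_cyc P Q (inverse y) (y * v)"
proof -
  have "zeta_cyc (Suc n) P (inverse y) / of_nat (Suc n) ^ Q * (y * v) ^ Suc n = v ^ Suc n * hsum 0 P y (Suc n) * hw 0 Q n" for n
  proof -
    have "zeta_cyc (Suc n) P (inverse y) = inverse y ^ Suc n * hsum 0 P (inverse (inverse y)) (Suc n)"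
      using zeta_hurwitz_eq_hsum[of "inverse y" "Suc n" P 0] assms
      unfolding zeta_cyc_def zeta_hurwitz_def by (simp only: add_0_right) simp
    moreover have "inverse y ^ Suc n * y ^ Suc n = 1"
      using assms by (simp flip: power_mult_distrib del: power_Suc)
    ultimately show ?thesis unfolding hw_0 power_mult_distrib inverse_inverse_eq
      by (metis (no_types, lifting) mult.assoc mult.commute mult.left_neutral times_divide_eq_left times_divide_eq_right mult_1_right)
  qed
  then show ?thesis unfolding mixed_sum_def S_cyc_def by presburger
qed

lemma off_sum_eq:
  assumes p: "p1 \<ge> 1" "p2 \<ge> 1" "q \<ge> 1" and y: "y \<noteq> 0" and v: "y * v = w"
  shows "(\<Sum>m<p2. (\<Sum>k\<le>p2 - 1 - m. off_coeff p1 q y v k (p2 - 1 - m - k)) * C m)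
    = (-1) ^ q * (\<Sum>(m, k) \<in> {(m, k). m + k \<le> p2 - 1}.
        of_nat ((k + p1 - 1) choose (p1 - 1)) * of_nat ((p2 + q - m - k - 2) choose (q - 1)) * C m
          * ((-1) ^ k * Li (k + p1) y * Li (p2 + q - m - k - 1) w
             + (-1) ^ p1 * S_cyc (k + p1) (p2 + q - m - k - 1) (inverse y) w))"
proof -
  have S: "Suc (p2 - 1) = p2" using p by simp
  show ?thesis unfolding sum_triangle S sum_distrib_left sum_distrib_right
  proof (intro sum.cong refl)
    fix m k assume mk: "m \<in> {..<p2}" "k \<in> {..p2 - 1 - m}"
    \<comment> \<open>No subtraction truncates: \<open>m + k \<le> p2 - 1\<close> and
      \<open>q \<ge> 1\<close> keep even \<open>p2 + q - m - k - 2\<close> exact.\<close>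
    have "p2 - 1 - m - k + q = p2 + q - m - k - 1" "p2 - 1 - m - k + q - 1 = p2 + q - m - k - 2"
      using mk p by auto
    then show "off_coeff p1 q y v k (p2 - 1 - m - k) * C m = (-1) ^ q * (
        of_nat ((k + p1 - 1) choose (p1 - 1)) * of_nat ((p2 + q - m - k - 2) choose (q - 1)) * C m
          * ((-1) ^ k * Li (k + p1) y * Li (p2 + q - m - k - 1) w
             + (-1) ^ p1 * S_cyc (k + p1) (p2 + q - m - k - 1) (inverse y) w))"
      unfolding off_coeff_def mixed_sum_eq_S_cyc[OF y] v by (simp only: mult_ac)
  qed
qed

lemma residue_total_eq:
  assumes p: "p1 \<ge> 1" "p2 \<ge> 1" "q \<ge> 1" and x: "x1 \<noteq> 0" "x2 \<noteq> 0"
  shows "residue_total x a p1 p2 q x1 x2 = C_coeff x a (p1 + p2 + q - 1)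
     + (\<Sum>(m, k) \<in> {(m, k). m + k = p1 + q - 1}.
          (-1) ^ k * of_nat ((k + p2 - 1) choose (p2 - 1)) * Li (k + p2) x2 * C_coeff x a m)
     + (\<Sum>(m, k) \<in> {(m, k). m + k = p2 + q - 1}.
          (-1) ^ k * of_nat ((k + p1 - 1) choose (p1 - 1)) * Li (k + p1) x1 * C_coeff x a m)
     + (-1) ^ q
         * (\<Sum>m = 0..p1 + p2 - 1. of_nat ((p1 + p2 + q - m - 2) choose (q - 1))
              * C_coeff x a m * Li (p1 + p2 + q - m - 1) (x * x1 * x2))
     + (\<Sum>(m, k1, k2) \<in> {(m, k1, k2). m + k1 + k2 = q - 1}.
          (-1) ^ (k1 + k2) * of_nat ((k1 + p1 - 1) choose (p1 - 1))
            * of_nat ((k2 + p2 - 1) choose (p2 - 1))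
            * Li (k1 + p1) x1 * Li (k2 + p2) x2 * C_coeff x a m)
     + (-1) ^ q
         * (\<Sum>(m, k) \<in> {(m, k). m + k \<le> p2 - 1}.
              of_nat ((k + p1 - 1) choose (p1 - 1))
                * of_nat ((p2 + q - m - k - 2) choose (q - 1)) * C_coeff x a m
                * ((-1) ^ k * Li (k + p1) x1 * Li (p2 + q - m - k - 1) (x * x1 * x2)
                   + (-1) ^ p1 * S_cyc (k + p1) (p2 + q - m - k - 1) (inverse x1) (x * x1 * x2)))
     + (-1) ^ q
         * (\<Sum>(m, k) \<in> {(m, k). m + k \<le> p1 - 1}.
              of_nat ((k + p2 - 1) choose (p2 - 1))
                * of_nat ((p1 + q - m - k - 2) choose (q - 1)) * C_coeff x a m
                * ((-1) ^ k * Li (k + p2) x2 * Li (p1 + q - m - k - 1) (x * x1 * x2)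
                   + (-1) ^ p2 * S_cyc (k + p2) (p1 + q - m - k - 1) (inverse x2) (x * x1 * x2)))"
proof -
  have S: "Suc (p1 + q - 1) = p1 + q" "Suc (p2 + q - 1) = p2 + q" "Suc (q - 1) = q" using p by auto
  have diag: "(\<Sum>m<p1 + p2. (-1) ^ q * of_nat ((p1 + p2 - 1 - m + q - 1) choose (q - 1))
        * Li (p1 + p2 - 1 - m + q) (x1 * x2 * x) * C_coeff x a m)
      = (-1) ^ q * (\<Sum>m = 0..p1 + p2 - 1. of_nat ((p1 + p2 + q - m - 2) choose (q - 1))
              * C_coeff x a m * Li (p1 + p2 + q - m - 1) (x * x1 * x2))"
    unfolding sum_distrib_left
  proof (intro sum.cong)
    show "{..<p1 + p2} = {0..p1 + p2 - 1}" using p by auto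
    fix m assume "m \<in> {0..p1 + p2 - 1}"
    then have "p1 + p2 - 1 - m + q = p1 + p2 + q - m - 1" "p1 + p2 - 1 - m + q - 1 = p1 + p2 + q - m - 2"
      using p by auto
    then show "(-1) ^ q * of_nat ((p1 + p2 - 1 - m + q - 1) choose (q - 1))
        * Li (p1 + p2 - 1 - m + q) (x1 * x2 * x) * C_coeff x a m
      = (-1) ^ q * (of_nat ((p1 + p2 + q - m - 2) choose (q - 1))
              * C_coeff x a m * Li (p1 + p2 + q - m - 1) (x * x1 * x2))"
      by (simp only: mult_ac)
  qed
  have triple: "(\<Sum>m<q. (\<Sum>k\<le>q - 1 - m. Li_coeff p1 x1 k * Li_coeff p2 x2 (q - 1 - m - k)) * C_coeff x a m)
      = (\<Sum>(m, k1, k2) \<in> {(m, k1, k2). m + k1 + k2 = q - 1}.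
          (-1) ^ (k1 + k2) * of_nat ((k1 + p1 - 1) choose (p1 - 1))
            * of_nat ((k2 + p2 - 1) choose (p2 - 1))
            * Li (k1 + p1) x1 * Li (k2 + p2) x2 * C_coeff x a m)"
    unfolding sum_antidiagonal_3 S Li_coeff_def sum_distrib_right power_add
    by (intro sum.cong refl) (simp only: mult_ac)
  have off1: "x1 * (x2 * x) = x * x1 * x2" and off2: "x2 * (x1 * x) = x * x1 * x2" by simp_all
  show ?thesis
    unfolding residue_total_def diag triple off_sum_eq[OF p x(1) off1] off_sum_eq[OF p(2,1,3) x(2) off2]
      sum_antidiagonal S
    unfolding Li_coeff_def by (simp only: add_ac)
qed

lemma root_of_unity_norm:
  assumes "root_of_unity w"
  shows "norm w = 1"
proof -
  obtain n where n: "n > 0" "w ^ n = 1" using assms unfolding root_of_unity_def by blast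
  then show ?thesis using power_eq_1_iff[OF n(2)] by simp
qed

theorem theorem3p7:
  fixes x x1 x2 a :: complex and p1 p2 q :: nat
  assumes "root_of_unity x" and "root_of_unity x1" and "root_of_unity x2"
    and "x \<noteq> 1"
    and "a \<notin> \<int>"
    and "p1 \<ge> 1" and "p2 \<ge> 1" and "q \<ge> 1"
    and "(p1, x1) \<noteq> (1, 1)" and "(p2, x2) \<noteq> (1, 1)" and "(q, x * x1 * x2) \<noteq> (1, 1)"
  shows
    "x * S_hurwitz (a - 1) [(p1, x1), (p2, x2)] q (inverse (x * x1 * x2))
     + (-1) ^ (p1 + p2 + q)
         * S_hurwitz (- a) [(p1, inverse x1), (p2, inverse x2)] q (x * x1 * x2)
     = x * S_hurwitz (a - 1) [(p1, x1)] (p2 + q) (inverse (x * x1))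
     + x * S_hurwitz (a - 1) [(p2, x2)] (p1 + q) (inverse (x * x2))
     + x * Li_hurwitz p1 x1 a * S_hurwitz (a - 1) [(p2, x2)] q (inverse (x * x1 * x2))
     + x * Li_hurwitz p2 x2 a * S_hurwitz (a - 1) [(p1, x1)] q (inverse (x * x1 * x2))
     - (-1) ^ (p2 + q) * inverse x1 * Li_hurwitz p1 x1 a
         * S_hurwitz (- a) [(p2, inverse x2)] q (x * x1 * x2)
     - (-1) ^ (p1 + q) * inverse x2 * Li_hurwitz p2 x2 a
         * S_hurwitz (- a) [(p1, inverse x1)] q (x * x1 * x2)
     + (-1) ^ (p1 + p2 + q) * Li_hurwitz (p1 + p2 + q) x (1 - a)
     - x * Li_hurwitz p1 x1 a * Li_hurwitz (p2 + q) (inverse (x * x1)) a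
     - x * Li_hurwitz p2 x2 a * Li_hurwitz (p1 + q) (inverse (x * x2)) a
     - x * Li_hurwitz p1 x1 a * Li_hurwitz p2 x2 a * Li_hurwitz q (inverse (x * x1 * x2)) a
     - (-1) ^ q * inverse (x1 * x2) * Li_hurwitz p1 x1 a * Li_hurwitz p2 x2 a
         * Li_hurwitz q (x * x1 * x2) (1 - a)
     - (\<Sum>(m, k) \<in> {(m, k). m + k = p1 + q - 1}.
          (-1) ^ k * of_nat ((k + p2 - 1) choose (p2 - 1)) * Li (k + p2) x2 * C_coeff x a m)
     - (\<Sum>(m, k) \<in> {(m, k). m + k = p2 + q - 1}.
          (-1) ^ k * of_nat ((k + p1 - 1) choose (p1 - 1)) * Li (k + p1) x1 * C_coeff x a m)
     - (-1) ^ q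
         * (\<Sum>m = 0..p1 + p2 - 1. of_nat ((p1 + p2 + q - m - 2) choose (q - 1))
              * C_coeff x a m * Li (p1 + p2 + q - m - 1) (x * x1 * x2))
     - (\<Sum>(m, k1, k2) \<in> {(m, k1, k2). m + k1 + k2 = q - 1}.
          (-1) ^ (k1 + k2) * of_nat ((k1 + p1 - 1) choose (p1 - 1))
            * of_nat ((k2 + p2 - 1) choose (p2 - 1))
            * Li (k1 + p1) x1 * Li (k2 + p2) x2 * C_coeff x a m)
     - (-1) ^ q
         * (\<Sum>(m, k) \<in> {(m, k). m + k \<le> p2 - 1}.
              of_nat ((k + p1 - 1) choose (p1 - 1))
                * of_nat ((p2 + q - m - k - 2) choose (q - 1)) * C_coeff x a m
                * ((-1) ^ k * Li (k + p1) x1 * Li (p2 + q - m - k - 1) (x * x1 * x2)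
                   + (-1) ^ p1 * S_cyc (k + p1) (p2 + q - m - k - 1) (inverse x1) (x * x1 * x2)))
     - (-1) ^ q
         * (\<Sum>(m, k) \<in> {(m, k). m + k \<le> p1 - 1}.
              of_nat ((k + p2 - 1) choose (p2 - 1))
                * of_nat ((p1 + q - m - k - 2) choose (q - 1)) * C_coeff x a m
                * ((-1) ^ k * Li (k + p2) x2 * Li (p1 + q - m - k - 1) (x * x1 * x2)
                   + (-1) ^ p2 * S_cyc (k + p2) (p1 + q - m - k - 1) (inverse x2) (x * x1 * x2)))"
proof -
  have n: "norm x = 1" "norm x1 = 1" "norm x2 = 1" using assms(1-3) root_of_unity_norm by auto
  then have nz: "x1 \<noteq> 0" "x2 \<noteq> 0" by auto
  have ne: "p1 = 1 \<longrightarrow> x1 \<noteq> 1" "p2 = 1 \<longrightarrow> x2 \<noteq> 1" "q = 1 \<longrightarrow> x * x1 * x2 \<noteq> 1"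
    "q = 1 \<longrightarrow> x1 * x2 * x \<noteq> 1" using assms(9-11) by (auto simp: mult_ac)
  note p = \<open>p1 \<ge> 1\<close> \<open>p2 \<ge> 1\<close> \<open>q \<ge> 1\<close>
  \<comment> \<open>The corner \<open>i = j = 0\<close> contributes this coefficient. Its part at
    \<open>inverse x\<close> cancels the last term of the positive half, and its other part is the
    term \<open>Li_hurwitz (p1 + p2 + q) x (1 - a)\<close> of the claim.\<close>
  have C: "C_coeff x a (p1 + p2 + q - 1)
      = - ((-1) ^ (p1 + p2 + q) * Li_hurwitz (p1 + p2 + q) x (1 - a)) - x * Li_hurwitz (p1 + p2 + q) (inverse x) a"
  proof -
    obtain P where P: "p1 + p2 + q = Suc P" using p by (cases "p1 + p2 + q") auto
    show ?thesis unfolding C_coeff_def P by simp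
  qed
  note pos = bilateral_positive_part[OF assms(5) n(1) assms(4) p n(2,3) ne(1-3) refl refl]
  note neg = bilateral_negative_part[OF assms(5) n(1) p n(2,3) ne(1-3) refl refl]
  have "bilateral_sum x a p1 p2 q x1 x2 + residue_total x a p1 p2 q x1 x2 = 0"
    using bilateral_sum_eq_residue_total[OF n(1) assms(4,5) p n(2,3)] ne by simp
  \<comment> \<open>Once both halves and the residues are expanded, the vanishing sum is the
    difference of the two sides of the claim.\<close>
  then show ?thesis
    unfolding bilateral_sum_def residue_total_eq[OF p nz] C pos neg
    by - (rule iffD2[OF eq_iff_diff_eq_0], erule trans[rotated], simp add: power_add algebra_simps)
qed

end
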